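(* Let $\mathcal{Q}$ be a small quantaloid. The quantaloid homomorphism $\hat{\mathsf K}:\mathbf{Arr}(\mathcal{Q}\text{-}\mathbf{Dist})\to\mathcal{Q}\text{-}\mathbf{IntDist}$ is a left inverse of the quantaloid homomorphism $\hat{\mathsf I}:\mathcal{Q}\text{-}\mathbf{IntDist}\to\mathbf{Arr}(\mathcal{Q}\text{-}\mathbf{Dist})$ (i.e. $\hat{\mathsf K}\hat{\mathsf I}$ is the identity on $\mathcal{Q}\text{-}\mathbf{IntDist}$); hence, the quantaloid $\mathcal{Q}\text{-}\mathbf{IntDist}$ is a retract of the quantaloid $\mathbf{Arr}(\mathcal{Q}\text{-}\mathbf{Dist})$.
   Context: **Quantaloids.** A quantaloid is a (possibly large) category whose hom-sets are complete lattices and whose composition preserves arbitrary joins in each variable. For arrows $u:p\to q$, $v:q\to r$, $w:p\to r$ the arrows $w\swarrow u:q\to r$ and $v\searrow w:p\to q$ are determined by $v\circ u\le w\iff v\le w\swarrow u\iff u\le v\searrow w$. A homomorphism of quantaloids is a functor between the underlying categories that preserves joins of arrows. A quantaloid is small if its objects form a set. Throughout, $\mathcal{Q}$ is a small quantaloid. **$\mathcal{Q}$-categories and $\mathcal{Q}$-distributors.** A $\mathcal{Q}$-category $X$ is a set $X$ with a type map $|\cdot|:X\to\mathrm{ob}\,\mathcal{Q}$ and hom-arrows $1_X^\natural(x,y)\in\mathcal{Q}(|x|,|y|)$ with $1_{|x|}\le 1_X^\natural(x,x)$ and $1_X^\natural(y,z)\circ 1_X^\natural(x,y)\le 1_X^\natural(x,z)$.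 Its underlying preorder is $x\le y\iff |x|=|y|$ and $1_{|x|}\le 1_X^\natural(x,y)$. A $\mathcal{Q}$-functor $f:X\to Y$ is a type-preserving map with $1_X^\natural(x,y)\le 1_Y^\natural(fx,fy)$; $\mathcal{Q}$-functors are ordered pointwise. A $\mathcal{Q}$-distributor $\phi:X\nrightarrow Y$ is a family $\phi(x,y)\in\mathcal{Q}(|x|,|y|)$ with $1_Y^\natural(y,y')\circ\phi(x,y)\circ 1_X^\natural(x',x)\le\phi(x',y')$. $\mathcal{Q}$-categories and $\mathcal{Q}$-distributors form a quantaloid $\mathcal{Q}\text{-}\mathbf{Dist}$ with pointwise order, $(\psi\circ\phi)(x,z)=\bigvee_y\psi(y,z)\circ\phi(x,y)$, identities $1_X^\natural$, and $(\xi\swarrow\phi)(y,z)=\bigwedge_x\xi(x,z)\swarrow\phi(x,y)$. The cograph of a $\mathcal{Q}$-functor $f:X\to Y$ is $f^\natural:Y\nrightarrow X$, $f^\natural(y,x)=1_Y^\natural(y,fx)$. **Presheaves and Kan adjunctions.** $\{q\}$ is the one-object $\mathcal{Q}$-category of type $q$ with hom $1_q$. $\mathsf{P}X$ is the $\mathcal{Q}$-category of all $\mathcal{Q}$-distributors $\mu:X\nrightarrow\{q\}$ (of type $q$; $q\in\mathrm{ob}\,\mathcal{Q}$), with $1_{\mathsf{P}X}^\natural(\mu,\mu')=\mu'\swarrow\mu$; write $\mu(x)$ for its values. Each $\phi:X\nrightarrow Y$ induces an adjunction $\phi^*\dashv\phi_*$ of $\mathcal{Q}$-functors, $\phi^*:\mathsf{P}Y\to\mathsf{P}X$,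 $\phi^*\lambda=\lambda\circ\phi$, and $\phi_*:\mathsf{P}X\to\mathsf{P}Y$, $\phi_*\mu=\mu\swarrow\phi$. **Interior spaces.** A $\mathcal{Q}$-interior space $(X,a)$ is a $\mathcal{Q}$-category $X$ with a $\mathcal{Q}$-functor $a:\mathsf{P}X\to\mathsf{P}X$ such that $a\le 1_{\mathsf{P}X}$ and $aa=a$. $\mathcal{O}(X,a)=\{\mu\in\mathsf{P}X\mid a\mu=\mu\}$ is regarded as a full $\mathcal{Q}$-subcategory of $\mathsf{P}X$. A continuous $\mathcal{Q}$-distributor $\zeta:(X,a)\nrightarrow(Y,b)$ is a $\mathcal{Q}$-distributor $\zeta:X\nrightarrow Y$ with $\zeta^*b\le a\zeta^*$. $\mathcal{Q}\text{-}\mathbf{IntDist}$ is the quantaloid of $\mathcal{Q}$-interior spaces and continuous $\mathcal{Q}$-distributors (order, composition and identities as in $\mathcal{Q}\text{-}\mathbf{Dist}$). **Arrow quantaloid and the homomorphisms.** $\mathbf{Arr}(\mathcal{Q}\text{-}\mathbf{Dist})$ is the quantaloid with $\mathcal{Q}$-distributors as objects; arrows from $\phi:X\nrightarrow Y$ to $\psi:X'\nrightarrow Y'$ are pairs $(\zeta:X\nrightarrow X',\eta:Y\nrightarrow Y')$ with $\psi\circ\zeta=\eta\circ\phi$, composed and ordered componentwise. The quantaloid homomorphism $\hat{\mathsf K}$ sends $\phi:X\nrightarrow Y$ to $(X,\phi^*\phi_* )$ and $(\zeta,\eta):\phi\to\psi$ to $\zeta:(X,\phi^*\phi_* )\nrightarrow(X',\psi^*\psi_*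 )$. The quantaloid homomorphism $\hat{\mathsf I}$ sends $(X,a)$ to the $\mathcal{Q}$-distributor $\kappa_a:X\nrightarrow\mathcal{O}(X,a)$, $\kappa_a(x,\mu)=\mu(x)$, and a continuous $\zeta:(X,a)\nrightarrow(Y,b)$ to $(\zeta,(\zeta^* )^\natural|_{\mathcal{O}(X,a),\mathcal{O}(Y,b)}):\kappa_a\to\kappa_b$, where $(\zeta^* )^\natural:\mathsf{P}X\nrightarrow\mathsf{P}Y$ is the cograph of $\zeta^*:\mathsf{P}Y\to\mathsf{P}X$, restricted to the indicated subcategories.
   Formalization: Î is not a quantaloid homomorphism for nontrivial Q (it fails to preserve the empty join at the empty space), so Î is shown only to be a functor monotone on hom-sets, and "retract" means a monotone functor as section with a quantaloid homomorphism as retraction. *)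

theory Defs
  imports "HOL-Algebra.Complete_Lattice"
begin

section \<open>Quantaloids\<close>

text \<open>Hom-sets are given as a family of ordered sets indexed by source and target and are not
  required to be disjoint; hence composition and identities carry their objects as indices.
  For \<open>u : p \<rightarrow> q\<close> and \<open>v : q \<rightarrow> r\<close>, the arrow \<open>v \<circ> u\<close> is \<open>comp Q p q r v u\<close>.
  The object and arrow types are arbitrary, so the same notion serves for the small base
  quantaloid \<open>Q\<close> and for the quantaloids of categories, spaces and distributors built from it.\<close>

record ('o, 'm) quantaloid =
  ob :: "'o set"
  hom :: "'o \<Rightarrow> 'o \<Rightarrow> 'm gorder"
  comp :: "'o \<Rightarrow> 'o \<Rightarrow> 'o \<Rightarrow> 'm \<Rightarrow> 'm \<Rightarrow> 'm"
  ident :: "'o \<Rightarrow> 'm"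

locale quantaloid =
  fixes Q :: "('o, 'm) quantaloid"
  assumes hom_complete_lattice:
      "\<lbrakk>p \<in> ob Q; q \<in> ob Q\<rbrakk> \<Longrightarrow> complete_lattice (hom Q p q)"
    and ident_closed: "p \<in> ob Q \<Longrightarrow> ident Q p \<in> carrier (hom Q p p)"
    and comp_closed:
      "\<lbrakk>p \<in> ob Q; q \<in> ob Q; r \<in> ob Q; u \<in> carrier (hom Q p q); v \<in> carrier (hom Q q r)\<rbrakk>
        \<Longrightarrow> comp Q p q r v u \<in> carrier (hom Q p r)"
    and comp_assoc:
      "\<lbrakk>p \<in> ob Q; q \<in> ob Q; r \<in> ob Q; s \<in> ob Q; u \<in> carrier (hom Q p q);
        v \<in> carrier (hom Q q r); w \<in> carrier (hom Q r s)\<rbrakk>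
        \<Longrightarrow> comp Q p q s (comp Q q r s w v) u = comp Q p r s w (comp Q p q r v u)"
    and comp_ident_left:
      "\<lbrakk>p \<in> ob Q; q \<in> ob Q; u \<in> carrier (hom Q p q)\<rbrakk> \<Longrightarrow> comp Q p q q (ident Q q) u = u"
    and comp_ident_right:
      "\<lbrakk>p \<in> ob Q; q \<in> ob Q; u \<in> carrier (hom Q p q)\<rbrakk> \<Longrightarrow> comp Q p p q u (ident Q p) = u"
    and comp_Sup_left:
      "\<lbrakk>p \<in> ob Q; q \<in> ob Q; r \<in> ob Q; u \<in> carrier (hom Q p q); V \<subseteq> carrier (hom Q q r)\<rbrakk>
        \<Longrightarrow> comp Q p q r (\<Squnion>\<^bsub>hom Q q r\<^esub> V) u = \<Squnion>\<^bsub>hom Q p r\<^esub> ((\<lambda>v. comp Q p q r v u) ` V)"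
    and comp_Sup_right:
      "\<lbrakk>p \<in> ob Q; q \<in> ob Q; r \<in> ob Q; U \<subseteq> carrier (hom Q p q); v \<in> carrier (hom Q q r)\<rbrakk>
        \<Longrightarrow> comp Q p q r v (\<Squnion>\<^bsub>hom Q p q\<^esub> U) = \<Squnion>\<^bsub>hom Q p r\<^esub> ((\<lambda>u. comp Q p q r v u) ` U)"

text \<open>For \<open>u : p \<rightarrow> q\<close> and \<open>w : p \<rightarrow> r\<close>, the arrow \<open>w \<swarrow> u : q \<rightarrow> r\<close>.\<close>

definition lres :: "('o, 'm) quantaloid \<Rightarrow> 'o \<Rightarrow> 'o \<Rightarrow> 'o \<Rightarrow> 'm \<Rightarrow> 'm \<Rightarrow> 'm" where
  "lres Q p q r w u =
    (THE z. z \<in> carrier (hom Q q r) \<and>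
      (\<forall>v\<in>carrier (hom Q q r). comp Q p q r v u \<sqsubseteq>\<^bsub>hom Q p r\<^esub> w \<longleftrightarrow> v \<sqsubseteq>\<^bsub>hom Q q r\<^esub> z))"


section \<open>Functors and homomorphisms\<close>

record ('o, 'm, 'p, 'n) functr =
  omap :: "'o \<Rightarrow> 'p"
  amap :: "'o \<Rightarrow> 'o \<Rightarrow> 'm \<Rightarrow> 'n"

locale quantaloid_functor = dom: quantaloid A + cod: quantaloid B
  for A :: "('o, 'm) quantaloid" and B :: "('p, 'n) quantaloid"
    and F :: "('o, 'm, 'p, 'n) functr" +
  assumes omap_closed: "p \<in> ob A \<Longrightarrow> omap F p \<in> ob B"
    and amap_closed:
      "\<lbrakk>p \<in> ob A; q \<in> ob A; u \<in> carrier (hom A p q)\<rbrakk>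
        \<Longrightarrow> amap F p q u \<in> carrier (hom B (omap F p) (omap F q))"
    and amap_ident: "p \<in> ob A \<Longrightarrow> amap F p p (ident A p) = ident B (omap F p)"
    and amap_comp:
      "\<lbrakk>p \<in> ob A; q \<in> ob A; r \<in> ob A; u \<in> carrier (hom A p q); v \<in> carrier (hom A q r)\<rbrakk>
        \<Longrightarrow> amap F p r (comp A p q r v u) =
            comp B (omap F p) (omap F q) (omap F r) (amap F q r v) (amap F p q u)"

locale monotone_functor = quantaloid_functor +
  assumes amap_mono:
    "\<lbrakk>p \<in> ob A; q \<in> ob A; u \<in> carrier (hom A p q); v \<in> carrier (hom A p q);
      u \<sqsubseteq>\<^bsub>hom A p q\<^esub> v\<rbrakk>
      \<Longrightarrow> amap F p q u \<sqsubseteq>\<^bsub>hom B (omap F p) (omap F q)\<^esub> amap F p q v"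

locale quantaloid_hom = quantaloid_functor +
  assumes amap_Sup:
    "\<lbrakk>p \<in> ob A; q \<in> ob A; U \<subseteq> carrier (hom A p q)\<rbrakk>
      \<Longrightarrow> amap F p q (\<Squnion>\<^bsub>hom A p q\<^esub> U) = \<Squnion>\<^bsub>hom B (omap F p) (omap F q)\<^esub> (amap F p q ` U)"

definition functor_comp ::
  "('p, 'n, 'r, 'k) functr \<Rightarrow> ('o, 'm, 'p, 'n) functr \<Rightarrow> ('o, 'm, 'r, 'k) functr" where
  "functor_comp G F =
    \<lparr>omap = \<lambda>p. omap G (omap F p),
     amap = \<lambda>p q u. amap G (omap F p) (omap F q) (amap F p q u)\<rparr>"

definition identity_on :: "('o, 'm) quantaloid \<Rightarrow> ('o, 'm, 'o, 'm) functr \<Rightarrow> bool" where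
  "identity_on A F \<longleftrightarrow>
    (\<forall>p\<in>ob A. omap F p = p) \<and>
    (\<forall>p\<in>ob A. \<forall>q\<in>ob A. \<forall>u\<in>carrier (hom A p q). amap F p q u = u)"

text \<open>The section \<open>S\<close> is only required to be a functor that is monotone on hom-sets; see the remark on
  \<open>Ihat\<close> below.\<close>

definition retract_of :: "('o, 'm) quantaloid \<Rightarrow> ('p, 'n) quantaloid \<Rightarrow> bool" where
  "retract_of A B \<longleftrightarrow>
    (\<exists>S R. monotone_functor A B S \<and> quantaloid_hom B A R \<and> identity_on A (functor_comp R S))"


section \<open>Categories, functors and distributors over a quantaloid\<close>

text \<open>The field \<open>carr\<close> of a category \<open>X\<close> is its hom-distributor \<open>1\<^sub>X\<close>. All functions on carriers
  are extensional, so that equality in HOL is equality of the mathematical objects.\<close>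

record ('x, 'o, 'm) qcat = "'x partial_object" +
  ty :: "'x \<Rightarrow> 'o"
  carr :: "'x \<times> 'x \<Rightarrow> 'm"

definition is_qcat :: "('o, 'm) quantaloid \<Rightarrow> ('x, 'o, 'm) qcat \<Rightarrow> bool" where
  "is_qcat Q X \<longleftrightarrow>
    ty X \<in> carrier X \<rightarrow>\<^sub>E ob Q \<and>
    carr X \<in> (\<Pi>\<^sub>E (x, y)\<in>carrier X \<times> carrier X. carrier (hom Q (ty X x) (ty X y))) \<and>
    (\<forall>x\<in>carrier X. ident Q (ty X x) \<sqsubseteq>\<^bsub>hom Q (ty X x) (ty X x)\<^esub> carr X (x, x)) \<and>
    (\<forall>x\<in>carrier X. \<forall>y\<in>carrier X. \<forall>z\<in>carrier X.
      comp Q (ty X x) (ty X y) (ty X z) (carr X (y, z)) (carr X (x, y))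
        \<sqsubseteq>\<^bsub>hom Q (ty X x) (ty X z)\<^esub> carr X (x, z))"

definition qcat_le :: "('o, 'm) quantaloid \<Rightarrow> ('x, 'o, 'm) qcat \<Rightarrow> 'x \<Rightarrow> 'x \<Rightarrow> bool" where
  "qcat_le Q X x y \<longleftrightarrow>
    ty X x = ty X y \<and> ident Q (ty X x) \<sqsubseteq>\<^bsub>hom Q (ty X x) (ty X y)\<^esub> carr X (x, y)"

definition is_qfunctor ::
  "('o, 'm) quantaloid \<Rightarrow> ('x, 'o, 'm) qcat \<Rightarrow> ('y, 'o, 'm) qcat \<Rightarrow> ('x \<Rightarrow> 'y) \<Rightarrow> bool" where
  "is_qfunctor Q X Y f \<longleftrightarrow>
    f \<in> carrier X \<rightarrow>\<^sub>E carrier Y \<and>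
    (\<forall>x\<in>carrier X. ty Y (f x) = ty X x) \<and>
    (\<forall>x\<in>carrier X. \<forall>y\<in>carrier X.
      carr X (x, y) \<sqsubseteq>\<^bsub>hom Q (ty X x) (ty X y)\<^esub> carr Y (f x, f y))"

definition qfunctor_le ::
  "('o, 'm) quantaloid \<Rightarrow> ('x, 'o, 'm) qcat \<Rightarrow> ('y, 'o, 'm) qcat \<Rightarrow> ('x \<Rightarrow> 'y) \<Rightarrow> ('x \<Rightarrow> 'y) \<Rightarrow> bool"
  where "qfunctor_le Q X Y f g \<longleftrightarrow> (\<forall>x\<in>carrier X. qcat_le Q Y (f x) (g x))"

definition full_subcat :: "('x, 'o, 'm) qcat \<Rightarrow> 'x set \<Rightarrow> ('x, 'o, 'm) qcat" where
  "full_subcat X S =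
    \<lparr>carrier = S, ty = restrict (ty X) S, carr = restrict (carr X) (S \<times> S)\<rparr>"

text \<open>A distributor \<open>\<phi> : X \<Zrres> Y\<close> is an extensional function on \<open>carrier X \<times> carrier Y\<close>; the types of
  \<open>X\<close> and \<open>Y\<close> may differ.\<close>

definition is_dist ::
  "('o, 'm) quantaloid \<Rightarrow> ('x, 'o, 'm) qcat \<Rightarrow> ('y, 'o, 'm) qcat \<Rightarrow> ('x \<times> 'y \<Rightarrow> 'm) \<Rightarrow> bool" where
  "is_dist Q X Y \<phi> \<longleftrightarrow>
    \<phi> \<in> (\<Pi>\<^sub>E (x, y)\<in>carrier X \<times> carrier Y. carrier (hom Q (ty X x) (ty Y y))) \<and>
    (\<forall>x\<in>carrier X. \<forall>x'\<in>carrier X. \<forall>y\<in>carrier Y. \<forall>y'\<in>carrier Y.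
      comp Q (ty X x') (ty Y y) (ty Y y') (carr Y (y, y'))
          (comp Q (ty X x') (ty X x) (ty Y y) (\<phi> (x, y)) (carr X (x', x)))
        \<sqsubseteq>\<^bsub>hom Q (ty X x') (ty Y y')\<^esub> \<phi> (x', y'))"

definition dist_le ::
  "('o, 'm) quantaloid \<Rightarrow> ('x, 'o, 'm) qcat \<Rightarrow> ('y, 'o, 'm) qcat \<Rightarrow>
    ('x \<times> 'y \<Rightarrow> 'm) \<Rightarrow> ('x \<times> 'y \<Rightarrow> 'm) \<Rightarrow> bool" where
  "dist_le Q X Y \<phi> \<psi> \<longleftrightarrow>
    (\<forall>x\<in>carrier X. \<forall>y\<in>carrier Y. \<phi> (x, y) \<sqsubseteq>\<^bsub>hom Q (ty X x) (ty Y y)\<^esub> \<psi> (x, y))"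

text \<open>\<open>\<psi> \<circ> \<phi> : X \<Zrres> Z\<close> for \<open>\<phi> : X \<Zrres> Y\<close> and \<open>\<psi> : Y \<Zrres> Z\<close>.\<close>

definition dist_comp ::
  "('o, 'm) quantaloid \<Rightarrow> ('x, 'o, 'm) qcat \<Rightarrow> ('y, 'o, 'm) qcat \<Rightarrow> ('z, 'o, 'm) qcat \<Rightarrow>
    ('y \<times> 'z \<Rightarrow> 'm) \<Rightarrow> ('x \<times> 'y \<Rightarrow> 'm) \<Rightarrow> ('x \<times> 'z \<Rightarrow> 'm)" where
  "dist_comp Q X Y Z \<psi> \<phi> =
    (\<lambda>(x, z)\<in>carrier X \<times> carrier Z.
      \<Squnion>\<^bsub>hom Q (ty X x) (ty Z z)\<^esub>
        ((\<lambda>y. comp Q (ty X x) (ty Y y) (ty Z z) (\<psi> (y, z)) (\<phi> (x, y))) ` carrier Y))"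

text \<open>\<open>\<xi> \<swarrow> \<phi> : Y \<Zrres> Z\<close> for \<open>\<phi> : X \<Zrres> Y\<close> and \<open>\<xi> : X \<Zrres> Z\<close>.\<close>

definition dist_lres ::
  "('o, 'm) quantaloid \<Rightarrow> ('x, 'o, 'm) qcat \<Rightarrow> ('y, 'o, 'm) qcat \<Rightarrow> ('z, 'o, 'm) qcat \<Rightarrow>
    ('x \<times> 'z \<Rightarrow> 'm) \<Rightarrow> ('x \<times> 'y \<Rightarrow> 'm) \<Rightarrow> ('y \<times> 'z \<Rightarrow> 'm)" where
  "dist_lres Q X Y Z \<xi> \<phi> =
    (\<lambda>(y, z)\<in>carrier Y \<times> carrier Z.
      \<Sqinter>\<^bsub>hom Q (ty Y y) (ty Z z)\<^esub>
        ((\<lambda>x. lres Q (ty X x) (ty Y y) (ty Z z) (\<xi> (x, z)) (\<phi> (x, y))) ` carrier X))"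

definition cograph ::
  "('x, 'o, 'm) qcat \<Rightarrow> ('y, 'o, 'm) qcat \<Rightarrow> ('x \<Rightarrow> 'y) \<Rightarrow> ('y \<times> 'x \<Rightarrow> 'm)" where
  "cograph X Y f = (\<lambda>(y, x)\<in>carrier Y \<times> carrier X. carr Y (y, f x))"


section \<open>Presheaves and Kan adjunctions\<close>

definition point :: "('o, 'm) quantaloid \<Rightarrow> 'o \<Rightarrow> (unit, 'o, 'm) qcat" where
  "point Q q = \<lparr>carrier = {()}, ty = \<lambda>_. q, carr = \<lambda>_. ident Q q\<rparr>"

text \<open>A presheaf of type \<open>q\<close> is a distributor to \<open>point Q q\<close>, tagged with \<open>q\<close>.\<close>

type_synonym ('x, 'o, 'm) presheaf = "'o \<times> ('x \<times> unit \<Rightarrow> 'm)"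

definition presheaves ::
  "('o, 'm) quantaloid \<Rightarrow> ('x, 'o, 'm) qcat \<Rightarrow> ('x, 'o, 'm) presheaf set" where
  "presheaves Q X = {(q, \<mu>). q \<in> ob Q \<and> is_dist Q X (point Q q) \<mu>}"

definition PSh ::
  "('o, 'm) quantaloid \<Rightarrow> ('x, 'o, 'm) qcat \<Rightarrow> (('x, 'o, 'm) presheaf, 'o, 'm) qcat" where
  "PSh Q X =
    \<lparr>carrier = presheaves Q X,
     ty = (\<lambda>(q, \<mu>)\<in>presheaves Q X. q),
     carr = (\<lambda>((q, \<mu>), (q', \<mu>'))\<in>presheaves Q X \<times> presheaves Q X.
       dist_lres Q X (point Q q) (point Q q') \<mu>' \<mu> ((), ()))\<rparr>"

definition kan_upper ::
  "('o, 'm) quantaloid \<Rightarrow> ('x, 'o, 'm) qcat \<Rightarrow> ('y, 'o, 'm) qcat \<Rightarrow> ('x \<times> 'y \<Rightarrow> 'm) \<Rightarrow>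
    ('y, 'o, 'm) presheaf \<Rightarrow> ('x, 'o, 'm) presheaf" where
  "kan_upper Q X Y \<phi> =
    (\<lambda>(q, \<nu>)\<in>carrier (PSh Q Y). (q, dist_comp Q X Y (point Q q) \<nu> \<phi>))"

definition kan_lower ::
  "('o, 'm) quantaloid \<Rightarrow> ('x, 'o, 'm) qcat \<Rightarrow> ('y, 'o, 'm) qcat \<Rightarrow> ('x \<times> 'y \<Rightarrow> 'm) \<Rightarrow>
    ('x, 'o, 'm) presheaf \<Rightarrow> ('y, 'o, 'm) presheaf" where
  "kan_lower Q X Y \<phi> =
    (\<lambda>(q, \<mu>)\<in>carrier (PSh Q X). (q, dist_lres Q X Y (point Q q) \<mu> \<phi>))"


section \<open>Interior spaces and continuous distributors\<close>

type_synonym ('x, 'o, 'm) int_space =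
  "('x, 'o, 'm) qcat \<times> (('x, 'o, 'm) presheaf \<Rightarrow> ('x, 'o, 'm) presheaf)"

definition is_int_space :: "('o, 'm) quantaloid \<Rightarrow> ('x, 'o, 'm) int_space \<Rightarrow> bool" where
  "is_int_space Q = (\<lambda>(X, a).
    is_qcat Q X \<and>
    is_qfunctor Q (PSh Q X) (PSh Q X) a \<and>
    qfunctor_le Q (PSh Q X) (PSh Q X) a (\<lambda>\<mu>\<in>carrier (PSh Q X). \<mu>) \<and>
    compose (carrier (PSh Q X)) a a = a)"

definition opens ::
  "('o, 'm) quantaloid \<Rightarrow> ('x, 'o, 'm) int_space \<Rightarrow> (('x, 'o, 'm) presheaf, 'o, 'm) qcat" where
  "opens Q = (\<lambda>(X, a). full_subcat (PSh Q X) {\<mu> \<in> carrier (PSh Q X). a \<mu> = \<mu>})"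

definition is_continuous ::
  "('o, 'm) quantaloid \<Rightarrow> ('x, 'o, 'm) int_space \<Rightarrow> ('y, 'o, 'm) int_space \<Rightarrow>
    ('x \<times> 'y \<Rightarrow> 'm) \<Rightarrow> bool" where
  "is_continuous Q = (\<lambda>(X, a) (Y, b) \<zeta>.
    is_dist Q X Y \<zeta> \<and>
    qfunctor_le Q (PSh Q Y) (PSh Q X)
      (compose (carrier (PSh Q Y)) (kan_upper Q X Y \<zeta>) b)
      (compose (carrier (PSh Q Y)) a (kan_upper Q X Y \<zeta>)))"

definition IntDist ::
  "('o, 'm) quantaloid \<Rightarrow> (('x, 'o, 'm) int_space, 'x \<times> 'x \<Rightarrow> 'm) quantaloid" where
  "IntDist Q =
    \<lparr>ob = Collect (is_int_space Q),
     hom = \<lambda>A B. \<lparr>carrier = Collect (is_continuous Q A B), eq = (=), le = dist_le Q (fst A) (fst B)\<rparr>,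
     comp = \<lambda>A B C. dist_comp Q (fst A) (fst B) (fst C),
     ident = \<lambda>A. carr (fst A)\<rparr>"


section \<open>The arrow quantaloid of distributors\<close>

text \<open>An object \<open>(X, Y, \<phi>)\<close> is a distributor \<open>\<phi> : X \<Zrres> Y\<close>. The elements of \<open>X\<close> and of \<open>Y\<close> are drawn from
  two types \<open>'x\<close> and \<open>'y\<close>: since presheaves on \<open>X\<close> live in a type that cannot be embedded
  in \<open>'x\<close>, no single type of elements is closed under \<open>PSh\<close>. Both types are arbitrary; any given
  set of distributors is covered by suitable types.\<close>

type_synonym ('x, 'y, 'o, 'm) dist_ob = "('x, 'o, 'm) qcat \<times> ('y, 'o, 'm) qcat \<times> ('x \<times> 'y \<Rightarrow> 'm)"
type_synonym ('x, 'y, 'm) dist_arr = "('x \<times> 'x \<Rightarrow> 'm) \<times> ('y \<times> 'y \<Rightarrow> 'm)"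

definition ArrDist ::
  "('o, 'm) quantaloid \<Rightarrow> (('x, 'y, 'o, 'm) dist_ob, ('x, 'y, 'm) dist_arr) quantaloid" where
  "ArrDist Q =
    \<lparr>ob = {(X, Y, \<phi>). is_qcat Q X \<and> is_qcat Q Y \<and> is_dist Q X Y \<phi>},
     hom = \<lambda>(X, Y, \<phi>) (X', Y', \<psi>).
       \<lparr>carrier = {(\<zeta>, \<eta>). is_dist Q X X' \<zeta> \<and> is_dist Q Y Y' \<eta> \<and>
          dist_comp Q X X' Y' \<psi> \<zeta> = dist_comp Q X Y Y' \<eta> \<phi>},
        eq = (=),
        le = \<lambda>(\<zeta>, \<eta>) (\<zeta>', \<eta>'). dist_le Q X X' \<zeta> \<zeta>' \<and> dist_le Q Y Y' \<eta> \<eta>'\<rparr>,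
     comp = \<lambda>(X, Y, \<phi>) (X', Y', \<psi>) (X'', Y'', \<chi>) (\<zeta>', \<eta>') (\<zeta>, \<eta>).
       (dist_comp Q X X' X'' \<zeta>' \<zeta>, dist_comp Q Y Y' Y'' \<eta>' \<eta>),
     ident = \<lambda>(X, Y, \<phi>). (carr X, carr Y)\<rparr>"


section \<open>The functors between them\<close>

definition Khat ::
  "('o, 'm) quantaloid \<Rightarrow>
    (('x, 'y, 'o, 'm) dist_ob, ('x, 'y, 'm) dist_arr, ('x, 'o, 'm) int_space, 'x \<times> 'x \<Rightarrow> 'm) functr"
  where
  "Khat Q =
    \<lparr>omap = \<lambda>(X, Y, \<phi>).
       (X, compose (carrier (PSh Q X)) (kan_upper Q X Y \<phi>) (kan_lower Q X Y \<phi>)),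
     amap = \<lambda>_ _ (\<zeta>, \<eta>). \<zeta>\<rparr>"

definition kappa ::
  "('o, 'm) quantaloid \<Rightarrow> ('x, 'o, 'm) int_space \<Rightarrow> ('x \<times> ('x, 'o, 'm) presheaf \<Rightarrow> 'm)" where
  "kappa Q A = (\<lambda>(x, (q, \<mu>))\<in>carrier (fst A) \<times> carrier (opens Q A). \<mu> (x, ()))"

definition Ihat ::
  "('o, 'm) quantaloid \<Rightarrow>
    (('x, 'o, 'm) int_space, 'x \<times> 'x \<Rightarrow> 'm,
     ('x, ('x, 'o, 'm) presheaf, 'o, 'm) dist_ob, ('x, ('x, 'o, 'm) presheaf, 'm) dist_arr) functr"
  where
  "Ihat Q =
    \<lparr>omap = \<lambda>A. (fst A, opens Q A, kappa Q A),
     amap = \<lambda>A B \<zeta>.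
       (\<zeta>, restrict (cograph (PSh Q (fst B)) (PSh Q (fst A)) (kan_upper Q (fst A) (fst B) \<zeta>))
             (carrier (opens Q A) \<times> carrier (opens Q B)))\<rparr>"

text \<open>\<open>Ihat\<close> is a functor and monotone on hom-sets, but it does not preserve joins: the second component
  of \<open>Ihat \<zeta>\<close> is \<open>(\<mu>, \<lambda>) \<mapsto> (\<lambda> \<circ> \<zeta>) \<swarrow> \<mu>\<close>, and \<open>- \<swarrow> \<mu>\<close> preserves meets, not joins.
  It fails already at the empty join, as soon as some identity arrow of \<open>Q\<close> is not the bottom
  arrow: the empty space has zero identity in \<open>IntDist Q\<close>, but its image has not in
  \<open>ArrDist Q\<close>. Hence \<open>Ihat\<close> is not a homomorphism of quantaloids when arrows of \<open>ArrDist Q\<close> are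
  ordered componentwise.\<close>

lemma Ihat_not_hom:
  fixes Q :: "('o, 'm) quantaloid"
  assumes Q: "quantaloid Q" and q: "q \<in> ob Q" and nontriv: "ident Q q \<noteq> \<bottom>\<^bsub>hom Q q q\<^esub>"
  shows "\<not> quantaloid_hom (IntDist Q :: (('x,'o,'m) int_space, _) quantaloid) (ArrDist Q) (Ihat Q)"
proof
  interpret Q: quantaloid Q by fact
  have CL: "complete_lattice (hom Q p r)" if "p \<in> ob Q" "r \<in> ob Q" for p r
    using that by (rule Q.hom_complete_lattice)
  assume H: "quantaloid_hom (IntDist Q :: (('x,'o,'m) int_space, _) quantaloid) (ArrDist Q) (Ihat Q)"
  interpret H: quantaloid_hom "IntDist Q :: (('x,'o,'m) int_space, _) quantaloid" "ArrDist Q" "Ihat Q" by fact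
  define X :: "('x,'o,'m) qcat" where "X = \<lparr>carrier = {}, ty = \<lambda>_. undefined, carr = \<lambda>_. undefined\<rparr>"
  have Xs[simp]: "carrier X = {}" "ty X = (\<lambda>_. undefined)" "carr X = (\<lambda>_. undefined)" by (simp_all add: X_def)
  have Xc: "is_qcat Q X" by (simp add: is_qcat_def)
  define a where "a = (\<lambda>\<mu>\<in>carrier (PSh Q X). \<mu>)"
  define A where "A = (X, a)"
  have PX: "carrier (PSh Q X) = ob Q \<times> {\<lambda>_. undefined}"
    by (auto simp: PSh_def presheaves_def is_dist_def)
  have PX': "presheaves Q X = ob Q \<times> {\<lambda>_. undefined}" using PX by (simp add: PSh_def)
  have ty: "ty (PSh Q X) \<mu> = fst \<mu>" if "\<mu> \<in> carrier (PSh Q X)" for \<mu>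
    using that PX' by (auto simp: PSh_def)
  have ca: "carr (PSh Q X) (\<mu>, \<nu>) = \<top>\<^bsub>hom Q (fst \<mu>) (fst \<nu>)\<^esub>" 
    if hyp: "\<mu> \<in> carrier (PSh Q X)" "\<nu> \<in> carrier (PSh Q X)" for \<mu> \<nu>
  proof -
    obtain p r where pr: "\<mu> = (p, \<lambda>_. undefined)" "\<nu> = (r, \<lambda>_. undefined)" "p \<in> ob Q" "r \<in> ob Q"
      using hyp PX by auto
    interpret L: complete_lattice "hom Q p r" using CL pr by auto
    have "carr (PSh Q X) (\<mu>, \<nu>) = \<Sqinter>\<^bsub>hom Q p r\<^esub> {}"
      using pr hyp PX' by (simp add: PSh_def dist_lres_def point_def)
    also have "\<dots> = \<top>\<^bsub>hom Q p r\<^esub>"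
      by (simp add: inf_def top_def)
    finally show ?thesis using pr by simp
  qed
  have topc: "\<top>\<^bsub>hom Q p r\<^esub> \<in> carrier (hom Q p r)" if "p \<in> ob Q" "r \<in> ob Q" for p r
  proof - interpret L: complete_lattice "hom Q p r" using CL that by auto
    show ?thesis by simp qed
  have topg: "x \<sqsubseteq>\<^bsub>hom Q p r\<^esub> \<top>\<^bsub>hom Q p r\<^esub>" if "p \<in> ob Q" "r \<in> ob Q" "x \<in> carrier (hom Q p r)" for p r x
  proof - interpret L: complete_lattice "hom Q p r" using CL that by auto
    show ?thesis using that by (simp add: L.top_higher) qed
  have botc: "\<bottom>\<^bsub>hom Q p r\<^esub> \<in> carrier (hom Q p r)" if "p \<in> ob Q" "r \<in> ob Q" for p r
  proof - interpret L: complete_lattice "hom Q p r" using CL that by auto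
    show ?thesis by simp qed
  have botl: "\<bottom>\<^bsub>hom Q p r\<^esub> \<sqsubseteq>\<^bsub>hom Q p r\<^esub> x" if "p \<in> ob Q" "r \<in> ob Q" "x \<in> carrier (hom Q p r)" for p r x
  proof - interpret L: complete_lattice "hom Q p r" using CL that by auto
    show ?thesis using that by (simp add: L.bottom_lower) qed
  have bs: "\<Squnion>\<^bsub>hom Q p r\<^esub> {} = \<bottom>\<^bsub>hom Q p r\<^esub>" for p r 
    by (simp add: sup_def bottom_def)
  have cbl: "comp Q p r s \<bottom>\<^bsub>hom Q r s\<^esub> u = \<bottom>\<^bsub>hom Q p s\<^esub>" 
    if "p \<in> ob Q" "r \<in> ob Q" "s \<in> ob Q" "u \<in> carrier (hom Q p r)" for p r s u
    using Q.comp_Sup_left[of p r s u "{}"] that by (simp add: bs)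
  have cbr: "comp Q p r s v \<bottom>\<^bsub>hom Q p r\<^esub> = \<bottom>\<^bsub>hom Q p s\<^esub>" 
    if "p \<in> ob Q" "r \<in> ob Q" "s \<in> ob Q" "v \<in> carrier (hom Q r s)" for p r s v
    using Q.comp_Sup_right[of p r s "{}" v] that by (simp add: bs)
  have ge: "qcat_le Q (PSh Q X) \<mu> \<mu>" if "\<mu> \<in> carrier (PSh Q X)" for \<mu>
    using that PX by (auto simp: qcat_le_def ty ca topg Q.ident_closed)
  have aid: "a \<mu> = \<mu>" if "\<mu> \<in> carrier (PSh Q X)" for \<mu> using that by (simp add: a_def)
  have refl: "x \<sqsubseteq>\<^bsub>hom Q p r\<^esub> x" if "p \<in> ob Q" "r \<in> ob Q" "x \<in> carrier (hom Q p r)" for p r x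
  proof - interpret L: complete_lattice "hom Q p r" using CL that by auto
    show ?thesis using that by simp qed
  have fq: "is_qfunctor Q (PSh Q X) (PSh Q X) a"
    unfolding is_qfunctor_def
    by (auto simp: aid ca ty a_def PX intro!: refl topc)
  have Ai: "A \<in> ob (IntDist Q)"
    unfolding IntDist_def A_def is_int_space_def
    by (auto simp: Xc fq qfunctor_le_def aid ge a_def[symmetric] compose_def)
       (auto simp: a_def)
  let ?e = "(\<lambda>_. undefined) :: 'x \<times> 'x \<Rightarrow> 'm"
  have de: "is_dist Q X X z \<longleftrightarrow> z = ?e" for z by (auto simp: is_dist_def)
  have ku: "kan_upper Q X X ?e \<mu> = \<mu>" if "\<mu> \<in> carrier (PSh Q X)" for \<mu>
    using that PX by (auto simp: kan_upper_def dist_comp_def restrict_def)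
  have ce: "is_continuous Q A A z \<longleftrightarrow> z = ?e" for z
    by (auto simp: A_def is_continuous_def de qfunctor_le_def compose_def ku aid ge)
  have sup: "\<Squnion>\<^bsub>hom (IntDist Q) A A\<^esub> {} = ?e"
  proof -
    interpret L: complete_lattice "hom (IntDist Q) A A" by (rule H.dom.hom_complete_lattice[OF Ai Ai])
    have "\<Squnion>\<^bsub>hom (IntDist Q) A A\<^esub> {} \<in> carrier (hom (IntDist Q) A A)" by (rule L.sup_closed) simp
    then show ?thesis by (simp add: IntDist_def ce)
  qed
  let ?I = "omap (Ihat Q) A"
  have IA: "?I \<in> ob (ArrDist Q)" by (rule H.omap_closed[OF Ai])
  have eq: "amap (Ihat Q) A A ?e = \<Squnion>\<^bsub>hom (ArrDist Q) ?I ?I\<^esub> {}"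
    using H.amap_Sup[OF Ai Ai, of "{}"] sup by simp
  interpret L: complete_lattice "hom (ArrDist Q) ?I ?I" by (rule H.cod.hom_complete_lattice[OF IA IA])
  have Oc: "carrier (opens Q A) = carrier (PSh Q X)"
    by (auto simp: opens_def A_def full_subcat_def aid)
  have Ot: "ty (opens Q A) \<mu> = fst \<mu>" if "\<mu> \<in> carrier (PSh Q X)" for \<mu>
    using that by (auto simp: opens_def A_def full_subcat_def aid ty)
  have Oa: "carr (opens Q A) (\<mu>, \<nu>) = \<top>\<^bsub>hom Q (fst \<mu>) (fst \<nu>)\<^esub>" 
    if "\<mu> \<in> carrier (PSh Q X)" "\<nu> \<in> carrier (PSh Q X)" for \<mu> \<nu>
    using that by (auto simp: opens_def A_def full_subcat_def aid ca)
  define b where "b = (\<lambda>(\<mu>, \<nu>)\<in>carrier (opens Q A) \<times> carrier (opens Q A). \<bottom>\<^bsub>hom Q (fst \<mu>) (fst \<nu>)\<^esub>)"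
  have bd: "is_dist Q (opens Q A) (opens Q A) b"
    unfolding is_dist_def b_def Oc
    by (auto simp: Ot PX Oa cbl cbr botc topc intro!: refl)
  have "(?e, b) \<in> carrier (hom (ArrDist Q) ?I ?I)"
    by (auto simp: ArrDist_def Ihat_def A_def de bd[unfolded A_def] dist_comp_def restrict_def fun_eq_iff)
  then have "\<Squnion>\<^bsub>hom (ArrDist Q) ?I ?I\<^esub> {} \<sqsubseteq>\<^bsub>hom (ArrDist Q) ?I ?I\<^esub> (?e, b)"
    by (intro L.sup_least) auto
  then have le: "dist_le Q (opens Q A) (opens Q A) (snd (amap (Ihat Q) A A ?e)) b"
    unfolding eq[symmetric] by (simp add: ArrDist_def Ihat_def)
  let ?m = "(q, \<lambda>_. undefined) :: ('x,'o,'m) presheaf"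
  have m: "?m \<in> carrier (PSh Q X)" using PX q by auto
  have "snd (amap (Ihat Q) A A ?e) (?m, ?m) \<sqsubseteq>\<^bsub>hom Q q q\<^esub> b (?m, ?m)"
    using le[unfolded dist_le_def, rule_format, of ?m ?m] m Ot[OF m] by (simp add: Oc)
  then have tb: "\<top>\<^bsub>hom Q q q\<^esub> \<sqsubseteq>\<^bsub>hom Q q q\<^esub> \<bottom>\<^bsub>hom Q q q\<^esub>"
    using m by (simp add: Ihat_def b_def Oc cograph_def A_def[THEN arg_cong, of fst] ku ca)
  interpret Lq: complete_lattice "hom Q q q" using CL q by auto
  have "ident Q q \<sqsubseteq>\<^bsub>hom Q q q\<^esub> \<bottom>\<^bsub>hom Q q q\<^esub>"
    using tb Q.ident_closed[OF q] topg[OF q q] topc[OF q q] botc[OF q q] by (meson Lq.le_trans)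
  then have "ident Q q = \<bottom>\<^bsub>hom Q q q\<^esub>"
    using Q.ident_closed[OF q] botc[OF q q] botl[OF q q] by (auto intro: Lq.le_antisym)
  then show False using nontriv by simp
qed

end

theory Submission
  imports Defs
begin

text \<open>The order on presheaves over \<open>X\<close> is pointwise, and \<open>t \<le> 1(\<mu>, \<mu>')\<close> holds iff \<open>t \<circ> \<mu> \<le> \<mu>'\<close>.
  If \<open>\<psi> \<circ> \<zeta> = \<eta> \<circ> \<phi>\<close>, then \<open>\<phi>\<^sup>* \<eta>\<^sup>* \<psi>\<^sub>* = \<zeta>\<^sup>* \<psi>\<^sup>* \<psi>\<^sub>* \<le> \<zeta>\<^sup>*\<close>, so
  \<open>\<eta>\<^sup>* \<psi>\<^sub>* \<le> \<phi>\<^sub>* \<zeta>\<^sup>*\<close> by adjunction and hence \<open>\<zeta>\<^sup>* \<psi>\<^sup>* \<psi>\<^sub>* \<le> \<phi>\<^sup>* \<phi>\<^sub>* \<zeta>\<^sup>*\<close>: this is the continuity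
  of \<open>\<zeta>\<close>. Joins in both quantaloids are pointwise, so \<open>Khat\<close> preserves them. For a continuous \<open>\<zeta>\<close> the
  functor \<open>\<zeta>\<^sup>*\<close> maps open presheaves to open presheaves, and evaluating a composite at the open
  presheaf \<open>\<zeta>\<^sup>* \<lambda>\<close> shows that \<open>Ihat \<zeta>\<close> is a commutative square and that \<open>Ihat\<close> preserves composition.
  Finally \<open>\<kappa>\<^sub>a\<^sup>* \<kappa>\<^sub>a\<^sub>* \<mu>\<close> is the join of \<open>1(\<nu>, \<mu>) \<circ> \<nu>\<close> over the open \<open>\<nu>\<close>. It lies below \<open>a \<mu>\<close> because
  \<open>1(\<nu>, \<mu>) \<le> 1(a \<nu>, a \<mu>) = 1(\<nu>, a \<mu>)\<close>, and above it by taking \<open>\<nu> = a \<mu>\<close>.\<close>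

section \<open>Quantaloids presented by joins\<close>

text \<open>Joins are pointwise for a reason that meets do not share. A pointwise join of commuting
  squares commutes because composition preserves joins in each variable, and a pointwise join of
  continuous distributors is continuous because \<zeta> \<mapsto> \<open>\<zeta>\<^sup>*\<close>
  preserves joins and interior operators are monotone. Nothing comparable is available for pointwise
  meets, so both lattices are presented by their joins, and meets are recovered as joins of lower
  bounds. The second recurring difficulty is typing. Presheaves carry a type tag, and two of them
  are comparable only if the tags agree; the tags are equal as values but not as terms, so many
  steps restate membership in a hom-set after rewriting a tag. Composites of distributors are joins
  over all middle elements, and they are compared through upper bounds: one inequality bounds every
  term of the join, the other singles out one term that contains an identity arrow. With open
  presheaves as middle elements the chosen index must itself be open, and continuity provides
  exactly that.\<close>

lemma complete_lattice_of_joins: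
  fixes L :: "'a gorder"
  assumes eq: "eq L = (=)"
    and refl: "\<And>x. x \<in> carrier L \<Longrightarrow> x \<sqsubseteq>\<^bsub>L\<^esub> x"
    and antisym: "\<And>x y. \<lbrakk>x \<in> carrier L; y \<in> carrier L; x \<sqsubseteq>\<^bsub>L\<^esub> y; y \<sqsubseteq>\<^bsub>L\<^esub> x\<rbrakk> \<Longrightarrow> x = y"
    and trans: "\<And>x y z. \<lbrakk>x \<in> carrier L; y \<in> carrier L; z \<in> carrier L; x \<sqsubseteq>\<^bsub>L\<^esub> y; y \<sqsubseteq>\<^bsub>L\<^esub> z\<rbrakk>
      \<Longrightarrow> x \<sqsubseteq>\<^bsub>L\<^esub> z"
    and closed: "\<And>A. A \<subseteq> carrier L \<Longrightarrow> S A \<in> carrier L"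
    and upper: "\<And>A x. \<lbrakk>A \<subseteq> carrier L; x \<in> A\<rbrakk> \<Longrightarrow> x \<sqsubseteq>\<^bsub>L\<^esub> S A"
    and least: "\<And>A z. \<lbrakk>A \<subseteq> carrier L; z \<in> carrier L; \<And>x. x \<in> A \<Longrightarrow> x \<sqsubseteq>\<^bsub>L\<^esub> z\<rbrakk> \<Longrightarrow> S A \<sqsubseteq>\<^bsub>L\<^esub> z"
  shows complete_lattice_of_joins_lattice: "complete_lattice L"
    and complete_lattice_of_joins_sup: "A \<subseteq> carrier L \<Longrightarrow> \<Squnion>\<^bsub>L\<^esub> A = S A"
proof -
  interpret L: partial_order L
    by unfold_locales (auto simp: eq intro: refl antisym trans)
  have lub: "least L (S A) (Upper L A)" if "A \<subseteq> carrier L" for A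
    using that by (auto simp: least_def Upper_def intro!: closed upper least)
  \<comment> \<open>The meet of \<open>A\<close> is the join of its lower bounds: every element of
    \<open>A\<close> is an upper bound of \<open>Lower L A\<close>, so this join is again a lower
    bound.\<close>
  have glb: "greatest L (S (Lower L A)) (Lower L A)" if A: "A \<subseteq> carrier L" for A
  proof -
    have *: "Lower L A \<subseteq> carrier L"
      by (auto simp: Lower_def)
    have "S (Lower L A) \<in> Lower L A"
      using A by (auto simp: Lower_def intro!: closed least)
    with * show ?thesis
      by (auto simp: greatest_def intro!: upper)
  qed
  show cl: "complete_lattice L"
    by unfold_locales (auto intro: lub glb)
  show "\<Squnion>\<^bsub>L\<^esub> A = S A" if A: "A \<subseteq> carrier L"
  proof -
    interpret C: complete_lattice L by (fact cl)
    show ?thesis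
      using C.sup_lub[OF A] lub[OF A] by (rule L.least_unique)
  qed
qed


section \<open>Calculus in a quantaloid\<close>

context quantaloid
begin

abbreviation Hom :: "'o \<Rightarrow> 'o \<Rightarrow> 'm set" where
  "Hom p q \<equiv> carrier (hom Q p q)"

abbreviation hom_le :: "'m \<Rightarrow> 'o \<Rightarrow> 'o \<Rightarrow> 'm \<Rightarrow> bool" ("(_/ \<preceq>[_,/ _] _)" [51, 0, 0, 51] 50) where
  "u \<preceq>[p, q] v \<equiv> u \<sqsubseteq>\<^bsub>hom Q p q\<^esub> v"

section \<open>Order, indexed joins and meets in one hom-set\<close>

lemma le_refl: "\<lbrakk>p \<in> ob Q; q \<in> ob Q; u \<in> Hom p q\<rbrakk> \<Longrightarrow> u \<preceq>[p, q] u"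
  by (meson hom_complete_lattice complete_lattice.axioms(1) partial_order.axioms(1)
      weak_partial_order.le_refl)

lemma le_trans:
  assumes "u \<preceq>[p, q] v" "v \<preceq>[p, q] w" "p \<in> ob Q" "q \<in> ob Q" "u \<in> Hom p q" "v \<in> Hom p q" "w \<in> Hom p q"
  shows "u \<preceq>[p, q] w"
proof -
  interpret L: complete_lattice "hom Q p q" using assms by (intro hom_complete_lattice)
  show ?thesis using assms by (blast intro: L.le_trans)
qed

lemma le_antisym:
  assumes "u \<preceq>[p, q] v" "v \<preceq>[p, q] u" "p \<in> ob Q" "q \<in> ob Q" "u \<in> Hom p q" "v \<in> Hom p q"
  shows "u = v"
proof -
  interpret L: complete_lattice "hom Q p q" using assms by (intro hom_complete_lattice)
  show ?thesis using assms by (blast intro: L.le_antisym)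
qed

lemma Sup_closed:
  assumes "p \<in> ob Q" "q \<in> ob Q" "\<And>i. i \<in> I \<Longrightarrow> f i \<in> Hom p q"
  shows "\<Squnion>\<^bsub>hom Q p q\<^esub> (f ` I) \<in> Hom p q"
proof -
  interpret L: complete_lattice "hom Q p q" using assms by (intro hom_complete_lattice)
  show ?thesis using assms by (intro L.sup_closed) auto
qed

lemma Inf_closed:
  assumes "p \<in> ob Q" "q \<in> ob Q" "\<And>i. i \<in> I \<Longrightarrow> f i \<in> Hom p q"
  shows "\<Sqinter>\<^bsub>hom Q p q\<^esub> (f ` I) \<in> Hom p q"
proof -
  interpret L: complete_lattice "hom Q p q" using assms by (intro hom_complete_lattice)
  show ?thesis using assms by (intro L.inf_closed) auto
qed

lemma Sup_upper:
  assumes "p \<in> ob Q" "q \<in> ob Q" "\<And>i. i \<in> I \<Longrightarrow> f i \<in> Hom p q" "i \<in> I"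
  shows "f i \<preceq>[p, q] \<Squnion>\<^bsub>hom Q p q\<^esub> (f ` I)"
proof -
  interpret L: complete_lattice "hom Q p q" using assms by (intro hom_complete_lattice)
  show ?thesis using assms by (intro L.sup_upper) auto
qed

lemma Sup_le_iff:
  assumes "p \<in> ob Q" "q \<in> ob Q" "\<And>i. i \<in> I \<Longrightarrow> f i \<in> Hom p q" "t \<in> Hom p q"
  shows "\<Squnion>\<^bsub>hom Q p q\<^esub> (f ` I) \<preceq>[p, q] t \<longleftrightarrow> (\<forall>i\<in>I. f i \<preceq>[p, q] t)" (is "?L \<longleftrightarrow> ?R")
proof
  interpret L: complete_lattice "hom Q p q" using assms by (intro hom_complete_lattice)
  show ?R if ?L
    using that assms Sup_upper[of p q I f] Sup_closed[of p q I f] by (blast intro: le_trans)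
  show ?L if ?R using that assms by (intro L.sup_least) auto
qed

lemma le_Inf_iff:
  assumes "p \<in> ob Q" "q \<in> ob Q" "\<And>i. i \<in> I \<Longrightarrow> f i \<in> Hom p q" "t \<in> Hom p q"
  shows "t \<preceq>[p, q] \<Sqinter>\<^bsub>hom Q p q\<^esub> (f ` I) \<longleftrightarrow> (\<forall>i\<in>I. t \<preceq>[p, q] f i)" (is "?L \<longleftrightarrow> ?R")
proof
  interpret L: complete_lattice "hom Q p q" using assms by (intro hom_complete_lattice)
  have "\<Sqinter>\<^bsub>hom Q p q\<^esub> (f ` I) \<preceq>[p, q] f i" if "i \<in> I" for i
    using assms that by (intro L.inf_lower) auto
  then show ?R if ?L
    using that assms Inf_closed[of p q I f] by (blast intro: le_trans)
  show ?L if ?R using that assms by (intro L.inf_greatest) auto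
qed

text \<open>Taking t = u and t = v gives both inequalities. The criterion allows iterated joins to
  be compared by quantified conditions, without rearranging the joins themselves.\<close>

lemma eq_by_upper_bounds:
  assumes "p \<in> ob Q" "q \<in> ob Q" "u \<in> Hom p q" "v \<in> Hom p q"
    and "\<And>t. t \<in> Hom p q \<Longrightarrow> u \<preceq>[p, q] t \<longleftrightarrow> v \<preceq>[p, q] t"
  shows "u = v"
  using assms by (intro le_antisym[of p q u v]) (auto intro: le_refl)

lemma comp_SUP_left:
  assumes "p \<in> ob Q" "q \<in> ob Q" "r \<in> ob Q" "u \<in> Hom p q" "\<And>i. i \<in> I \<Longrightarrow> f i \<in> Hom q r"
  shows "comp Q p q r (\<Squnion>\<^bsub>hom Q q r\<^esub> (f ` I)) u = \<Squnion>\<^bsub>hom Q p r\<^esub> ((\<lambda>i. comp Q p q r (f i) u) ` I)"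
  using comp_Sup_left[of p q r u "f ` I"] assms by (simp add: image_image image_subset_iff)

lemma comp_SUP_right:
  assumes "p \<in> ob Q" "q \<in> ob Q" "r \<in> ob Q" "\<And>i. i \<in> I \<Longrightarrow> f i \<in> Hom p q" "v \<in> Hom q r"
  shows "comp Q p q r v (\<Squnion>\<^bsub>hom Q p q\<^esub> (f ` I)) = \<Squnion>\<^bsub>hom Q p r\<^esub> ((\<lambda>i. comp Q p q r v (f i)) ` I)"
  using comp_Sup_right[of p q r "f ` I" v] assms by (simp add: image_image image_subset_iff)

text \<open>Monotonicity of composition is not an axiom of \<open>quantaloid\<close>. It follows
  from join preservation once the larger of two comparable arrows is written as the join of both;
  the image under \<open>id\<close> brings this join into the indexed form of
  \<open>comp_SUP_left\<close> and \<open>comp_SUP_right\<close>.\<close>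

lemma Sup_pair:
  assumes "p \<in> ob Q" "q \<in> ob Q" "u \<in> Hom p q" "v \<in> Hom p q" "u \<preceq>[p, q] v"
  shows "\<Squnion>\<^bsub>hom Q p q\<^esub> (id ` {u, v}) = v"
  using assms Sup_upper[of p q "{u, v}" id v] Sup_le_iff[of p q "{u, v}" id v]
    Sup_closed[of p q "{u, v}" id]
  by (intro le_antisym[of p q]) (auto intro: le_refl)

lemma comp_mono_left:
  assumes "p \<in> ob Q" "q \<in> ob Q" "r \<in> ob Q" "u \<in> Hom p q" "v \<in> Hom q r" "v' \<in> Hom q r"
    and "v \<preceq>[q, r] v'"
  shows "comp Q p q r v u \<preceq>[p, r] comp Q p q r v' u"
proof -
  have "comp Q p q r v' u = \<Squnion>\<^bsub>hom Q p r\<^esub> ((\<lambda>i. comp Q p q r (id i) u) ` {v, v'})"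
    using assms comp_SUP_left[of p q r u "{v, v'}" id] Sup_pair[of q r v v'] by auto
  then show ?thesis
    using assms Sup_upper[of p r "{v, v'}" "\<lambda>i. comp Q p q r (id i) u" v] by (fastforce simp: comp_closed)
qed

lemma comp_mono_right:
  assumes "p \<in> ob Q" "q \<in> ob Q" "r \<in> ob Q" "u \<in> Hom p q" "u' \<in> Hom p q" "v \<in> Hom q r"
    and "u \<preceq>[p, q] u'"
  shows "comp Q p q r v u \<preceq>[p, r] comp Q p q r v u'"
proof -
  have "comp Q p q r v u' = \<Squnion>\<^bsub>hom Q p r\<^esub> ((\<lambda>i. comp Q p q r v (id i)) ` {u, u'})"
    using assms comp_SUP_right[of p q r "{u, u'}" id v] Sup_pair[of p q u u'] by auto
  then show ?thesis
    using assms Sup_upper[of p r "{u, u'}" "\<lambda>i. comp Q p q r v (id i)" u] by (fastforce simp: comp_closed)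
qed

lemma comp_mono:
  assumes "p \<in> ob Q" "q \<in> ob Q" "r \<in> ob Q" "u \<in> Hom p q" "u' \<in> Hom p q" "v \<in> Hom q r" "v' \<in> Hom q r"
    and "u \<preceq>[p, q] u'" "v \<preceq>[q, r] v'"
  shows "comp Q p q r v u \<preceq>[p, r] comp Q p q r v' u'"
  using assms by (blast intro: le_trans comp_mono_left comp_mono_right comp_closed)

lemma le_comp_left:
  assumes "p \<in> ob Q" "q \<in> ob Q" "u \<in> Hom p q" "v \<in> Hom q q" "ident Q q \<preceq>[q, q] v"
  shows "u \<preceq>[p, q] comp Q p q q v u"
  using comp_mono_left[of p q q u "ident Q q" v] assms by (simp add: ident_closed comp_ident_left)

lemma le_comp_right:
  assumes "p \<in> ob Q" "q \<in> ob Q" "u \<in> Hom p p" "v \<in> Hom p q" "ident Q p \<preceq>[p, p] u"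
  shows "v \<preceq>[p, q] comp Q p p q v u"
  using comp_mono_right[of p p q "ident Q p" u v] assms by (simp add: ident_closed comp_ident_right)

text \<open>The residual is the join \<open>s\<close> of all v with v \<circ> u \<le> w. Since
  composition preserves joins, \<open>s\<close> satisfies this bound itself, hence is the greatest
  solution; antisymmetry makes it unique, so the \<open>THE\<close> in \<open>lres\<close> denotes
  it.\<close>

lemma lres_spec:
  assumes p: "p \<in> ob Q" and q: "q \<in> ob Q" and r: "r \<in> ob Q" and u: "u \<in> Hom p q" and w: "w \<in> Hom p r"
  shows lres_closed: "lres Q p q r w u \<in> Hom q r"
    and lres_iff: "v \<in> Hom q r \<Longrightarrow> v \<preceq>[q, r] lres Q p q r w u \<longleftrightarrow> comp Q p q r v u \<preceq>[p, r] w"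
proof -
  let ?V = "{v \<in> Hom q r. comp Q p q r v u \<preceq>[p, r] w}"
  let ?P = "\<lambda>z. z \<in> Hom q r \<and> (\<forall>v\<in>Hom q r. comp Q p q r v u \<preceq>[p, r] w \<longleftrightarrow> v \<preceq>[q, r] z)"
  define s where "s = \<Squnion>\<^bsub>hom Q q r\<^esub> (id ` ?V)"
  have s: "s \<in> Hom q r"
    unfolding s_def using q r by (rule Sup_closed) simp
  have "comp Q p q r s u \<preceq>[p, r] w"
    unfolding s_def using assms comp_SUP_left[of p q r u ?V id]
      Sup_le_iff[of p r ?V "\<lambda>i. comp Q p q r i u" w]
    by (auto simp: comp_closed)
  moreover have "v \<preceq>[q, r] s" if "v \<in> ?V" for v
    unfolding s_def using Sup_upper[of q r ?V id v] q r that by auto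
  ultimately have "?P s"
    using assms s by (blast intro: le_trans comp_mono_left comp_closed)
  moreover from this have "z = s" if "?P z" for z
    using that q r by (blast intro: le_antisym[of q r z s] le_refl)
  ultimately have "?P (lres Q p q r w u)"
    unfolding lres_def by (rule theI)
  then show "lres Q p q r w u \<in> Hom q r"
    "v \<in> Hom q r \<Longrightarrow> v \<preceq>[q, r] lres Q p q r w u \<longleftrightarrow> comp Q p q r v u \<preceq>[p, r] w"
    by auto
qed

end


section \<open>Categories and distributors\<close>

text \<open>This turns out to be the join in \<open>IntDist Q\<close> and, in each component, the
  join in \<open>ArrDist Q\<close>. It is restricted to the carriers so that it is extensional, as
  distributors must be.\<close>

definition dist_Sup ::
  "('o, 'm) quantaloid \<Rightarrow> ('x, 'o, 'm) qcat \<Rightarrow> ('y, 'o, 'm) qcat \<Rightarrow> ('x \<times> 'y \<Rightarrow> 'm) set \<Rightarrow>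
    ('x \<times> 'y \<Rightarrow> 'm)" where
  "dist_Sup Q X Y \<Phi> =
    (\<lambda>(x, y)\<in>carrier X \<times> carrier Y. \<Squnion>\<^bsub>hom Q (ty X x) (ty Y y)\<^esub> ((\<lambda>\<phi>. \<phi> (x, y)) ` \<Phi>))"

lemma dist_eqI:
  assumes "is_dist Q X Y \<phi>" "is_dist Q X Y \<psi>"
    and "\<And>x y. \<lbrakk>x \<in> carrier X; y \<in> carrier Y\<rbrakk> \<Longrightarrow> \<phi> (x, y) = \<psi> (x, y)"
  shows "\<phi> = \<psi>"
proof -
  have "\<phi> \<in> extensional (carrier X \<times> carrier Y)" "\<psi> \<in> extensional (carrier X \<times> carrier Y)"
    using assms by (auto simp: is_dist_def PiE_def)
  then show ?thesis
    by (rule extensionalityI) (auto simp: assms(3))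
qed

lemma is_dist_closed:
  "\<lbrakk>is_dist Q X Y \<phi>; x \<in> carrier X; y \<in> carrier Y\<rbrakk> \<Longrightarrow> \<phi> (x, y) \<in> carrier (hom Q (ty X x) (ty Y y))"
  unfolding is_dist_def by (auto dest: PiE_mem)

context quantaloid
begin

section \<open>Categories and one-sided actions on distributors\<close>

lemma qcat_ty: "\<lbrakk>is_qcat Q X; x \<in> carrier X\<rbrakk> \<Longrightarrow> ty X x \<in> ob Q"
  unfolding is_qcat_def by (auto dest: PiE_mem)

lemma qcat_carr:
  "\<lbrakk>is_qcat Q X; x \<in> carrier X; y \<in> carrier X\<rbrakk> \<Longrightarrow> carr X (x, y) \<in> Hom (ty X x) (ty X y)"
  unfolding is_qcat_def by (auto dest: PiE_mem)

lemma qcat_refl: "\<lbrakk>is_qcat Q X; x \<in> carrier X\<rbrakk> \<Longrightarrow> ident Q (ty X x) \<preceq>[ty X x, ty X x] carr X (x, x)"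
  unfolding is_qcat_def by auto

lemma qcat_trans:
  "\<lbrakk>is_qcat Q X; x \<in> carrier X; y \<in> carrier X; z \<in> carrier X\<rbrakk>
    \<Longrightarrow> comp Q (ty X x) (ty X y) (ty X z) (carr X (y, z)) (carr X (x, y)) \<preceq>[ty X x, ty X z] carr X (x, z)"
  unfolding is_qcat_def by auto

lemmas qcat_simps = qcat_ty qcat_carr ident_closed comp_closed comp_ident_left comp_ident_right

text \<open>The two-sided law is used with the reflexivity arrow of \<open>X\<close> on the other
  side: inserting something above an identity only enlarges the composite.\<close>

lemma dist_act_left:
  assumes "is_qcat Q X" "is_qcat Q Y" "is_dist Q X Y \<phi>" "x \<in> carrier X" "y \<in> carrier Y" "y' \<in> carrier Y"
  shows "comp Q (ty X x) (ty Y y) (ty Y y') (carr Y (y, y')) (\<phi> (x, y)) \<preceq>[ty X x, ty Y y'] \<phi> (x, y')"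
proof -
  note [simp] = qcat_simps is_dist_closed[OF assms(3)] assms
  have "\<phi> (x, y) \<preceq>[ty X x, ty Y y] comp Q (ty X x) (ty X x) (ty Y y) (\<phi> (x, y)) (carr X (x, x))"
    by (rule le_comp_right) (simp_all add: qcat_refl)
  then have "comp Q (ty X x) (ty Y y) (ty Y y') (carr Y (y, y')) (\<phi> (x, y)) \<preceq>[ty X x, ty Y y']
      comp Q (ty X x) (ty Y y) (ty Y y') (carr Y (y, y'))
        (comp Q (ty X x) (ty X x) (ty Y y) (\<phi> (x, y)) (carr X (x, x)))"
    by (intro comp_mono_right) auto
  moreover have "comp Q (ty X x) (ty Y y) (ty Y y') (carr Y (y, y'))
        (comp Q (ty X x) (ty X x) (ty Y y) (\<phi> (x, y)) (carr X (x, x))) \<preceq>[ty X x, ty Y y'] \<phi> (x, y')"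
    using assms unfolding is_dist_def by auto
  ultimately show ?thesis
    by (rule le_trans) auto
qed

lemma dist_act_right:
  assumes "is_qcat Q X" "is_qcat Q Y" "is_dist Q X Y \<phi>" "x \<in> carrier X" "x' \<in> carrier X" "y \<in> carrier Y"
  shows "comp Q (ty X x') (ty X x) (ty Y y) (\<phi> (x, y)) (carr X (x', x)) \<preceq>[ty X x', ty Y y] \<phi> (x', y)"
proof -
  note [simp] = qcat_simps is_dist_closed[OF assms(3)] assms
  let ?u = "comp Q (ty X x') (ty X x) (ty Y y) (\<phi> (x, y)) (carr X (x', x))"
  have "?u \<preceq>[ty X x', ty Y y] comp Q (ty X x') (ty Y y) (ty Y y) (carr Y (y, y)) ?u"
    by (rule le_comp_left) (simp_all add: qcat_refl)
  moreover have "comp Q (ty X x') (ty Y y) (ty Y y) (carr Y (y, y)) ?u \<preceq>[ty X x', ty Y y] \<phi> (x', y)"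
    using assms unfolding is_dist_def by auto
  ultimately show ?thesis
    by (rule le_trans) auto
qed

text \<open>Applying the right action and then the left one yields the two-sided law. Later
  verifications can therefore treat source and target separately.\<close>

lemma is_distI:
  assumes X: "is_qcat Q X" and Y: "is_qcat Q Y"
    and ext: "\<phi> \<in> extensional (carrier X \<times> carrier Y)"
    and closed: "\<And>x y. \<lbrakk>x \<in> carrier X; y \<in> carrier Y\<rbrakk> \<Longrightarrow> \<phi> (x, y) \<in> Hom (ty X x) (ty Y y)"
    and left: "\<And>x y y'. \<lbrakk>x \<in> carrier X; y \<in> carrier Y; y' \<in> carrier Y\<rbrakk> \<Longrightarrow>
      comp Q (ty X x) (ty Y y) (ty Y y') (carr Y (y, y')) (\<phi> (x, y)) \<preceq>[ty X x, ty Y y'] \<phi> (x, y')"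
    and right: "\<And>x x' y. \<lbrakk>x \<in> carrier X; x' \<in> carrier X; y \<in> carrier Y\<rbrakk> \<Longrightarrow>
      comp Q (ty X x') (ty X x) (ty Y y) (\<phi> (x, y)) (carr X (x', x)) \<preceq>[ty X x', ty Y y] \<phi> (x', y)"
  shows "is_dist Q X Y \<phi>"
proof -
  note [simp] = qcat_simps closed X Y
  have "comp Q (ty X x') (ty Y y) (ty Y y') (carr Y (y, y'))
      (comp Q (ty X x') (ty X x) (ty Y y) (\<phi> (x, y)) (carr X (x', x))) \<preceq>[ty X x', ty Y y'] \<phi> (x', y')"
    if [simp]: "x \<in> carrier X" "x' \<in> carrier X" "y \<in> carrier Y" "y' \<in> carrier Y" for x x' y y'
    using comp_mono_right[OF _ _ _ _ _ _ right[of x x' y], of "ty Y y'" "carr Y (y, y')"]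
      left[of x' y y']
    by (auto elim!: le_trans)
  then show ?thesis
    unfolding is_dist_def using ext by (auto simp: PiE_def)
qed

lemma carr_dist:
  assumes X: "is_qcat Q X"
  shows "is_dist Q X X (carr X)"
  using X unfolding is_qcat_def
  by (intro is_distI[OF X X]) (auto simp: PiE_def qcat_carr[OF X])

section \<open>Pointwise order of distributors\<close>

lemma dist_le_refl:
  assumes "is_qcat Q X" "is_qcat Q Y" "is_dist Q X Y \<phi>"
  shows "dist_le Q X Y \<phi> \<phi>"
  using assms by (auto simp: dist_le_def qcat_ty intro!: le_refl is_dist_closed)

lemma dist_le_trans:
  assumes "is_qcat Q X" "is_qcat Q Y" "is_dist Q X Y \<phi>" "is_dist Q X Y \<psi>" "is_dist Q X Y \<chi>"
    and "dist_le Q X Y \<phi> \<psi>" "dist_le Q X Y \<psi> \<chi>"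
  shows "dist_le Q X Y \<phi> \<chi>"
  using assms unfolding dist_le_def
  by (blast intro: le_trans qcat_ty is_dist_closed)

lemma dist_le_antisym:
  assumes "is_qcat Q X" "is_qcat Q Y" "is_dist Q X Y \<phi>" "is_dist Q X Y \<psi>"
    and "dist_le Q X Y \<phi> \<psi>" "dist_le Q X Y \<psi> \<phi>"
  shows "\<phi> = \<psi>"
  using assms unfolding dist_le_def
  by (intro dist_eqI[OF assms(3,4)]) (blast intro: le_antisym qcat_ty is_dist_closed)

section \<open>Composition of distributors\<close>

lemma dist_comp_apply:
  "\<lbrakk>x \<in> carrier X; z \<in> carrier Z\<rbrakk> \<Longrightarrow> dist_comp Q X Y Z \<psi> \<phi> (x, z) =
    \<Squnion>\<^bsub>hom Q (ty X x) (ty Z z)\<^esub>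
        ((\<lambda>y. comp Q (ty X x) (ty Y y) (ty Z z) (\<psi> (y, z)) (\<phi> (x, y))) ` carrier Y)"
  by (simp add: dist_comp_def)

lemma dist_comp_closed:
  assumes "is_qcat Q X" "is_qcat Q Y" "is_qcat Q Z" "is_dist Q X Y \<phi>" "is_dist Q Y Z \<psi>"
    "x \<in> carrier X" "z \<in> carrier Z"
  shows "dist_comp Q X Y Z \<psi> \<phi> (x, z) \<in> Hom (ty X x) (ty Z z)"
  using assms by (auto simp: dist_comp_apply qcat_simps is_dist_closed intro!: Sup_closed)

lemma dist_comp_apply_le_iff:
  assumes "is_qcat Q X" "is_qcat Q Y" "is_qcat Q Z" "is_dist Q X Y \<phi>" "is_dist Q Y Z \<psi>"
    "x \<in> carrier X" "z \<in> carrier Z" "t \<in> Hom (ty X x) (ty Z z)"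
  shows "dist_comp Q X Y Z \<psi> \<phi> (x, z) \<preceq>[ty X x, ty Z z] t \<longleftrightarrow>
    (\<forall>y\<in>carrier Y. comp Q (ty X x) (ty Y y) (ty Z z) (\<psi> (y, z)) (\<phi> (x, y)) \<preceq>[ty X x, ty Z z] t)"
  unfolding dist_comp_apply[OF assms(6,7)]
  using assms by (intro Sup_le_iff) (auto simp: qcat_simps is_dist_closed)

lemma dist_comp_upper:
  assumes "is_qcat Q X" "is_qcat Q Y" "is_qcat Q Z" "is_dist Q X Y \<phi>" "is_dist Q Y Z \<psi>"
    "x \<in> carrier X" "y \<in> carrier Y" "z \<in> carrier Z"
  shows "comp Q (ty X x) (ty Y y) (ty Z z) (\<psi> (y, z)) (\<phi> (x, y)) \<preceq>[ty X x, ty Z z] dist_comp Q X Y Z \<psi> \<phi> (x, z)"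
  using dist_comp_apply_le_iff[OF assms(1-6,8) dist_comp_closed[OF assms(1-6,8)]] assms
  by (auto intro!: le_refl dist_comp_closed qcat_ty)

text \<open>An outer factor \<open>w\<close> is moved into the join over \<open>Y\<close> and
  absorbed by \<psi> through associativity. In this form an action on the target applies directly to
  \<psi>; \<open>dist_comp_comp_le_iff\<close> is the mirror image for the source and
  \<phi>.\<close>

lemma comp_dist_comp_le_iff:
  assumes "is_qcat Q X" "is_qcat Q Y" "is_qcat Q Z" "is_dist Q X Y \<phi>" "is_dist Q Y Z \<psi>"
    "x \<in> carrier X" "z \<in> carrier Z" "r \<in> ob Q" "w \<in> Hom (ty Z z) r" "t \<in> Hom (ty X x) r"
  shows "comp Q (ty X x) (ty Z z) r w (dist_comp Q X Y Z \<psi> \<phi> (x, z)) \<preceq>[ty X x, r] t \<longleftrightarrow>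
    (\<forall>y\<in>carrier Y. comp Q (ty X x) (ty Y y) r (comp Q (ty Y y) (ty Z z) r w (\<psi> (y, z))) (\<phi> (x, y))
       \<preceq>[ty X x, r] t)"
proof -
  note [simp] = qcat_simps is_dist_closed[OF assms(4)] is_dist_closed[OF assms(5)] assms
  have "comp Q (ty X x) (ty Z z) r w (dist_comp Q X Y Z \<psi> \<phi> (x, z)) =
    \<Squnion>\<^bsub>hom Q (ty X x) r\<^esub> ((\<lambda>y. comp Q (ty X x) (ty Z z) r w
        (comp Q (ty X x) (ty Y y) (ty Z z) (\<psi> (y, z)) (\<phi> (x, y)))) ` carrier Y)"
    unfolding dist_comp_apply[OF assms(6,7)] by (rule comp_SUP_right) auto
  moreover have "\<dots> \<preceq>[ty X x, r] t \<longleftrightarrow> (\<forall>y\<in>carrier Y. comp Q (ty X x) (ty Z z) r w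
        (comp Q (ty X x) (ty Y y) (ty Z z) (\<psi> (y, z)) (\<phi> (x, y))) \<preceq>[ty X x, r] t)"
    by (rule Sup_le_iff) auto
  moreover have "comp Q (ty X x) (ty Z z) r w
        (comp Q (ty X x) (ty Y y) (ty Z z) (\<psi> (y, z)) (\<phi> (x, y))) =
      comp Q (ty X x) (ty Y y) r (comp Q (ty Y y) (ty Z z) r w (\<psi> (y, z))) (\<phi> (x, y))"
    if "y \<in> carrier Y" for y
    using that by (simp add: comp_assoc)
  ultimately show ?thesis by simp
qed

lemma dist_comp_comp_le_iff:
  assumes "is_qcat Q X" "is_qcat Q Y" "is_qcat Q Z" "is_dist Q X Y \<phi>" "is_dist Q Y Z \<psi>"
    "x \<in> carrier X" "z \<in> carrier Z" "r \<in> ob Q" "w \<in> Hom r (ty X x)" "t \<in> Hom r (ty Z z)"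
  shows "comp Q r (ty X x) (ty Z z) (dist_comp Q X Y Z \<psi> \<phi> (x, z)) w \<preceq>[r, ty Z z] t \<longleftrightarrow>
    (\<forall>y\<in>carrier Y. comp Q r (ty Y y) (ty Z z) (\<psi> (y, z)) (comp Q r (ty X x) (ty Y y) (\<phi> (x, y)) w)
       \<preceq>[r, ty Z z] t)"
proof -
  note [simp] = qcat_simps is_dist_closed[OF assms(4)] is_dist_closed[OF assms(5)] assms
  have "comp Q r (ty X x) (ty Z z) (dist_comp Q X Y Z \<psi> \<phi> (x, z)) w =
    \<Squnion>\<^bsub>hom Q r (ty Z z)\<^esub> ((\<lambda>y. comp Q r (ty X x) (ty Z z)
        (comp Q (ty X x) (ty Y y) (ty Z z) (\<psi> (y, z)) (\<phi> (x, y))) w) ` carrier Y)"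
    unfolding dist_comp_apply[OF assms(6,7)] by (rule comp_SUP_left) auto
  moreover have "\<dots> \<preceq>[r, ty Z z] t \<longleftrightarrow> (\<forall>y\<in>carrier Y. comp Q r (ty X x) (ty Z z)
        (comp Q (ty X x) (ty Y y) (ty Z z) (\<psi> (y, z)) (\<phi> (x, y))) w \<preceq>[r, ty Z z] t)"
    by (rule Sup_le_iff) auto
  moreover have "comp Q r (ty X x) (ty Z z)
        (comp Q (ty X x) (ty Y y) (ty Z z) (\<psi> (y, z)) (\<phi> (x, y))) w =
      comp Q r (ty Y y) (ty Z z) (\<psi> (y, z)) (comp Q r (ty X x) (ty Y y) (\<phi> (x, y)) w)"
    if "y \<in> carrier Y" for y
    using that by (simp add: comp_assoc)
  ultimately show ?thesis by simp
qed

lemma dist_comp_dist: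
  assumes X: "is_qcat Q X" and Y: "is_qcat Q Y" and Z: "is_qcat Q Z"
    and \<phi>: "is_dist Q X Y \<phi>" and \<psi>: "is_dist Q Y Z \<psi>"
  shows "is_dist Q X Z (dist_comp Q X Y Z \<psi> \<phi>)"
proof (rule is_distI[OF X Z])
  note [simp] = qcat_simps is_dist_closed[OF \<phi>] is_dist_closed[OF \<psi>] dist_comp_closed[OF assms] assms
  note up = dist_comp_upper[OF assms]
  show "dist_comp Q X Y Z \<psi> \<phi> \<in> extensional (carrier X \<times> carrier Z)"
    by (simp add: dist_comp_def)
  fix x z assume [simp]: "x \<in> carrier X" "z \<in> carrier Z"
  show "dist_comp Q X Y Z \<psi> \<phi> (x, z) \<in> Hom (ty X x) (ty Z z)"
    by simp
  show "comp Q (ty X x) (ty Z z) (ty Z z') (carr Z (z, z')) (dist_comp Q X Y Z \<psi> \<phi> (x, z))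
        \<preceq>[ty X x, ty Z z'] dist_comp Q X Y Z \<psi> \<phi> (x, z')" if [simp]: "z' \<in> carrier Z" for z'
    unfolding comp_dist_comp_le_iff[OF assms \<open>x \<in> carrier X\<close> \<open>z \<in> carrier Z\<close>, of "ty Z z'" "carr Z (z, z')"
        "dist_comp Q X Y Z \<psi> \<phi> (x, z')", simplified]
  proof
    fix y assume [simp]: "y \<in> carrier Y"
    show "comp Q (ty X x) (ty Y y) (ty Z z')
          (comp Q (ty Y y) (ty Z z) (ty Z z') (carr Z (z, z')) (\<psi> (y, z))) (\<phi> (x, y))
        \<preceq>[ty X x, ty Z z'] dist_comp Q X Y Z \<psi> \<phi> (x, z')"
      by (rule le_trans[OF comp_mono_left[OF _ _ _ _ _ _ dist_act_left[OF Y Z \<psi>]] up]) auto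
  qed
  show "comp Q (ty X x') (ty X x) (ty Z z) (dist_comp Q X Y Z \<psi> \<phi> (x, z)) (carr X (x', x))
        \<preceq>[ty X x', ty Z z] dist_comp Q X Y Z \<psi> \<phi> (x', z)" if [simp]: "x' \<in> carrier X" for x'
    unfolding dist_comp_comp_le_iff[OF assms \<open>x \<in> carrier X\<close> \<open>z \<in> carrier Z\<close>, of "ty X x'" "carr X (x', x)"
        "dist_comp Q X Y Z \<psi> \<phi> (x', z)", simplified]
  proof
    fix y assume [simp]: "y \<in> carrier Y"
    show "comp Q (ty X x') (ty Y y) (ty Z z) (\<psi> (y, z))
          (comp Q (ty X x') (ty X x) (ty Y y) (\<phi> (x, y)) (carr X (x', x)))
        \<preceq>[ty X x', ty Z z] dist_comp Q X Y Z \<psi> \<phi> (x', z)"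
      by (rule le_trans[OF comp_mono_right[OF _ _ _ _ _ _ dist_act_right[OF X Y \<phi>]] up]) auto
  qed
qed

text \<open>An upper bound of either side is an upper bound of all triple composites; the two
  conditions differ only in the order of the quantifiers over \<open>Y\<close> and
  \<open>Z\<close>.\<close>

lemma dist_comp_assoc:
  assumes X: "is_qcat Q X" and Y: "is_qcat Q Y" and Z: "is_qcat Q Z" and W: "is_qcat Q W"
    and \<phi>: "is_dist Q X Y \<phi>" and \<psi>: "is_dist Q Y Z \<psi>" and \<chi>: "is_dist Q Z W \<chi>"
  shows "dist_comp Q X Y W (dist_comp Q Y Z W \<chi> \<psi>) \<phi> = dist_comp Q X Z W \<chi> (dist_comp Q X Y Z \<psi> \<phi>)"
proof -
  note cat = X Y Z W
  note dist = \<phi> \<psi> \<chi> dist_comp_dist[OF X Y Z \<phi> \<psi>] dist_comp_dist[OF Y Z W \<psi> \<chi>]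
  note [simp] = cat dist qcat_simps dist[THEN is_dist_closed]
  note d = dist_comp_dist[OF X Y W dist(1,5)] dist_comp_dist[OF X Z W dist(4,3)]
  note [simp] = d[THEN is_dist_closed]
  show ?thesis
  proof (rule dist_eqI[OF d])
    fix x w assume [simp]: "x \<in> carrier X" "w \<in> carrier W"
    show "dist_comp Q X Y W (dist_comp Q Y Z W \<chi> \<psi>) \<phi> (x, w) =
      dist_comp Q X Z W \<chi> (dist_comp Q X Y Z \<psi> \<phi>) (x, w)"
    proof (rule eq_by_upper_bounds[of "ty X x" "ty W w"])
      fix t assume [simp]: "t \<in> Hom (ty X x) (ty W w)"
      have "dist_comp Q X Y W (dist_comp Q Y Z W \<chi> \<psi>) \<phi> (x, w) \<preceq>[ty X x, ty W w] t \<longleftrightarrow>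
        (\<forall>y\<in>carrier Y. \<forall>z\<in>carrier Z. comp Q (ty X x) (ty Z z) (ty W w) (\<chi> (z, w))
          (comp Q (ty X x) (ty Y y) (ty Z z) (\<psi> (y, z)) (\<phi> (x, y))) \<preceq>[ty X x, ty W w] t)"
        by (simp add: dist_comp_apply_le_iff dist_comp_comp_le_iff)
      moreover have "dist_comp Q X Z W \<chi> (dist_comp Q X Y Z \<psi> \<phi>) (x, w) \<preceq>[ty X x, ty W w] t \<longleftrightarrow>
        (\<forall>z\<in>carrier Z. \<forall>y\<in>carrier Y. comp Q (ty X x) (ty Z z) (ty W w) (\<chi> (z, w))
          (comp Q (ty X x) (ty Y y) (ty Z z) (\<psi> (y, z)) (\<phi> (x, y))) \<preceq>[ty X x, ty W w] t)"
        by (simp add: dist_comp_apply_le_iff comp_dist_comp_le_iff comp_assoc)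
      ultimately show "dist_comp Q X Y W (dist_comp Q Y Z W \<chi> \<psi>) \<phi> (x, w) \<preceq>[ty X x, ty W w] t \<longleftrightarrow>
        dist_comp Q X Z W \<chi> (dist_comp Q X Y Z \<psi> \<phi>) (x, w) \<preceq>[ty X x, ty W w] t"
        by blast
    qed auto
  qed
qed

text \<open>Every term of the join is below \<phi> by the right action, and the term with middle
  element x is above \<phi> by reflexivity of \<open>X\<close>.\<close>

lemma dist_comp_ident_right:
  assumes X: "is_qcat Q X" and Y: "is_qcat Q Y" and \<phi>: "is_dist Q X Y \<phi>"
  shows "dist_comp Q X X Y \<phi> (carr X) = \<phi>"
proof (rule dist_eqI[OF dist_comp_dist[OF X X Y carr_dist[OF X] \<phi>] \<phi>])
  note [simp] = assms qcat_simps is_dist_closed[OF \<phi>] carr_dist[OF X] dist_comp_closed[OF X X Y carr_dist[OF X] \<phi>]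
  fix x y assume [simp]: "x \<in> carrier X" "y \<in> carrier Y"
  have "dist_comp Q X X Y \<phi> (carr X) (x, y) \<preceq>[ty X x, ty Y y] \<phi> (x, y)"
    by (simp add: dist_comp_apply_le_iff dist_act_right)
  moreover have "\<phi> (x, y) \<preceq>[ty X x, ty Y y] comp Q (ty X x) (ty X x) (ty Y y) (\<phi> (x, y)) (carr X (x, x))"
    by (rule le_comp_right) (simp_all add: qcat_refl)
  then have "\<phi> (x, y) \<preceq>[ty X x, ty Y y] dist_comp Q X X Y \<phi> (carr X) (x, y)"
    by (rule le_trans[OF _ dist_comp_upper]) auto
  ultimately show "dist_comp Q X X Y \<phi> (carr X) (x, y) = \<phi> (x, y)"
    by (rule le_antisym) auto
qed

lemma dist_comp_ident_left:
  assumes X: "is_qcat Q X" and Y: "is_qcat Q Y" and \<phi>: "is_dist Q X Y \<phi>"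
  shows "dist_comp Q X Y Y (carr Y) \<phi> = \<phi>"
proof (rule dist_eqI[OF dist_comp_dist[OF X Y Y \<phi> carr_dist[OF Y]] \<phi>])
  note [simp] = assms qcat_simps is_dist_closed[OF \<phi>] carr_dist[OF Y] dist_comp_closed[OF X Y Y \<phi> carr_dist[OF Y]]
  fix x y assume [simp]: "x \<in> carrier X" "y \<in> carrier Y"
  have "dist_comp Q X Y Y (carr Y) \<phi> (x, y) \<preceq>[ty X x, ty Y y] \<phi> (x, y)"
    by (simp add: dist_comp_apply_le_iff dist_act_left)
  moreover have "\<phi> (x, y) \<preceq>[ty X x, ty Y y] comp Q (ty X x) (ty Y y) (ty Y y) (carr Y (y, y)) (\<phi> (x, y))"
    by (rule le_comp_left) (simp_all add: qcat_refl)
  then have "\<phi> (x, y) \<preceq>[ty X x, ty Y y] dist_comp Q X Y Y (carr Y) \<phi> (x, y)"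
    by (rule le_trans[OF _ dist_comp_upper]) auto
  ultimately show "dist_comp Q X Y Y (carr Y) \<phi> (x, y) = \<phi> (x, y)"
    by (rule le_antisym) auto
qed

lemma dist_comp_mono:
  assumes X: "is_qcat Q X" and Y: "is_qcat Q Y" and Z: "is_qcat Q Z"
    and d: "is_dist Q X Y \<phi>" "is_dist Q X Y \<phi>'" "is_dist Q Y Z \<psi>" "is_dist Q Y Z \<psi>'"
    and le: "dist_le Q X Y \<phi> \<phi>'" "dist_le Q Y Z \<psi> \<psi>'"
  shows "dist_le Q X Z (dist_comp Q X Y Z \<psi> \<phi>) (dist_comp Q X Y Z \<psi>' \<phi>')"
  unfolding dist_le_def
proof (intro ballI)
  note [simp] = assms qcat_simps d[THEN is_dist_closed] dist_comp_closed
  fix x z assume [simp]: "x \<in> carrier X" "z \<in> carrier Z"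
  have "comp Q (ty X x) (ty Y y) (ty Z z) (\<psi> (y, z)) (\<phi> (x, y)) \<preceq>[ty X x, ty Z z]
      dist_comp Q X Y Z \<psi>' \<phi>' (x, z)" if [simp]: "y \<in> carrier Y" for y
    using le by (intro le_trans[OF comp_mono dist_comp_upper]) (auto simp: dist_le_def)
  then show "dist_comp Q X Y Z \<psi> \<phi> (x, z) \<preceq>[ty X x, ty Z z] dist_comp Q X Y Z \<psi>' \<phi>' (x, z)"
    by (simp add: dist_comp_apply_le_iff)
qed

section \<open>Joins of distributors\<close>

lemma dist_Sup_apply:
  "\<lbrakk>x \<in> carrier X; y \<in> carrier Y\<rbrakk> \<Longrightarrow>
    dist_Sup Q X Y \<Phi> (x, y) = \<Squnion>\<^bsub>hom Q (ty X x) (ty Y y)\<^esub> ((\<lambda>\<phi>. \<phi> (x, y)) ` \<Phi>)"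
  by (simp add: dist_Sup_def)

lemma dist_Sup_dist:
  assumes X: "is_qcat Q X" and Y: "is_qcat Q Y" and \<Phi>: "\<And>\<phi>. \<phi> \<in> \<Phi> \<Longrightarrow> is_dist Q X Y \<phi>"
  shows "is_dist Q X Y (dist_Sup Q X Y \<Phi>)"
proof (rule is_distI[OF X Y])
  note [simp] = X Y qcat_simps is_dist_closed[OF \<Phi>]
  show "dist_Sup Q X Y \<Phi> \<in> extensional (carrier X \<times> carrier Y)"
    by (simp add: dist_Sup_def)
  have cl[simp]: "\<Squnion>\<^bsub>hom Q (ty X x) (ty Y y)\<^esub> ((\<lambda>\<phi>. \<phi> (x, y)) ` \<Phi>) \<in> Hom (ty X x) (ty Y y)"
    if "x \<in> carrier X" "y \<in> carrier Y" for x y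
    using that by (intro Sup_closed) auto
  have up: "\<phi> (x, y) \<preceq>[ty X x, ty Y y] \<Squnion>\<^bsub>hom Q (ty X x) (ty Y y)\<^esub> ((\<lambda>\<phi>. \<phi> (x, y)) ` \<Phi>)"
    if "x \<in> carrier X" "y \<in> carrier Y" "\<phi> \<in> \<Phi>" for x y \<phi>
    using that Sup_upper[of "ty X x" "ty Y y" \<Phi> "\<lambda>\<phi>. \<phi> (x, y)" \<phi>] by simp
  fix x y assume xy[simp]: "x \<in> carrier X" "y \<in> carrier Y"
  show "dist_Sup Q X Y \<Phi> (x, y) \<in> Hom (ty X x) (ty Y y)"
    by (simp add: dist_Sup_apply)
  show "comp Q (ty X x) (ty Y y) (ty Y y') (carr Y (y, y')) (dist_Sup Q X Y \<Phi> (x, y))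
      \<preceq>[ty X x, ty Y y'] dist_Sup Q X Y \<Phi> (x, y')" if [simp]: "y' \<in> carrier Y" for y'
  proof -
    have "comp Q (ty X x) (ty Y y) (ty Y y') (carr Y (y, y')) (\<phi> (x, y))
        \<preceq>[ty X x, ty Y y'] dist_Sup Q X Y \<Phi> (x, y')" if [simp]: "\<phi> \<in> \<Phi>" for \<phi>
      by (rule le_trans[OF dist_act_left[OF X Y \<Phi>]]) (auto simp: dist_Sup_apply up)
    then show ?thesis
      by (simp add: dist_Sup_apply comp_SUP_right Sup_le_iff)
  qed
  show "comp Q (ty X x') (ty X x) (ty Y y) (dist_Sup Q X Y \<Phi> (x, y)) (carr X (x', x))
      \<preceq>[ty X x', ty Y y] dist_Sup Q X Y \<Phi> (x', y)" if [simp]: "x' \<in> carrier X" for x'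
  proof -
    have "comp Q (ty X x') (ty X x) (ty Y y) (\<phi> (x, y)) (carr X (x', x))
        \<preceq>[ty X x', ty Y y] dist_Sup Q X Y \<Phi> (x', y)" if [simp]: "\<phi> \<in> \<Phi>" for \<phi>
      by (rule le_trans[OF dist_act_right[OF X Y \<Phi>]]) (auto simp: dist_Sup_apply up)
    then show ?thesis
      by (simp add: dist_Sup_apply comp_SUP_left Sup_le_iff)
  qed
qed

lemma dist_Sup_le_iff:
  assumes "is_qcat Q X" "is_qcat Q Y" "\<And>\<phi>. \<phi> \<in> \<Phi> \<Longrightarrow> is_dist Q X Y \<phi>" "is_dist Q X Y \<psi>"
  shows "dist_le Q X Y (dist_Sup Q X Y \<Phi>) \<psi> \<longleftrightarrow> (\<forall>\<phi>\<in>\<Phi>. dist_le Q X Y \<phi> \<psi>)"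
proof -
  note [simp] = assms qcat_simps assms(3,4)[THEN is_dist_closed]
  show ?thesis
    unfolding dist_le_def by (auto simp: dist_Sup_apply Sup_le_iff)
qed

lemma dist_Sup_upper:
  assumes "is_qcat Q X" "is_qcat Q Y" "\<And>\<phi>. \<phi> \<in> \<Phi> \<Longrightarrow> is_dist Q X Y \<phi>" "\<phi> \<in> \<Phi>"
  shows "dist_le Q X Y \<phi> (dist_Sup Q X Y \<Phi>)"
proof -
  have d: "is_dist Q X Y (dist_Sup Q X Y \<Phi>)"
    using assms by (intro dist_Sup_dist) auto
  have "\<forall>\<phi>\<in>\<Phi>. dist_le Q X Y \<phi> (dist_Sup Q X Y \<Phi>)"
    by (rule dist_Sup_le_iff[THEN iffD1, OF assms(1-2) _ d dist_le_refl[OF assms(1-2) d]])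
      (rule assms(3))
  then show ?thesis using assms(4) ..
qed

lemma dist_comp_le_iff:
  assumes "is_qcat Q X" "is_qcat Q Y" "is_qcat Q Z" "is_dist Q X Y \<phi>" "is_dist Q Y Z \<psi>" "is_dist Q X Z \<chi>"
  shows "dist_le Q X Z (dist_comp Q X Y Z \<psi> \<phi>) \<chi> \<longleftrightarrow>
    (\<forall>x\<in>carrier X. \<forall>y\<in>carrier Y. \<forall>z\<in>carrier Z.
       comp Q (ty X x) (ty Y y) (ty Z z) (\<psi> (y, z)) (\<phi> (x, y)) \<preceq>[ty X x, ty Z z] \<chi> (x, z))"
  unfolding dist_le_def using assms by (auto simp: dist_comp_apply_le_iff is_dist_closed)

lemma dist_eq_by_upper_bounds:
  assumes "is_qcat Q X" "is_qcat Q Y" "is_dist Q X Y \<phi>" "is_dist Q X Y \<psi>"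
    and "\<And>\<chi>. is_dist Q X Y \<chi> \<Longrightarrow> dist_le Q X Y \<phi> \<chi> \<longleftrightarrow> dist_le Q X Y \<psi> \<chi>"
  shows "\<phi> = \<psi>"
  using assms by (intro dist_le_antisym[OF assms(1-4)]) (auto intro: dist_le_refl)

text \<open>Both sides have the same upper bounds: join preservation in the base quantaloid reduces
  either condition to the inequalities for single \<psi> and single elements.\<close>

lemma dist_comp_Sup_left:
  assumes X: "is_qcat Q X" and Y: "is_qcat Q Y" and Z: "is_qcat Q Z"
    and \<phi>: "is_dist Q X Y \<phi>" and \<Psi>: "\<And>\<psi>. \<psi> \<in> \<Psi> \<Longrightarrow> is_dist Q Y Z \<psi>"
  shows "dist_comp Q X Y Z (dist_Sup Q Y Z \<Psi>) \<phi> = dist_Sup Q X Z ((\<lambda>\<psi>. dist_comp Q X Y Z \<psi> \<phi>) ` \<Psi>)"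
proof -
  note [simp] = X Y Z qcat_simps \<phi> \<Psi> dist_comp_dist dist_Sup_dist \<Psi>[THEN is_dist_closed] \<phi>[THEN is_dist_closed]
    is_dist_closed[where X = X and Y = Z]
  show ?thesis
  proof (rule dist_eq_by_upper_bounds[OF X Z])
    fix \<chi> assume [simp]: "is_dist Q X Z \<chi>"
    have "dist_le Q X Z (dist_Sup Q X Z ((\<lambda>\<psi>. dist_comp Q X Y Z \<psi> \<phi>) ` \<Psi>)) \<chi> \<longleftrightarrow>
      (\<forall>\<psi>\<in>\<Psi>. dist_le Q X Z (dist_comp Q X Y Z \<psi> \<phi>) \<chi>)"
      by (subst dist_Sup_le_iff) auto
    also have "\<dots> \<longleftrightarrow> dist_le Q X Z (dist_comp Q X Y Z (dist_Sup Q Y Z \<Psi>) \<phi>) \<chi>"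
      by (auto simp: dist_comp_le_iff dist_Sup_apply comp_SUP_left Sup_le_iff)
    finally show "dist_le Q X Z (dist_comp Q X Y Z (dist_Sup Q Y Z \<Psi>) \<phi>) \<chi> \<longleftrightarrow>
      dist_le Q X Z (dist_Sup Q X Z ((\<lambda>\<psi>. dist_comp Q X Y Z \<psi> \<phi>) ` \<Psi>)) \<chi>" ..
  qed (auto intro!: dist_comp_dist dist_Sup_dist)
qed

lemma dist_comp_Sup_right:
  assumes X: "is_qcat Q X" and Y: "is_qcat Q Y" and Z: "is_qcat Q Z"
    and \<Phi>: "\<And>\<phi>. \<phi> \<in> \<Phi> \<Longrightarrow> is_dist Q X Y \<phi>" and \<psi>: "is_dist Q Y Z \<psi>"
  shows "dist_comp Q X Y Z \<psi> (dist_Sup Q X Y \<Phi>) = dist_Sup Q X Z (dist_comp Q X Y Z \<psi> ` \<Phi>)"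
proof -
  note [simp] = X Y Z qcat_simps \<psi> \<Phi> dist_comp_dist dist_Sup_dist \<Phi>[THEN is_dist_closed] \<psi>[THEN is_dist_closed]
    is_dist_closed[where X = X and Y = Z]
  show ?thesis
  proof (rule dist_eq_by_upper_bounds[OF X Z])
    fix \<chi> assume [simp]: "is_dist Q X Z \<chi>"
    have "dist_le Q X Z (dist_Sup Q X Z (dist_comp Q X Y Z \<psi> ` \<Phi>)) \<chi> \<longleftrightarrow>
      (\<forall>\<phi>\<in>\<Phi>. dist_le Q X Z (dist_comp Q X Y Z \<psi> \<phi>) \<chi>)"
      by (subst dist_Sup_le_iff) auto
    also have "\<dots> \<longleftrightarrow> dist_le Q X Z (dist_comp Q X Y Z \<psi> (dist_Sup Q X Y \<Phi>)) \<chi>"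
      by (auto simp: dist_comp_le_iff dist_Sup_apply comp_SUP_right Sup_le_iff)
    finally show "dist_le Q X Z (dist_comp Q X Y Z \<psi> (dist_Sup Q X Y \<Phi>)) \<chi> \<longleftrightarrow>
      dist_le Q X Z (dist_Sup Q X Z (dist_comp Q X Y Z \<psi> ` \<Phi>)) \<chi>" ..
  qed (auto intro!: dist_comp_dist dist_Sup_dist)
qed

section \<open>Residuals of distributors\<close>

lemma dist_lres_apply:
  "\<lbrakk>y \<in> carrier Y; z \<in> carrier Z\<rbrakk> \<Longrightarrow> dist_lres Q X Y Z \<xi> \<phi> (y, z) =
    \<Sqinter>\<^bsub>hom Q (ty Y y) (ty Z z)\<^esub>
        ((\<lambda>x. lres Q (ty X x) (ty Y y) (ty Z z) (\<xi> (x, z)) (\<phi> (x, y))) ` carrier X)"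
  by (simp add: dist_lres_def)

lemma dist_lres_closed:
  assumes "is_qcat Q X" "is_qcat Q Y" "is_qcat Q Z" "is_dist Q X Y \<phi>" "is_dist Q X Z \<xi>"
    "y \<in> carrier Y" "z \<in> carrier Z"
  shows "dist_lres Q X Y Z \<xi> \<phi> (y, z) \<in> Hom (ty Y y) (ty Z z)"
  unfolding dist_lres_apply[OF assms(6,7)]
  using assms by (intro Inf_closed lres_closed) (auto simp: qcat_ty is_dist_closed)

text \<open>The residuation law is stated for a single arrow \<open>t\<close> in place of a whole
  distributor. This sharper form describes the homs of presheaf categories as well as the Kan
  adjunction.\<close>

lemma le_dist_lres_iff:
  assumes "is_qcat Q X" "is_qcat Q Y" "is_qcat Q Z" "is_dist Q X Y \<phi>" "is_dist Q X Z \<xi>"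
    "y \<in> carrier Y" "z \<in> carrier Z" "t \<in> Hom (ty Y y) (ty Z z)"
  shows "t \<preceq>[ty Y y, ty Z z] dist_lres Q X Y Z \<xi> \<phi> (y, z) \<longleftrightarrow>
    (\<forall>x\<in>carrier X. comp Q (ty X x) (ty Y y) (ty Z z) t (\<phi> (x, y)) \<preceq>[ty X x, ty Z z] \<xi> (x, z))"
  unfolding dist_lres_apply[OF assms(6,7)]
  using assms by (subst le_Inf_iff) (auto simp: qcat_ty is_dist_closed lres_closed lres_iff)

lemma dist_lres_counit:
  assumes "is_qcat Q X" "is_qcat Q Y" "is_qcat Q Z" "is_dist Q X Y \<phi>" "is_dist Q X Z \<xi>"
    "y \<in> carrier Y" "z \<in> carrier Z" "x \<in> carrier X"
  shows "comp Q (ty X x) (ty Y y) (ty Z z) (dist_lres Q X Y Z \<xi> \<phi> (y, z)) (\<phi> (x, y)) \<preceq>[ty X x, ty Z z] \<xi> (x, z)"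
  using le_dist_lres_iff[OF assms(1-7) dist_lres_closed[OF assms(1-7)]] assms
  by (auto intro!: le_refl dist_lres_closed qcat_ty)

text \<open>Both actions are transposed across the residual. For the target, the counit is followed
  by the action on \<xi>; for the source, associativity hands the arrow of \<open>Y\<close> to
  \<phi>, which absorbs it before the counit applies.\<close>

lemma dist_lres_dist:
  assumes X: "is_qcat Q X" and Y: "is_qcat Q Y" and Z: "is_qcat Q Z"
    and \<phi>: "is_dist Q X Y \<phi>" and \<xi>: "is_dist Q X Z \<xi>"
  shows "is_dist Q Y Z (dist_lres Q X Y Z \<xi> \<phi>)"
proof (rule is_distI[OF Y Z])
  note [simp] = assms qcat_simps \<phi>[THEN is_dist_closed] \<xi>[THEN is_dist_closed] dist_lres_closed[OF assms]
  note counit = dist_lres_counit[OF assms]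
  show "dist_lres Q X Y Z \<xi> \<phi> \<in> extensional (carrier Y \<times> carrier Z)"
    by (simp add: dist_lres_def)
  fix y z assume yz[simp]: "y \<in> carrier Y" "z \<in> carrier Z"
  show "dist_lres Q X Y Z \<xi> \<phi> (y, z) \<in> Hom (ty Y y) (ty Z z)"
    by simp
  show "comp Q (ty Y y) (ty Z z) (ty Z z') (carr Z (z, z')) (dist_lres Q X Y Z \<xi> \<phi> (y, z))
      \<preceq>[ty Y y, ty Z z'] dist_lres Q X Y Z \<xi> \<phi> (y, z')" if [simp]: "z' \<in> carrier Z" for z'
  proof (subst le_dist_lres_iff, simp_all, intro ballI)
    fix x assume [simp]: "x \<in> carrier X"
    have "comp Q (ty X x) (ty Y y) (ty Z z')
          (comp Q (ty Y y) (ty Z z) (ty Z z') (carr Z (z, z')) (dist_lres Q X Y Z \<xi> \<phi> (y, z))) (\<phi> (x, y)) =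
        comp Q (ty X x) (ty Z z) (ty Z z') (carr Z (z, z'))
          (comp Q (ty X x) (ty Y y) (ty Z z) (dist_lres Q X Y Z \<xi> \<phi> (y, z)) (\<phi> (x, y)))"
      by (simp add: comp_assoc)
    also have "\<dots> \<preceq>[ty X x, ty Z z'] \<xi> (x, z')"
      by (rule le_trans[OF comp_mono_right[OF _ _ _ _ _ _ counit] dist_act_left[OF X Z \<xi>]]) auto
    finally show "comp Q (ty X x) (ty Y y) (ty Z z')
          (comp Q (ty Y y) (ty Z z) (ty Z z') (carr Z (z, z')) (dist_lres Q X Y Z \<xi> \<phi> (y, z))) (\<phi> (x, y))
        \<preceq>[ty X x, ty Z z'] \<xi> (x, z')" .
  qed
  show "comp Q (ty Y y') (ty Y y) (ty Z z) (dist_lres Q X Y Z \<xi> \<phi> (y, z)) (carr Y (y', y))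
      \<preceq>[ty Y y', ty Z z] dist_lres Q X Y Z \<xi> \<phi> (y', z)" if [simp]: "y' \<in> carrier Y" for y'
  proof (subst le_dist_lres_iff, simp_all, intro ballI)
    fix x assume [simp]: "x \<in> carrier X"
    have "comp Q (ty X x) (ty Y y') (ty Z z)
          (comp Q (ty Y y') (ty Y y) (ty Z z) (dist_lres Q X Y Z \<xi> \<phi> (y, z)) (carr Y (y', y))) (\<phi> (x, y')) =
        comp Q (ty X x) (ty Y y) (ty Z z) (dist_lres Q X Y Z \<xi> \<phi> (y, z))
          (comp Q (ty X x) (ty Y y') (ty Y y) (carr Y (y', y)) (\<phi> (x, y')))"
      by (simp add: comp_assoc)
    also have "\<dots> \<preceq>[ty X x, ty Z z] \<xi> (x, z)"
      by (rule le_trans[OF comp_mono_right[OF _ _ _ _ _ _ dist_act_left[OF X Y \<phi>]] counit]) auto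
    finally show "comp Q (ty X x) (ty Y y') (ty Z z)
          (comp Q (ty Y y') (ty Y y) (ty Z z) (dist_lres Q X Y Z \<xi> \<phi> (y, z)) (carr Y (y', y))) (\<phi> (x, y'))
        \<preceq>[ty X x, ty Z z] \<xi> (x, z)" .
  qed
qed

end

section \<open>Presheaves\<close>

lemma point_simps [simp]:
  "carrier (point Q q) = {()}" "ty (point Q q) = (\<lambda>_. q)" "carr (point Q q) = (\<lambda>_. ident Q q)"
  by (simp_all add: point_def)

lemma PSh_carrier_iff:
  "m \<in> carrier (PSh Q X) \<longleftrightarrow> fst m \<in> ob Q \<and> is_dist Q X (point Q (fst m)) (snd m)"
  by (auto simp: PSh_def presheaves_def split_beta)

lemma PSh_ty: "m \<in> carrier (PSh Q X) \<Longrightarrow> ty (PSh Q X) m = fst m"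
  by (auto simp: PSh_def split_beta)

lemma PSh_carr:
  "\<lbrakk>m \<in> carrier (PSh Q X); n \<in> carrier (PSh Q X)\<rbrakk> \<Longrightarrow> carr (PSh Q X) (m, n) =
    dist_lres Q X (point Q (fst m)) (point Q (fst n)) (snd n) (snd m) ((), ())"
  by (auto simp: PSh_def split_beta)

lemma kan_upper_apply:
  "n \<in> carrier (PSh Q Y) \<Longrightarrow>
    kan_upper Q X Y \<phi> n = (fst n, dist_comp Q X Y (point Q (fst n)) (snd n) \<phi>)"
  by (auto simp: kan_upper_def split_beta)

lemma kan_lower_apply:
  "m \<in> carrier (PSh Q X) \<Longrightarrow>
    kan_lower Q X Y \<phi> m = (fst m, dist_lres Q X Y (point Q (fst m)) (snd m) \<phi>)"
  by (auto simp: kan_lower_def split_beta)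

lemma kan_upper_fst: "n \<in> carrier (PSh Q Y) \<Longrightarrow> fst (kan_upper Q X Y \<phi> n) = fst n"
  by (simp add: kan_upper_apply)

lemma kan_lower_fst: "m \<in> carrier (PSh Q X) \<Longrightarrow> fst (kan_lower Q X Y \<phi> m) = fst m"
  by (simp add: kan_lower_apply)

context quantaloid
begin

section \<open>Underlying preorders and composition of functors\<close>

lemma qcat_le_refl: "\<lbrakk>is_qcat Q X; x \<in> carrier X\<rbrakk> \<Longrightarrow> qcat_le Q X x x"
  by (simp add: qcat_le_def qcat_refl)

lemma qcat_le_trans:
  assumes X: "is_qcat Q X" and [simp]: "x \<in> carrier X" "y \<in> carrier X" "z \<in> carrier X"
    and le: "qcat_le Q X x y" "qcat_le Q X y z"
  shows "qcat_le Q X x z"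
proof -
  note [simp] = X qcat_simps
  have ty[simp]: "ty X y = ty X x" "ty X z = ty X x"
    using le by (auto simp: qcat_le_def)
  have cl: "carr X (x, y) \<in> Hom (ty X x) (ty X x)" "carr X (y, z) \<in> Hom (ty X x) (ty X x)"
      "carr X (x, z) \<in> Hom (ty X x) (ty X x)"
    using qcat_carr[OF X, of x y] qcat_carr[OF X, of y z] qcat_carr[OF X, of x z] by simp_all
  have "ident Q (ty X x) = comp Q (ty X x) (ty X x) (ty X x) (ident Q (ty X x)) (ident Q (ty X x))"
    by simp
  also have "\<dots> \<preceq>[ty X x, ty X x] comp Q (ty X x) (ty X x) (ty X x) (carr X (y, z)) (carr X (x, y))"
    using le cl by (intro comp_mono) (auto simp: qcat_le_def)
  finally show ?thesis
    using qcat_trans[OF X, of x y z] cl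
    by (auto simp: qcat_le_def intro: le_trans)
qed

lemma qfunctor_closed: "\<lbrakk>is_qfunctor Q X Y f; x \<in> carrier X\<rbrakk> \<Longrightarrow> f x \<in> carrier Y"
  by (auto simp: is_qfunctor_def)

lemma qfunctor_mono:
  assumes X: "is_qcat Q X" and Y: "is_qcat Q Y" and f: "is_qfunctor Q X Y f"
    and xy: "x \<in> carrier X" "y \<in> carrier X" and le: "qcat_le Q X x y"
  shows "qcat_le Q Y (f x) (f y)"
proof -
  have ty[simp]: "ty X y = ty X x" "ty Y (f x) = ty X x" "ty Y (f y) = ty X x"
    using le f xy by (auto simp: qcat_le_def is_qfunctor_def)
  have "carr X (x, y) \<preceq>[ty X x, ty X x] carr Y (f x, f y)"
    using f xy unfolding is_qfunctor_def by (metis ty(1))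
  then show ?thesis
    using le xy X Y qcat_carr[OF X, of x y] qcat_carr[OF Y, of "f x" "f y"] qfunctor_closed[OF f]
    by (auto simp: qcat_le_def qcat_simps intro: le_trans)
qed

lemma qfunctor_compose:
  assumes X: "is_qcat Q X" and Y: "is_qcat Q Y" and Z: "is_qcat Q Z"
    and f: "is_qfunctor Q X Y f" and g: "is_qfunctor Q Y Z g"
  shows "is_qfunctor Q X Z (compose (carrier X) g f)"
proof -
  have ty[simp]: "ty Y (f x) = ty X x" "ty Z (g (f x)) = ty X x" if "x \<in> carrier X" for x
    using f g that qfunctor_closed[OF f that] by (auto simp: is_qfunctor_def)
  have "carr X (x, y) \<preceq>[ty X x, ty X y] carr Z (g (f x), g (f y))"
    if xy[simp]: "x \<in> carrier X" "y \<in> carrier X" for x y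
  proof -
    have "carr X (x, y) \<preceq>[ty X x, ty X y] carr Y (f x, f y)"
      using f xy unfolding is_qfunctor_def by auto
    moreover have "carr Y (f x, f y) \<preceq>[ty X x, ty X y] carr Z (g (f x), g (f y))"
      using g xy qfunctor_closed[OF f] unfolding is_qfunctor_def by (metis ty(1))
    moreover have "carr Y (f x, f y) \<in> Hom (ty X x) (ty X y)" "carr Z (g (f x), g (f y)) \<in> Hom (ty X x) (ty X y)"
      using qcat_carr[OF Y, of "f x" "f y"] qcat_carr[OF Z, of "g (f x)" "g (f y)"]
        qfunctor_closed[OF f] qfunctor_closed[OF g] by simp_all
    ultimately show ?thesis
      using X by (auto intro: le_trans simp: qcat_simps)
  qed
  then show ?thesis
    using qfunctor_closed[OF f] qfunctor_closed[OF g]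
    by (auto simp: is_qfunctor_def compose_def)
qed

section \<open>The category of presheaves\<close>

lemma point_qcat: "q \<in> ob Q \<Longrightarrow> is_qcat Q (point Q q)"
  by (auto simp: is_qcat_def comp_ident_left ident_closed intro: le_refl ident_closed)

lemma PSh_point: "m \<in> carrier (PSh Q X) \<Longrightarrow> is_qcat Q (point Q (fst m))"
  by (simp add: PSh_carrier_iff point_qcat)

lemma PSh_dist: "m \<in> carrier (PSh Q X) \<Longrightarrow> is_dist Q X (point Q (fst m)) (snd m)"
  by (simp add: PSh_carrier_iff)

lemma PSh_ob: "m \<in> carrier (PSh Q X) \<Longrightarrow> fst m \<in> ob Q"
  by (simp add: PSh_carrier_iff)

lemma PSh_value:
  "\<lbrakk>m \<in> carrier (PSh Q X); x \<in> carrier X\<rbrakk> \<Longrightarrow> snd m (x, ()) \<in> Hom (ty X x) (fst m)"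
  using is_dist_closed[OF PSh_dist[of m X], of x "()"] by simp

lemma PSh_carr_closed:
  assumes "is_qcat Q X" "m \<in> carrier (PSh Q X)" "n \<in> carrier (PSh Q X)"
  shows "carr (PSh Q X) (m, n) \<in> Hom (fst m) (fst n)"
  using dist_lres_closed[OF assms(1) PSh_point PSh_point PSh_dist PSh_dist] assms
  by (simp add: PSh_carr)

lemma le_PSh_carr_iff:
  assumes "is_qcat Q X" "m \<in> carrier (PSh Q X)" "n \<in> carrier (PSh Q X)" "t \<in> Hom (fst m) (fst n)"
  shows "t \<preceq>[fst m, fst n] carr (PSh Q X) (m, n) \<longleftrightarrow>
    (\<forall>x\<in>carrier X. comp Q (ty X x) (fst m) (fst n) t (snd m (x, ())) \<preceq>[ty X x, fst n] snd n (x, ()))"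
  using le_dist_lres_iff[OF assms(1) PSh_point PSh_point PSh_dist PSh_dist] assms
  by (simp add: PSh_carr)

lemma PSh_carr_counit:
  assumes "is_qcat Q X" "m \<in> carrier (PSh Q X)" "n \<in> carrier (PSh Q X)" "x \<in> carrier X"
  shows "comp Q (ty X x) (fst m) (fst n) (carr (PSh Q X) (m, n)) (snd m (x, ())) \<preceq>[ty X x, fst n] snd n (x, ())"
  using le_PSh_carr_iff[OF assms(1-3) PSh_carr_closed[OF assms(1-3)]] assms
  by (auto intro!: le_refl PSh_carr_closed PSh_ob)

lemma PSh_qcat:
  assumes X: "is_qcat Q X"
  shows "is_qcat Q (PSh Q X)"
proof -
  note [simp] = X PSh_ty PSh_ob[of _ X] PSh_carr_closed[OF X] PSh_value qcat_simps
  have ext: "ty (PSh Q X) \<in> extensional (carrier (PSh Q X))"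
    "carr (PSh Q X) \<in> extensional (carrier (PSh Q X) \<times> carrier (PSh Q X))"
    by (auto simp: PSh_def)
  have refl: "ident Q (fst m) \<preceq>[fst m, fst m] carr (PSh Q X) (m, m)" if "m \<in> carrier (PSh Q X)" for m
    using that by (subst le_PSh_carr_iff) (auto intro: le_refl)
  have trans: "comp Q (fst m) (fst n) (fst k) (carr (PSh Q X) (n, k)) (carr (PSh Q X) (m, n))
      \<preceq>[fst m, fst k] carr (PSh Q X) (m, k)"
    if [simp]: "m \<in> carrier (PSh Q X)" "n \<in> carrier (PSh Q X)" "k \<in> carrier (PSh Q X)" for m n k
  proof (subst le_PSh_carr_iff, simp_all, intro ballI)
    fix x assume [simp]: "x \<in> carrier X"
    have "comp Q (ty X x) (fst m) (fst k)
        (comp Q (fst m) (fst n) (fst k) (carr (PSh Q X) (n, k)) (carr (PSh Q X) (m, n))) (snd m (x, ())) =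
      comp Q (ty X x) (fst n) (fst k) (carr (PSh Q X) (n, k))
        (comp Q (ty X x) (fst m) (fst n) (carr (PSh Q X) (m, n)) (snd m (x, ())))"
      by (simp add: comp_assoc)
    also have "\<dots> \<preceq>[ty X x, fst k] snd k (x, ())"
      by (rule le_trans[OF comp_mono_right[OF _ _ _ _ _ _ PSh_carr_counit] PSh_carr_counit]) auto
    finally show "comp Q (ty X x) (fst m) (fst k)
        (comp Q (fst m) (fst n) (fst k) (carr (PSh Q X) (n, k)) (carr (PSh Q X) (m, n))) (snd m (x, ()))
      \<preceq>[ty X x, fst k] snd k (x, ())" .
  qed
  \<comment> \<open>The pair is kept whole here and \<open>split_paired_All\<close> is switched off
    below: presheaves are pairs themselves, and splitting them would destroy the terms
    \<open>fst m\<close> on which the facts above rely.\<close>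
  have "carr (PSh Q X) z \<in> (\<lambda>(m, n). Hom (ty (PSh Q X) m) (ty (PSh Q X) n)) z"
    if "z \<in> carrier (PSh Q X) \<times> carrier (PSh Q X)" for z
    using that by (rule SigmaE) simp
  then show ?thesis
    using ext refl trans unfolding is_qcat_def by (simp add: PiE_iff del: split_paired_All)

qed

text \<open>This is \<open>le_PSh_carr_iff\<close> at the identity arrow. The types have to agree
  before the identity can be tested against a hom from \<open>m\<close> to \<open>n\<close>, hence
  the case distinction.\<close>

lemma PSh_le_iff:
  assumes "is_qcat Q X" "m \<in> carrier (PSh Q X)" "n \<in> carrier (PSh Q X)"
  shows "qcat_le Q (PSh Q X) m n \<longleftrightarrow> fst m = fst n \<and> dist_le Q X (point Q (fst m)) (snd m) (snd n)"
proof (cases "fst m = fst n")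
  case True
  have "snd m (x, ()) \<in> Hom (ty X x) (fst n)" if "x \<in> carrier X" for x
    using PSh_value[OF assms(2) that] True by simp
  with True show ?thesis
    using le_PSh_carr_iff[OF assms, of "ident Q (fst m)"] assms PSh_ob[OF assms(2)]
    by (auto simp: qcat_le_def dist_le_def PSh_ty PSh_value qcat_simps comp_ident_left)
qed (use assms in \<open>simp add: qcat_le_def PSh_ty\<close>)

text \<open>Presheaf categories are separated, so mutual comparison already gives equality of
  presheaves. This is what turns order arguments into the strict equation aa = a and into the
  fixed-point condition for open presheaves.\<close>

lemma PSh_le_antisym:
  assumes "is_qcat Q X" "m \<in> carrier (PSh Q X)" "n \<in> carrier (PSh Q X)"
    and "qcat_le Q (PSh Q X) m n" "qcat_le Q (PSh Q X) n m"
  shows "m = n"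
  using assms PSh_dist[OF assms(2)] PSh_dist[OF assms(3)] PSh_point[OF assms(2)]
  by (auto simp: PSh_le_iff intro!: prod_eqI dist_le_antisym[of X "point Q (fst m)"])

section \<open>Kan adjunctions\<close>

lemma kan_upper_closed:
  assumes "is_qcat Q X" "is_qcat Q Y" "is_dist Q X Y \<phi>" "n \<in> carrier (PSh Q Y)"
  shows "kan_upper Q X Y \<phi> n \<in> carrier (PSh Q X)"
  using assms PSh_ob[OF assms(4)]
  by (subst PSh_carrier_iff) (auto simp: kan_upper_apply intro!: dist_comp_dist PSh_point PSh_dist)

lemma kan_lower_closed:
  assumes "is_qcat Q X" "is_qcat Q Y" "is_dist Q X Y \<phi>" "m \<in> carrier (PSh Q X)"
  shows "kan_lower Q X Y \<phi> m \<in> carrier (PSh Q Y)"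
  using assms PSh_ob[OF assms(4)]
  by (subst PSh_carrier_iff) (auto simp: kan_lower_apply intro!: dist_lres_dist PSh_point PSh_dist)

text \<open>With u the hom from m to n, associativity turns u \<circ> (m \<circ> \<phi>) into (u
  \<circ> m) \<circ> \<phi>, and the counit gives u \<circ> m \<le> n.\<close>

lemma kan_upper_functor:
  assumes X: "is_qcat Q X" and Y: "is_qcat Q Y" and \<phi>: "is_dist Q X Y \<phi>"
  shows "is_qfunctor Q (PSh Q Y) (PSh Q X) (kan_upper Q X Y \<phi>)"
proof -
  note [simp] = assms PSh_ty PSh_ob[of _ X] PSh_ob[of _ Y] PSh_carr_closed PSh_value qcat_simps kan_upper_closed[OF assms] kan_upper_fst
    \<phi>[THEN is_dist_closed] PSh_point[of _ X] PSh_point[of _ Y] PSh_dist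
  have "carr (PSh Q Y) (m, n) \<preceq>[fst m, fst n]
      carr (PSh Q X) (kan_upper Q X Y \<phi> m, kan_upper Q X Y \<phi> n)"
    if [simp]: "m \<in> carrier (PSh Q Y)" "n \<in> carrier (PSh Q Y)" for m n
  proof -
    let ?u = "carr (PSh Q Y) (m, n)"
    have "comp Q (ty X x) (fst m) (fst n) ?u (snd (kan_upper Q X Y \<phi> m) (x, ()))
        \<preceq>[ty X x, fst n] snd (kan_upper Q X Y \<phi> n) (x, ())" if [simp]: "x \<in> carrier X" for x
    proof -
      have cl: "snd (kan_upper Q X Y \<phi> n) (x, ()) \<in> Hom (ty X x) (fst n)"
        using PSh_value[of "kan_upper Q X Y \<phi> n" X x] by simp
      have "comp Q (ty X x) (ty Y y) (fst n) (comp Q (ty Y y) (fst m) (fst n) ?u (snd m (y, ()))) (\<phi> (x, y))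
          \<preceq>[ty X x, fst n] snd (kan_upper Q X Y \<phi> n) (x, ())" if [simp]: "y \<in> carrier Y" for y
        using dist_comp_upper[OF X Y PSh_point[of n Y] \<phi> PSh_dist, of x y "()"] cl
        by (intro le_trans[OF comp_mono_left[OF _ _ _ _ _ _ PSh_carr_counit]]) (auto simp: kan_upper_apply)
      then show ?thesis
        using comp_dist_comp_le_iff[OF X Y PSh_point[of m Y] \<phi> PSh_dist, of x "()" "fst n" ?u] cl
        by (simp add: kan_upper_apply)
    qed
    then show ?thesis
      using le_PSh_carr_iff[OF X, of "kan_upper Q X Y \<phi> m" "kan_upper Q X Y \<phi> n" ?u] by simp
  qed
  then show ?thesis
    by (simp add: is_qfunctor_def PiE_def Pi_def) (simp add: kan_upper_def)
qed

text \<open>The claim is transposed twice, first across the hom of \<open>PSh Q Y\<close> and then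
  across the residual by \<phi>. What remains is the counit for \<phi> followed by the counit of the
  hom from m to n.\<close>

lemma kan_lower_functor:
  assumes X: "is_qcat Q X" and Y: "is_qcat Q Y" and \<phi>: "is_dist Q X Y \<phi>"
  shows "is_qfunctor Q (PSh Q X) (PSh Q Y) (kan_lower Q X Y \<phi>)"
proof -
  note [simp] = assms PSh_ty PSh_ob[of _ X] PSh_ob[of _ Y] PSh_carr_closed PSh_value qcat_simps kan_lower_closed[OF assms] kan_lower_fst
    \<phi>[THEN is_dist_closed] PSh_point[of _ X] PSh_point[of _ Y] PSh_dist
  have "carr (PSh Q X) (m, n) \<preceq>[fst m, fst n]
      carr (PSh Q Y) (kan_lower Q X Y \<phi> m, kan_lower Q X Y \<phi> n)"
    if [simp]: "m \<in> carrier (PSh Q X)" "n \<in> carrier (PSh Q X)" for m n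
  proof -
    let ?u = "carr (PSh Q X) (m, n)"
    let ?m = "kan_lower Q X Y \<phi> m" and ?n = "kan_lower Q X Y \<phi> n"
    have val[simp]: "snd ?m (y, ()) \<in> Hom (ty Y y) (fst m)" if "y \<in> carrier Y" for y
      using PSh_value[of ?m Y y] that by simp
    have "comp Q (ty Y y) (fst m) (fst n) ?u (snd ?m (y, ())) \<preceq>[ty Y y, fst n] snd ?n (y, ())"
      if [simp]: "y \<in> carrier Y" for y
    proof -
      have "comp Q (ty X x) (ty Y y) (fst n) (comp Q (ty Y y) (fst m) (fst n) ?u (snd ?m (y, ()))) (\<phi> (x, y))
          \<preceq>[ty X x, fst n] snd n (x, ())" if [simp]: "x \<in> carrier X" for x
      proof -
        have "comp Q (ty X x) (ty Y y) (fst m) (snd ?m (y, ())) (\<phi> (x, y)) \<preceq>[ty X x, fst m] snd m (x, ())"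
          using dist_lres_counit[OF X Y PSh_point[of m X] \<phi> PSh_dist, of y "()" x] by (simp add: kan_lower_apply)
        then show ?thesis
          by (subst comp_assoc) (auto intro!: le_trans[OF comp_mono_right PSh_carr_counit])
      qed
      then show ?thesis
        using le_dist_lres_iff[OF X Y PSh_point[of n X] \<phi> PSh_dist, of y "()"
            "comp Q (ty Y y) (fst m) (fst n) ?u (snd ?m (y, ()))"]
        by (simp add: kan_lower_apply[of n])
    qed
    then show ?thesis
      using le_PSh_carr_iff[OF Y, of ?m ?n ?u] by simp
  qed
  then show ?thesis
    by (simp add: is_qfunctor_def PiE_def Pi_def) (simp add: kan_lower_def)
qed

text \<open>For equal types both sides unfold to the same inequalities n(y) \<circ> \<phi>(x, y)
  \<le> m(x), with the quantifiers over x and y interchanged. For different types both sides fail,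
  since Kan extension keeps the type.\<close>

lemma kan_adjunction:
  assumes X: "is_qcat Q X" and Y: "is_qcat Q Y" and \<phi>: "is_dist Q X Y \<phi>"
    and m: "m \<in> carrier (PSh Q X)" and n: "n \<in> carrier (PSh Q Y)"
  shows "qcat_le Q (PSh Q X) (kan_upper Q X Y \<phi> n) m \<longleftrightarrow> qcat_le Q (PSh Q Y) n (kan_lower Q X Y \<phi> m)"
proof (cases "fst n = fst m")
  case True
  have d: "is_dist Q Y (point Q (fst m)) (snd n)"
    using PSh_dist[OF n] True by simp
  note [simp] = kan_upper_closed[OF X Y \<phi> n] kan_lower_closed[OF X Y \<phi> m] X Y m n \<phi> PSh_point[OF m] PSh_dist[OF m] d
  show ?thesis
    using le_dist_lres_iff[OF X Y PSh_point[OF m] \<phi> PSh_dist[OF m], of _ "()"] is_dist_closed[OF d]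
    by (simp add: PSh_le_iff, simp add: kan_upper_apply kan_lower_apply True dist_comp_le_iff)
      (auto simp: dist_le_def)
qed (use assms in \<open>simp add: PSh_le_iff kan_upper_closed kan_lower_closed kan_upper_fst kan_lower_fst\<close>)

lemma kan_upper_ident:
  assumes "is_qcat Q X" "n \<in> carrier (PSh Q X)"
  shows "kan_upper Q X X (carr X) n = n"
  using assms by (simp add: kan_upper_apply dist_comp_ident_right PSh_point PSh_dist)

lemma kan_upper_comp:
  assumes "is_qcat Q X" "is_qcat Q Y" "is_qcat Q Z" "is_dist Q X Y \<phi>" "is_dist Q Y Z \<psi>"
    and "n \<in> carrier (PSh Q Z)"
  shows "kan_upper Q X Z (dist_comp Q X Y Z \<psi> \<phi>) n = kan_upper Q X Y \<phi> (kan_upper Q Y Z \<psi> n)"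
  using assms kan_upper_closed[OF assms(2,3,5,6)]
  by (simp add: kan_upper_apply dist_comp_assoc PSh_point PSh_dist)

lemma kan_upper_dist_mono:
  assumes "is_qcat Q X" "is_qcat Q Y" "is_dist Q X Y \<phi>" "is_dist Q X Y \<phi>'" "dist_le Q X Y \<phi> \<phi>'"
    and "n \<in> carrier (PSh Q Y)"
  shows "qcat_le Q (PSh Q X) (kan_upper Q X Y \<phi> n) (kan_upper Q X Y \<phi>' n)"
  using assms
  by (simp add: PSh_le_iff kan_upper_closed)
    (simp add: kan_upper_apply dist_comp_mono dist_le_refl PSh_point PSh_dist)

text \<open>\<open>kan_upper\<close> preserves joins of distributors, expressed through upper
  bounds. The assumption \<open>mn\<close> matters for empty \<Phi>: the right side is then vacuous,
  while the left side still asserts equality of types.\<close>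

lemma kan_upper_Sup_le_iff:
  assumes X: "is_qcat Q X" and Y: "is_qcat Q Y" and \<Phi>: "\<And>\<phi>. \<phi> \<in> \<Phi> \<Longrightarrow> is_dist Q X Y \<phi>"
    and n: "n \<in> carrier (PSh Q Y)" and m: "m \<in> carrier (PSh Q X)" and mn: "fst m = fst n"
  shows "qcat_le Q (PSh Q X) (kan_upper Q X Y (dist_Sup Q X Y \<Phi>) n) m \<longleftrightarrow>
    (\<forall>\<phi>\<in>\<Phi>. qcat_le Q (PSh Q X) (kan_upper Q X Y \<phi> n) m)"
proof -
  let ?P = "point Q (fst n)"
  note [simp] = X Y \<Phi> n m PSh_point[OF n] PSh_dist[OF n]
  have d: "is_dist Q X ?P (snd m)"
    using PSh_dist[OF m] mn by simp
  have e: "is_dist Q X ?P \<psi>" if "\<psi> \<in> dist_comp Q X Y ?P (snd n) ` \<Phi>" for \<psi>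
    using that by (auto intro!: dist_comp_dist)
  have s: "is_dist Q X Y (dist_Sup Q X Y \<Phi>)"
    by (rule dist_Sup_dist) auto
  have "qcat_le Q (PSh Q X) (kan_upper Q X Y (dist_Sup Q X Y \<Phi>) n) m \<longleftrightarrow>
      dist_le Q X ?P (dist_Sup Q X ?P (dist_comp Q X Y ?P (snd n) ` \<Phi>)) (snd m)"
    using dist_comp_Sup_right[OF X Y PSh_point[OF n] \<Phi> PSh_dist[OF n]]
    by (simp add: PSh_le_iff kan_upper_closed[OF X Y s] mn) (simp add: kan_upper_apply)
  also have "\<dots> \<longleftrightarrow> (\<forall>\<phi>\<in>\<Phi>. dist_le Q X ?P (dist_comp Q X Y ?P (snd n) \<phi>) (snd m))"
    by (subst dist_Sup_le_iff[OF X PSh_point[OF n] e d]) auto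
  also have "\<dots> \<longleftrightarrow> (\<forall>\<phi>\<in>\<Phi>. qcat_le Q (PSh Q X) (kan_upper Q X Y \<phi> n) m)"
    by (intro ball_cong refl)
      (simp add: PSh_le_iff kan_upper_closed[OF X Y] mn, simp add: kan_upper_apply)
  finally show ?thesis .
qed


section \<open>Interior spaces\<close>

lemma int_space_iff:
  "is_int_space Q (X, a) \<longleftrightarrow> is_qcat Q X \<and> is_qfunctor Q (PSh Q X) (PSh Q X) a \<and>
    (\<forall>m\<in>carrier (PSh Q X). qcat_le Q (PSh Q X) (a m) m \<and> a (a m) = a m)"
proof -
  have "compose (carrier (PSh Q X)) a a = a \<longleftrightarrow> (\<forall>m\<in>carrier (PSh Q X). a (a m) = a m)"
    if "a \<in> extensional (carrier (PSh Q X))"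
    using that by (auto simp: compose_def fun_eq_iff extensional_def)
  then show ?thesis
    by (auto simp: is_int_space_def qfunctor_le_def is_qfunctor_def PiE_def)
qed

lemma continuous_iff:
  "is_continuous Q (X, a) (Y, b) \<zeta> \<longleftrightarrow> is_dist Q X Y \<zeta> \<and>
    (\<forall>n\<in>carrier (PSh Q Y). qcat_le Q (PSh Q X) (kan_upper Q X Y \<zeta> (b n)) (a (kan_upper Q X Y \<zeta> n)))"
  by (auto simp: is_continuous_def qfunctor_le_def compose_def)

text \<open>As for any adjunction between ordered sets, the composite on the side of the counit is
  deflationary and idempotent.\<close>

lemma kan_int_space:
  assumes X: "is_qcat Q X" and Y: "is_qcat Q Y" and \<phi>: "is_dist Q X Y \<phi>"
  shows "is_int_space Q (X, compose (carrier (PSh Q X)) (kan_upper Q X Y \<phi>) (kan_lower Q X Y \<phi>))"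
proof -
  let ?U = "kan_upper Q X Y \<phi>" and ?L = "kan_lower Q X Y \<phi>"
  note [simp] = kan_upper_closed[OF assms] kan_lower_closed[OF assms] PSh_qcat X Y
  have counit: "qcat_le Q (PSh Q X) (?U (?L m)) m" if "m \<in> carrier (PSh Q X)" for m
    using kan_adjunction[OF assms that, of "?L m"] that by (simp add: qcat_le_refl)
  have unit: "qcat_le Q (PSh Q Y) n (?L (?U n))" if "n \<in> carrier (PSh Q Y)" for n
    using kan_adjunction[OF assms, of "?U n" n] that by (simp add: qcat_le_refl)
  \<comment> \<open>One inequality is the counit at \<open>?U (?L m)\<close>, the other is
    \<open>?U\<close> applied to the unit at \<open>?L m\<close>.\<close>
  have "?U (?L (?U (?L m))) = ?U (?L m)" if [simp]: "m \<in> carrier (PSh Q X)" for m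
    using counit[of "?U (?L m)"] unit[of "?L m"]
    by (intro PSh_le_antisym[OF X]) (auto intro!: qfunctor_mono[OF _ _ kan_upper_functor[OF assms]])
  then show ?thesis
    using qfunctor_compose[OF _ _ _ kan_lower_functor[OF assms] kan_upper_functor[OF assms]]
    by (auto simp: int_space_iff compose_def counit)
qed

lemma kan_counit:
  assumes "is_qcat Q X" "is_qcat Q Y" "is_dist Q X Y \<phi>" "m \<in> carrier (PSh Q X)"
  shows "qcat_le Q (PSh Q X) (kan_upper Q X Y \<phi> (kan_lower Q X Y \<phi> m)) m"
  using kan_adjunction[OF assms kan_lower_closed[OF assms]] kan_lower_closed[OF assms] assms
  by (simp add: qcat_le_refl PSh_qcat)

lemma kan_upper_mono:
  assumes "is_qcat Q X" "is_qcat Q Y" "is_dist Q X Y \<phi>"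
    and "n \<in> carrier (PSh Q Y)" "n' \<in> carrier (PSh Q Y)" "qcat_le Q (PSh Q Y) n n'"
  shows "qcat_le Q (PSh Q X) (kan_upper Q X Y \<phi> n) (kan_upper Q X Y \<phi> n')"
  using assms by (intro qfunctor_mono[OF PSh_qcat PSh_qcat kan_upper_functor])

lemma PSh_le_trans:
  assumes "qcat_le Q (PSh Q X) m n" "qcat_le Q (PSh Q X) n k" "is_qcat Q X"
    and "m \<in> carrier (PSh Q X)" "n \<in> carrier (PSh Q X)" "k \<in> carrier (PSh Q X)"
  shows "qcat_le Q (PSh Q X) m k"
  using assms by (intro qcat_le_trans[OF PSh_qcat, of X m n k])

lemma int_space_qcat: "is_int_space Q (X, a) \<Longrightarrow> is_qcat Q X"
  by (simp add: int_space_iff)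

lemma int_space_functor: "is_int_space Q (X, a) \<Longrightarrow> is_qfunctor Q (PSh Q X) (PSh Q X) a"
  by (simp add: int_space_iff)

lemma int_space_closed: "\<lbrakk>is_int_space Q (X, a); m \<in> carrier (PSh Q X)\<rbrakk> \<Longrightarrow> a m \<in> carrier (PSh Q X)"
  by (auto dest: int_space_functor qfunctor_closed)

lemma int_space_le: "\<lbrakk>is_int_space Q (X, a); m \<in> carrier (PSh Q X)\<rbrakk> \<Longrightarrow> qcat_le Q (PSh Q X) (a m) m"
  by (simp add: int_space_iff)

lemma int_space_idem: "\<lbrakk>is_int_space Q (X, a); m \<in> carrier (PSh Q X)\<rbrakk> \<Longrightarrow> a (a m) = a m"
  by (simp add: int_space_iff)

lemma int_space_fst:
  assumes "is_int_space Q (X, a)" "m \<in> carrier (PSh Q X)"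
  shows "fst (a m) = fst m"
  using int_space_le[OF assms] int_space_closed[OF assms] int_space_qcat[OF assms(1)] assms(2)
  by (simp add: PSh_le_iff)

lemma int_space_mono:
  assumes "is_int_space Q (X, a)" "m \<in> carrier (PSh Q X)" "n \<in> carrier (PSh Q X)"
    and "qcat_le Q (PSh Q X) m n"
  shows "qcat_le Q (PSh Q X) (a m) (a n)"
  using int_space_qcat[OF assms(1)] assms(2-)
  by (intro qfunctor_mono[OF PSh_qcat PSh_qcat int_space_functor[OF assms(1)]])

lemma continuous_dist: "is_continuous Q (X, a) (Y, b) \<zeta> \<Longrightarrow> is_dist Q X Y \<zeta>"
  by (simp add: continuous_iff)

lemma continuous_le:
  "\<lbrakk>is_continuous Q (X, a) (Y, b) \<zeta>; n \<in> carrier (PSh Q Y)\<rbrakk> \<Longrightarrow>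
    qcat_le Q (PSh Q X) (kan_upper Q X Y \<zeta> (b n)) (a (kan_upper Q X Y \<zeta> n))"
  by (simp add: continuous_iff)

section \<open>Closure properties of continuous distributors\<close>

lemma continuous_ident:
  assumes A: "is_int_space Q (X, a)"
  shows "is_continuous Q (X, a) (X, a) (carr X)"
proof -
  note [simp] = int_space_qcat[OF A] int_space_closed[OF A]
  show ?thesis
    by (simp add: continuous_iff carr_dist kan_upper_ident qcat_le_refl PSh_qcat)
qed

lemma continuous_comp:
  assumes A: "is_int_space Q (X, a)" and B: "is_int_space Q (Y, b)" and C: "is_int_space Q (Z, c)"
    and \<zeta>: "is_continuous Q (X, a) (Y, b) \<zeta>" and \<xi>: "is_continuous Q (Y, b) (Z, c) \<xi>"
  shows "is_continuous Q (X, a) (Z, c) (dist_comp Q X Y Z \<xi> \<zeta>)"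
proof -
  note cat[simp] = int_space_qcat[OF A] int_space_qcat[OF B] int_space_qcat[OF C]
  note [simp] = continuous_dist[OF \<zeta>] continuous_dist[OF \<xi>]
    int_space_closed[OF A] int_space_closed[OF B] int_space_closed[OF C] kan_upper_closed
  have "qcat_le Q (PSh Q X) (kan_upper Q X Y \<zeta> (kan_upper Q Y Z \<xi> (c n)))
      (a (kan_upper Q X Y \<zeta> (kan_upper Q Y Z \<xi> n)))" if [simp]: "n \<in> carrier (PSh Q Z)" for n
    by (rule PSh_le_trans[OF kan_upper_mono[OF _ _ _ _ _ continuous_le[OF \<xi>]] continuous_le[OF \<zeta>]]) simp_all
  then show ?thesis
    by (simp add: continuous_iff dist_comp_dist kan_upper_comp[of X Y Z])
qed

text \<open>For each \<phi>, continuity followed by monotonicity of \<open>a\<close> bounds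
  \<open>\<phi>\<^sup>* b\<close> by \<open>a\<close> applied to the extension along the join. This
  bound no longer depends on \<phi>, so it also bounds the join.\<close>

lemma continuous_Sup:
  assumes A: "is_int_space Q (X, a)" and B: "is_int_space Q (Y, b)"
    and \<Phi>: "\<And>\<phi>. \<phi> \<in> \<Phi> \<Longrightarrow> is_continuous Q (X, a) (Y, b) \<phi>"
  shows "is_continuous Q (X, a) (Y, b) (dist_Sup Q X Y \<Phi>)"
proof -
  note cat[simp] = int_space_qcat[OF A] int_space_qcat[OF B]
  note d[simp] = continuous_dist[OF \<Phi>]
  note [simp] = int_space_closed[OF A] int_space_closed[OF B] kan_upper_closed
    kan_upper_fst int_space_fst[OF A] int_space_fst[OF B]
  have S[simp]: "is_dist Q X Y (dist_Sup Q X Y \<Phi>)"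
    by (rule dist_Sup_dist) auto
  have "qcat_le Q (PSh Q X) (kan_upper Q X Y (dist_Sup Q X Y \<Phi>) (b n))
      (a (kan_upper Q X Y (dist_Sup Q X Y \<Phi>) n))" if [simp]: "n \<in> carrier (PSh Q Y)" for n
  proof (subst kan_upper_Sup_le_iff)
    show "\<forall>\<phi>\<in>\<Phi>. qcat_le Q (PSh Q X) (kan_upper Q X Y \<phi> (b n)) (a (kan_upper Q X Y (dist_Sup Q X Y \<Phi>) n))"
    proof
      fix \<phi> assume [simp]: "\<phi> \<in> \<Phi>"
      have "dist_le Q X Y \<phi> (dist_Sup Q X Y \<Phi>)"
        by (rule dist_Sup_upper) auto
      then have "qcat_le Q (PSh Q X) (a (kan_upper Q X Y \<phi> n)) (a (kan_upper Q X Y (dist_Sup Q X Y \<Phi>) n))"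
        by (intro int_space_mono[OF A] kan_upper_dist_mono) simp_all
      then show "qcat_le Q (PSh Q X) (kan_upper Q X Y \<phi> (b n)) (a (kan_upper Q X Y (dist_Sup Q X Y \<Phi>) n))"
        by (rule PSh_le_trans[OF continuous_le[OF \<Phi>], rotated 2]) simp_all
    qed
  qed simp_all
  then show ?thesis
    by (simp add: continuous_iff)
qed

lemma kan_continuous:
  assumes cat: "is_qcat Q X" "is_qcat Q Y" "is_qcat Q X'" "is_qcat Q Y'"
    and dist: "is_dist Q X Y \<phi>" "is_dist Q X' Y' \<psi>" "is_dist Q X X' \<zeta>" "is_dist Q Y Y' \<eta>"
    and sq: "dist_comp Q X X' Y' \<psi> \<zeta> = dist_comp Q X Y Y' \<eta> \<phi>"
  shows "is_continuous Q (X, compose (carrier (PSh Q X)) (kan_upper Q X Y \<phi>) (kan_lower Q X Y \<phi>))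
    (X', compose (carrier (PSh Q X')) (kan_upper Q X' Y' \<psi>) (kan_lower Q X' Y' \<psi>)) \<zeta>"
proof -
  note [simp] = cat dist kan_upper_closed kan_lower_closed compose_eq
  have "qcat_le Q (PSh Q X) (kan_upper Q X X' \<zeta> (kan_upper Q X' Y' \<psi> (kan_lower Q X' Y' \<psi> n)))
      (kan_upper Q X Y \<phi> (kan_lower Q X Y \<phi> (kan_upper Q X X' \<zeta> n)))"
    if [simp]: "n \<in> carrier (PSh Q X')" for n
  proof -
    \<comment> \<open>Forming \<open>\<phi>\<^sup>*\<close> reverses composition, so the commuting
      square becomes a commuting square of Kan extensions.\<close>
    have eq: "kan_upper Q X X' \<zeta> (kan_upper Q X' Y' \<psi> (kan_lower Q X' Y' \<psi> n)) =
        kan_upper Q X Y \<phi> (kan_upper Q Y Y' \<eta> (kan_lower Q X' Y' \<psi> n))"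
      using kan_upper_comp[of X X' Y' \<zeta> \<psi>] kan_upper_comp[of X Y Y' \<phi> \<eta>] by (simp add: sq)
    have "qcat_le Q (PSh Q X) (kan_upper Q X X' \<zeta> (kan_upper Q X' Y' \<psi> (kan_lower Q X' Y' \<psi> n)))
        (kan_upper Q X X' \<zeta> n)"
      by (intro kan_upper_mono kan_counit) simp_all
    then have "qcat_le Q (PSh Q Y) (kan_upper Q Y Y' \<eta> (kan_lower Q X' Y' \<psi> n))
        (kan_lower Q X Y \<phi> (kan_upper Q X X' \<zeta> n))"
      unfolding eq by (subst (asm) kan_adjunction) simp_all
    then show ?thesis
      unfolding eq by (intro kan_upper_mono) simp_all
  qed
  then show ?thesis
    by (simp add: continuous_iff)
qed


section \<open>The quantaloid of interior spaces\<close>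

lemma IntDist_simps [simp]:
  "ob (IntDist Q) = Collect (is_int_space Q)"
  "carrier (hom (IntDist Q) A B) = Collect (is_continuous Q A B)"
  "le (hom (IntDist Q) A B) = dist_le Q (fst A) (fst B)"
  "eq (hom (IntDist Q) A B) = (=)"
  "comp (IntDist Q) A B C = dist_comp Q (fst A) (fst B) (fst C)"
  "ident (IntDist Q) A = carr (fst A)"
  by (simp_all add: IntDist_def)

lemma IntDist_joins:
  assumes "is_int_space Q A" "is_int_space Q B"
  shows IntDist_lattice: "complete_lattice (hom (IntDist Q) A B)"
    and IntDist_Sup: "\<Phi> \<subseteq> Collect (is_continuous Q A B) \<Longrightarrow>
      \<Squnion>\<^bsub>hom (IntDist Q) A B\<^esub> \<Phi> = dist_Sup Q (fst A) (fst B) \<Phi>"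
proof -
  obtain X a Y b where AB[simp]: "A = (X, a)" "B = (Y, b)"
    by (cases A, cases B)
  have spaces: "is_int_space Q (X, a)" "is_int_space Q (Y, b)"
    using assms by auto
  note cat = spaces[THEN int_space_qcat]
  have *: "complete_lattice (hom (IntDist Q) A B) \<and> (\<Phi> \<subseteq> Collect (is_continuous Q A B) \<longrightarrow>
      \<Squnion>\<^bsub>hom (IntDist Q) A B\<^esub> \<Phi> = dist_Sup Q (fst A) (fst B) \<Phi>)" for \<Phi>
  proof (intro conjI impI)
    let ?L = "hom (IntDist Q) A B" and ?S = "dist_Sup Q (fst A) (fst B)"
    have 1: "x \<sqsubseteq>\<^bsub>?L\<^esub> x" if "x \<in> carrier ?L" for x
      using that cat by (auto intro: dist_le_refl continuous_dist)
    have 2: "x = y" if "x \<in> carrier ?L" "y \<in> carrier ?L" "x \<sqsubseteq>\<^bsub>?L\<^esub> y" "y \<sqsubseteq>\<^bsub>?L\<^esub> x" for x y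
      using that by (auto intro!: dist_le_antisym[OF cat] dest: continuous_dist)
    have 3: "x \<sqsubseteq>\<^bsub>?L\<^esub> z"
      if "x \<in> carrier ?L" "y \<in> carrier ?L" "z \<in> carrier ?L" "x \<sqsubseteq>\<^bsub>?L\<^esub> y" "y \<sqsubseteq>\<^bsub>?L\<^esub> z" for x y z
      using that dist_le_trans[OF cat, of x y z] by (auto dest: continuous_dist)
    have 4: "?S U \<in> carrier ?L" if "U \<subseteq> carrier ?L" for U
      using that by (auto intro!: continuous_Sup[OF spaces])
    have 5: "x \<sqsubseteq>\<^bsub>?L\<^esub> ?S U" if "U \<subseteq> carrier ?L" "x \<in> U" for U x
      using that by (auto intro!: dist_Sup_upper[OF cat] dest: continuous_dist)
    have 6: "?S U \<sqsubseteq>\<^bsub>?L\<^esub> z" if "U \<subseteq> carrier ?L" "z \<in> carrier ?L" "\<And>x. x \<in> U \<Longrightarrow> x \<sqsubseteq>\<^bsub>?L\<^esub> z" for U z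
      using that dist_Sup_le_iff[OF cat, of U z] by (auto dest!: continuous_dist)
    show "complete_lattice ?L"
      by (rule complete_lattice_of_joins_lattice[of ?L ?S, OF _ 1 2 3 4 5 6]) simp_all
    show "\<Squnion>\<^bsub>?L\<^esub> \<Phi> = ?S \<Phi>" if "\<Phi> \<subseteq> Collect (is_continuous Q A B)"
      by (rule complete_lattice_of_joins_sup[of ?L ?S, OF _ 1 2 3 4 5 6]) (use that in simp_all)
  qed
  show "complete_lattice (hom (IntDist Q) A B)"
    using * by blast
  show "\<Phi> \<subseteq> Collect (is_continuous Q A B) \<Longrightarrow>
      \<Squnion>\<^bsub>hom (IntDist Q) A B\<^esub> \<Phi> = dist_Sup Q (fst A) (fst B) \<Phi>"
    using * by blast
qed

lemma IntDist_quantaloid: "quantaloid (IntDist Q :: (('x, 'o, 'm) int_space, 'x \<times> 'x \<Rightarrow> 'm) quantaloid)"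
proof (rule quantaloid.intro)
  fix A B :: "('x, 'o, 'm) int_space"
  assume "A \<in> ob (IntDist Q)" "B \<in> ob (IntDist Q)"
  then show "complete_lattice (hom (IntDist Q) A B)"
    by (simp add: IntDist_lattice)
next
  fix A :: "('x, 'o, 'm) int_space"
  assume "A \<in> ob (IntDist Q)"
  then show "ident (IntDist Q) A \<in> carrier (hom (IntDist Q) A A)"
    by (cases A) (simp add: continuous_ident)
next
  fix A B C :: "('x, 'o, 'm) int_space" and u v
  assume "A \<in> ob (IntDist Q)" "B \<in> ob (IntDist Q)" "C \<in> ob (IntDist Q)"
    "u \<in> carrier (hom (IntDist Q) A B)" "v \<in> carrier (hom (IntDist Q) B C)"
  then show "comp (IntDist Q) A B C v u \<in> carrier (hom (IntDist Q) A C)"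
    by (cases A; cases B; cases C) (simp add: continuous_comp)
next
  fix A B C D :: "('x, 'o, 'm) int_space" and u v w
  assume "A \<in> ob (IntDist Q)" "B \<in> ob (IntDist Q)" "C \<in> ob (IntDist Q)" "D \<in> ob (IntDist Q)"
    "u \<in> carrier (hom (IntDist Q) A B)" "v \<in> carrier (hom (IntDist Q) B C)"
    "w \<in> carrier (hom (IntDist Q) C D)"
  then show "comp (IntDist Q) A B D (comp (IntDist Q) B C D w v) u =
      comp (IntDist Q) A C D w (comp (IntDist Q) A B C v u)"
    by (cases A; cases B; cases C; cases D) (simp, (rule dist_comp_assoc; blast intro: int_space_qcat continuous_dist))
next
  fix A B :: "('x, 'o, 'm) int_space" and u
  assume "A \<in> ob (IntDist Q)" "B \<in> ob (IntDist Q)" "u \<in> carrier (hom (IntDist Q) A B)"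
  then show "comp (IntDist Q) A B B (ident (IntDist Q) B) u = u"
    by (cases A; cases B) (simp, (rule dist_comp_ident_left; blast intro: int_space_qcat continuous_dist))
next
  fix A B :: "('x, 'o, 'm) int_space" and u
  assume "A \<in> ob (IntDist Q)" "B \<in> ob (IntDist Q)" "u \<in> carrier (hom (IntDist Q) A B)"
  then show "comp (IntDist Q) A A B u (ident (IntDist Q) A) = u"
    by (cases A; cases B) (simp, (rule dist_comp_ident_right; blast intro: int_space_qcat continuous_dist))
next
  fix A B C :: "('x, 'o, 'm) int_space" and u V
  assume *: "A \<in> ob (IntDist Q)" "B \<in> ob (IntDist Q)" "C \<in> ob (IntDist Q)"
    "u \<in> carrier (hom (IntDist Q) A B)" "V \<subseteq> carrier (hom (IntDist Q) B C)"
  obtain X a Y b Z c where [simp]: "A = (X, a)" "B = (Y, b)" "C = (Z, c)"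
    by (cases A, cases B, cases C)
  have V: "is_continuous Q (Y, b) (Z, c) v" if "v \<in> V" for v
    using that * by auto
  have "(\<lambda>v. dist_comp Q X Y Z v u) ` V \<subseteq> Collect (is_continuous Q (X, a) (Z, c))"
    using * V by (auto intro!: continuous_comp)
  then show "comp (IntDist Q) A B C (\<Squnion>\<^bsub>hom (IntDist Q) B C\<^esub> V) u =
      \<Squnion>\<^bsub>hom (IntDist Q) A C\<^esub> ((\<lambda>v. comp (IntDist Q) A B C v u) ` V)"
    using * V
    by (simp add: IntDist_Sup) (rule dist_comp_Sup_left; blast intro: int_space_qcat continuous_dist)
next
  fix A B C :: "('x, 'o, 'm) int_space" and U v
  assume *: "A \<in> ob (IntDist Q)" "B \<in> ob (IntDist Q)" "C \<in> ob (IntDist Q)"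
    "U \<subseteq> carrier (hom (IntDist Q) A B)" "v \<in> carrier (hom (IntDist Q) B C)"
  obtain X a Y b Z c where [simp]: "A = (X, a)" "B = (Y, b)" "C = (Z, c)"
    by (cases A, cases B, cases C)
  have U: "is_continuous Q (X, a) (Y, b) u" if "u \<in> U" for u
    using that * by auto
  have "dist_comp Q X Y Z v ` U \<subseteq> Collect (is_continuous Q (X, a) (Z, c))"
    using * U by (auto intro!: continuous_comp)
  then show "comp (IntDist Q) A B C v (\<Squnion>\<^bsub>hom (IntDist Q) A B\<^esub> U) =
      \<Squnion>\<^bsub>hom (IntDist Q) A C\<^esub> ((\<lambda>u. comp (IntDist Q) A B C v u) ` U)"
    using * U
    by (simp add: IntDist_Sup) (rule dist_comp_Sup_right; blast intro: int_space_qcat continuous_dist)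
qed


section \<open>The arrow quantaloid\<close>

lemma ArrDist_simps [simp]:
  "(X, Y, \<phi>) \<in> ob (ArrDist Q) \<longleftrightarrow> is_qcat Q X \<and> is_qcat Q Y \<and> is_dist Q X Y \<phi>"
  "(\<zeta>, \<eta>) \<in> carrier (hom (ArrDist Q) (X, Y, \<phi>) (X', Y', \<psi>)) \<longleftrightarrow>
    is_dist Q X X' \<zeta> \<and> is_dist Q Y Y' \<eta> \<and> dist_comp Q X X' Y' \<psi> \<zeta> = dist_comp Q X Y Y' \<eta> \<phi>"
  "le (hom (ArrDist Q) (X, Y, \<phi>) (X', Y', \<psi>)) (\<zeta>, \<eta>) (\<zeta>', \<eta>') \<longleftrightarrow>
    dist_le Q X X' \<zeta> \<zeta>' \<and> dist_le Q Y Y' \<eta> \<eta>'"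
  "eq (hom (ArrDist Q) (X, Y, \<phi>) (X', Y', \<psi>)) = (=)"
  "comp (ArrDist Q) (X, Y, \<phi>) (X', Y', \<psi>) (X'', Y'', \<chi>) (\<zeta>'', \<eta>'') (\<zeta>, \<eta>) =
    (dist_comp Q X X' X'' \<zeta>'' \<zeta>, dist_comp Q Y Y' Y'' \<eta>'' \<eta>)"
  "ident (ArrDist Q) (X, Y, \<phi>) = (carr X, carr Y)"
  by (simp_all add: ArrDist_def)

lemma ArrDist_joins:
  assumes cat: "is_qcat Q X" "is_qcat Q Y" "is_qcat Q X'" "is_qcat Q Y'"
    and dist: "is_dist Q X Y \<phi>" "is_dist Q X' Y' \<psi>"
  shows ArrDist_lattice: "complete_lattice (hom (ArrDist Q) (X, Y, \<phi>) (X', Y', \<psi>))"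
    and ArrDist_Sup: "U \<subseteq> carrier (hom (ArrDist Q) (X, Y, \<phi>) (X', Y', \<psi>)) \<Longrightarrow>
      \<Squnion>\<^bsub>hom (ArrDist Q) (X, Y, \<phi>) (X', Y', \<psi>)\<^esub> U = (dist_Sup Q X X' (fst ` U), dist_Sup Q Y Y' (snd ` U))"
proof -
  let ?L = "hom (ArrDist Q) (X, Y, \<phi>) (X', Y', \<psi>)"
  let ?S = "\<lambda>U. (dist_Sup Q X X' (fst ` U), dist_Sup Q Y Y' (snd ` U))"
  have mem: "is_dist Q X X' (fst u)" "is_dist Q Y Y' (snd u)"
      "dist_comp Q X X' Y' \<psi> (fst u) = dist_comp Q X Y Y' (snd u) \<phi>"
    if "u \<in> carrier ?L" for u
    using that by (cases u; simp)+
  have le: "u \<sqsubseteq>\<^bsub>?L\<^esub> v \<longleftrightarrow> dist_le Q X X' (fst u) (fst v) \<and> dist_le Q Y Y' (snd u) (snd v)" for u v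
    by (cases u; cases v; simp)
  have dfst: "is_dist Q X X' x" if "U \<subseteq> carrier ?L" "x \<in> fst ` U" for U x
    using that mem by auto
  have dsnd: "is_dist Q Y Y' x" if "U \<subseteq> carrier ?L" "x \<in> snd ` U" for U x
    using that mem by auto
  have 1: "x \<sqsubseteq>\<^bsub>?L\<^esub> x" if "x \<in> carrier ?L" for x
    using mem[OF that] cat by (simp add: le dist_le_refl)
  have 2: "x = y" if "x \<in> carrier ?L" "y \<in> carrier ?L" "x \<sqsubseteq>\<^bsub>?L\<^esub> y" "y \<sqsubseteq>\<^bsub>?L\<^esub> x" for x y
    using that mem[of x] mem[of y] cat
    by (intro prod_eqI dist_le_antisym[of X X'] dist_le_antisym[of Y Y']) (simp_all add: le)
  have 3: "x \<sqsubseteq>\<^bsub>?L\<^esub> z"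
    if "x \<in> carrier ?L" "y \<in> carrier ?L" "z \<in> carrier ?L" "x \<sqsubseteq>\<^bsub>?L\<^esub> y" "y \<sqsubseteq>\<^bsub>?L\<^esub> z" for x y z
    using that mem[of x] mem[of y] mem[of z] cat
    by (auto simp: le intro: dist_le_trans[of X X' "fst x" "fst y" "fst z"]
        dist_le_trans[of Y Y' "snd x" "snd y" "snd z"])
  have 4: "?S U \<in> carrier ?L" if U: "U \<subseteq> carrier ?L" for U
  proof -
    \<comment> \<open>Each member of \<open>U\<close> is a commuting square, so its two composites
      coincide. The two sets of composites are therefore equal, and so are their joins.\<close>
    have "dist_comp Q X X' Y' \<psi> ` fst ` U = (\<lambda>\<eta>. dist_comp Q X Y Y' \<eta> \<phi>) ` snd ` U"
      unfolding image_image using U mem(3) by (intro image_cong refl) auto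
    then have "dist_comp Q X X' Y' \<psi> (dist_Sup Q X X' (fst ` U)) = dist_comp Q X Y Y' (dist_Sup Q Y Y' (snd ` U)) \<phi>"
      using dist_comp_Sup_right[OF cat(1,3,4) dfst[OF U] dist(2)]
        dist_comp_Sup_left[OF cat(1,2,4) dist(1) dsnd[OF U]] by simp
    then show ?thesis
      using dist_Sup_dist[OF cat(1,3) dfst[OF U]] dist_Sup_dist[OF cat(2,4) dsnd[OF U]] by simp
  qed
  have 5: "x \<sqsubseteq>\<^bsub>?L\<^esub> ?S U" if "U \<subseteq> carrier ?L" "x \<in> U" for U x
    using that dist_Sup_upper[OF cat(1,3) dfst] dist_Sup_upper[OF cat(2,4) dsnd] by (simp add: le)
  have 6: "?S U \<sqsubseteq>\<^bsub>?L\<^esub> z" if "U \<subseteq> carrier ?L" "z \<in> carrier ?L" "\<And>x. x \<in> U \<Longrightarrow> x \<sqsubseteq>\<^bsub>?L\<^esub> z" for U z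
    using that dist_Sup_le_iff[OF cat(1,3) dfst[OF that(1)] mem(1)[OF that(2)]]
      dist_Sup_le_iff[OF cat(2,4) dsnd[OF that(1)] mem(2)[OF that(2)]] by (simp add: le)
  show "complete_lattice ?L"
    by (rule complete_lattice_of_joins_lattice[of ?L ?S, OF _ 1 2 3 4 5 6]) simp_all
  show "\<Squnion>\<^bsub>?L\<^esub> U = ?S U" if "U \<subseteq> carrier ?L"
    by (rule complete_lattice_of_joins_sup[of ?L ?S, OF _ 1 2 3 4 5 6]) (use that in simp_all)
qed

text \<open>Two commuting squares are pasted along \<psi>; each rewriting is one associativity step
  and at most one of the two squares.\<close>

lemma ArrDist_comp_closed:
  assumes "p \<in> ob (ArrDist Q)" "q \<in> ob (ArrDist Q)" "r \<in> ob (ArrDist Q)"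
    "u \<in> carrier (hom (ArrDist Q) p q)" "v \<in> carrier (hom (ArrDist Q) q r)"
  shows "comp (ArrDist Q) p q r v u \<in> carrier (hom (ArrDist Q) p r)"
proof -
  obtain X Y \<phi> where p[simp]: "p = (X, Y, \<phi>)" by (cases p)
  obtain X' Y' \<psi> where q[simp]: "q = (X', Y', \<psi>)" by (cases q)
  obtain X'' Y'' \<chi> where r[simp]: "r = (X'', Y'', \<chi>)" by (cases r)
  obtain \<zeta> \<eta> where u[simp]: "u = (\<zeta>, \<eta>)" by (cases u)
  obtain \<zeta>' \<eta>' where v[simp]: "v = (\<zeta>', \<eta>')" by (cases v)
  note cat = assms(1-3)[simplified] and arr = assms(4,5)[simplified]
  have "dist_comp Q X X'' Y'' \<chi> (dist_comp Q X X' X'' \<zeta>' \<zeta>) = dist_comp Q X X' Y'' (dist_comp Q X' Y' Y'' \<eta>' \<psi>) \<zeta>"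
    using cat arr dist_comp_assoc[of X X' X'' Y'' \<zeta> \<zeta>' \<chi>] by simp
  also have "\<dots> = dist_comp Q X Y' Y'' \<eta>' (dist_comp Q X Y Y' \<eta> \<phi>)"
    using cat arr dist_comp_assoc[of X X' Y' Y'' \<zeta> \<psi> \<eta>'] by simp
  also have "\<dots> = dist_comp Q X Y Y'' (dist_comp Q Y Y' Y'' \<eta>' \<eta>) \<phi>"
    using cat arr dist_comp_assoc[of X Y Y' Y'' \<phi> \<eta> \<eta>'] by simp
  finally show ?thesis
    using cat arr by (simp add: dist_comp_dist)
qed

lemma ArrDist_quantaloid:
  "quantaloid (ArrDist Q :: (('x, 'y, 'o, 'm) dist_ob, ('x, 'y, 'm) dist_arr) quantaloid)"
    (is "quantaloid ?A")
proof (rule quantaloid.intro)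
  fix p q :: "('x, 'y, 'o, 'm) dist_ob"
  assume "p \<in> ob ?A" "q \<in> ob ?A"
  then show "complete_lattice (hom ?A p q)"
    by (cases p; cases q) (simp add: ArrDist_lattice)
next
  fix p :: "('x, 'y, 'o, 'm) dist_ob"
  assume "p \<in> ob ?A"
  then show "ident ?A p \<in> carrier (hom ?A p p)"
    by (cases p) (simp add: carr_dist dist_comp_ident_left dist_comp_ident_right)
next
  fix p q r :: "('x, 'y, 'o, 'm) dist_ob" and u v
  assume "p \<in> ob ?A" "q \<in> ob ?A" "r \<in> ob ?A" "u \<in> carrier (hom ?A p q)" "v \<in> carrier (hom ?A q r)"
  then show "comp ?A p q r v u \<in> carrier (hom ?A p r)"
    by (rule ArrDist_comp_closed)
next
  fix p q r s :: "('x, 'y, 'o, 'm) dist_ob" and u v w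
  assume "p \<in> ob ?A" "q \<in> ob ?A" "r \<in> ob ?A" "s \<in> ob ?A"
    "u \<in> carrier (hom ?A p q)" "v \<in> carrier (hom ?A q r)" "w \<in> carrier (hom ?A r s)"
  then show "comp ?A p q s (comp ?A q r s w v) u = comp ?A p r s w (comp ?A p q r v u)"
    by (cases p; cases q; cases r; cases s; cases u; cases v; cases w) (simp add: dist_comp_assoc)
next
  fix p q :: "('x, 'y, 'o, 'm) dist_ob" and u
  assume "p \<in> ob ?A" "q \<in> ob ?A" "u \<in> carrier (hom ?A p q)"
  then show "comp ?A p q q (ident ?A q) u = u" "comp ?A p p q u (ident ?A p) = u"
    by (cases p; cases q; cases u; simp add: dist_comp_ident_left dist_comp_ident_right)+
next
  fix p q r :: "('x, 'y, 'o, 'm) dist_ob" and u V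
  assume *: "p \<in> ob ?A" "q \<in> ob ?A" "r \<in> ob ?A" "u \<in> carrier (hom ?A p q)" "V \<subseteq> carrier (hom ?A q r)"
  obtain X Y \<phi> where p[simp]: "p = (X, Y, \<phi>)" by (cases p)
  obtain X' Y' \<psi> where q[simp]: "q = (X', Y', \<psi>)" by (cases q)
  obtain X'' Y'' \<chi> where r[simp]: "r = (X'', Y'', \<chi>)" by (cases r)
  obtain \<zeta> \<eta> where u[simp]: "u = (\<zeta>, \<eta>)" by (cases u)
  have img: "(\<lambda>v. comp ?A p q r v u) ` V \<subseteq> carrier (hom ?A p r)"
    using ArrDist_comp_closed[OF *(1-4)] *(5) by blast
  \<comment> \<open>Composition in \<open>ArrDist Q\<close> is defined by matching on pairs. Written
    with projections, it can be pushed through the image of a set of arrows.\<close>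
  have split: "comp ?A p q r v u = (dist_comp Q X X' X'' (fst v) \<zeta>, dist_comp Q Y Y' Y'' (snd v) \<eta>)" for v
    by (cases v) simp
  have V: "is_dist Q X' X'' x" if "x \<in> fst ` V" for x
    using that * by auto
  have V': "is_dist Q Y' Y'' x" if "x \<in> snd ` V" for x
    using that * by auto
  have "\<Squnion>\<^bsub>hom ?A p r\<^esub> ((\<lambda>v. comp ?A p q r v u) ` V) =
      (dist_Sup Q X X'' (fst ` (\<lambda>v. comp ?A p q r v u) ` V), dist_Sup Q Y Y'' (snd ` (\<lambda>v. comp ?A p q r v u) ` V))"
    using * img by (simp add: ArrDist_Sup)
  moreover have "\<Squnion>\<^bsub>hom ?A q r\<^esub> V = (dist_Sup Q X' X'' (fst ` V), dist_Sup Q Y' Y'' (snd ` V))"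
    using * by (simp add: ArrDist_Sup)
  ultimately show "comp ?A p q r (\<Squnion>\<^bsub>hom ?A q r\<^esub> V) u = \<Squnion>\<^bsub>hom ?A p r\<^esub> ((\<lambda>v. comp ?A p q r v u) ` V)"
    using * by (simp only: split image_image fst_conv snd_conv)
      (simp add: dist_comp_Sup_left V V' image_image)
next
  fix p q r :: "('x, 'y, 'o, 'm) dist_ob" and U v
  assume *: "p \<in> ob ?A" "q \<in> ob ?A" "r \<in> ob ?A" "U \<subseteq> carrier (hom ?A p q)" "v \<in> carrier (hom ?A q r)"
  obtain X Y \<phi> where p[simp]: "p = (X, Y, \<phi>)" by (cases p)
  obtain X' Y' \<psi> where q[simp]: "q = (X', Y', \<psi>)" by (cases q)
  obtain X'' Y'' \<chi> where r[simp]: "r = (X'', Y'', \<chi>)" by (cases r)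
  obtain \<zeta> \<eta> where v[simp]: "v = (\<zeta>, \<eta>)" by (cases v)
  have img: "comp ?A p q r v ` U \<subseteq> carrier (hom ?A p r)"
    using ArrDist_comp_closed[OF *(1-3) _ *(5)] *(4) by blast
  have split: "comp ?A p q r v u = (dist_comp Q X X' X'' \<zeta> (fst u), dist_comp Q Y Y' Y'' \<eta> (snd u))" for u
    by (cases u) simp
  have U: "is_dist Q X X' x" if "x \<in> fst ` U" for x
    using that * by auto
  have U': "is_dist Q Y Y' x" if "x \<in> snd ` U" for x
    using that * by auto
  have "\<Squnion>\<^bsub>hom ?A p r\<^esub> (comp ?A p q r v ` U) =
      (dist_Sup Q X X'' (fst ` comp ?A p q r v ` U), dist_Sup Q Y Y'' (snd ` comp ?A p q r v ` U))"
    using * img by (simp add: ArrDist_Sup)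
  moreover have "\<Squnion>\<^bsub>hom ?A p q\<^esub> U = (dist_Sup Q X X' (fst ` U), dist_Sup Q Y Y' (snd ` U))"
    using * by (simp add: ArrDist_Sup)
  ultimately show "comp ?A p q r v (\<Squnion>\<^bsub>hom ?A p q\<^esub> U) = \<Squnion>\<^bsub>hom ?A p r\<^esub> (comp ?A p q r v ` U)"
    using * by (simp only: split image_image fst_conv snd_conv)
      (simp add: dist_comp_Sup_right U U' image_image)
qed

end

section \<open>The Kan homomorphism\<close>

lemma Khat_simps [simp]:
  "omap (Khat Q) (X, Y, \<phi>) =
    (X, compose (carrier (PSh Q X)) (kan_upper Q X Y \<phi>) (kan_lower Q X Y \<phi>))"
  "amap (Khat Q) p q u = fst u"
  by (simp_all add: Khat_def split_beta)

context quantaloid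
begin

text \<open>Only well-definedness has content, through \<open>kan_int_space\<close> and
  \<open>kan_continuous\<close>. On arrows \<open>Khat\<close> is the first projection, and
  identities, composites and joins of squares are all formed componentwise.\<close>

lemma Khat_hom:
  "quantaloid_hom (ArrDist Q :: (('x, 'y, 'o, 'm) dist_ob, ('x, 'y, 'm) dist_arr) quantaloid)
     (IntDist Q) (Khat Q)"
  (is "quantaloid_hom ?A ?B ?K")
proof -
  have obj: "omap ?K p \<in> ob ?B" if "p \<in> ob ?A" for p
    using that by (cases p) (simp add: kan_int_space)
  have arr: "amap ?K p q u \<in> carrier (hom ?B (omap ?K p) (omap ?K q))"
    if "p \<in> ob ?A" "q \<in> ob ?A" "u \<in> carrier (hom ?A p q)" for p q u
    using that by (cases p; cases q; cases u) (auto intro: kan_continuous)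
  have Sup: "amap ?K p q (\<Squnion>\<^bsub>hom ?A p q\<^esub> U) = \<Squnion>\<^bsub>hom ?B (omap ?K p) (omap ?K q)\<^esub> (amap ?K p q ` U)"
    if "p \<in> ob ?A" "q \<in> ob ?A" "U \<subseteq> carrier (hom ?A p q)" for p q U
  proof -
    have "amap ?K p q ` U \<subseteq> carrier (hom ?B (omap ?K p) (omap ?K q))"
      using arr[OF that(1,2)] that(3) by blast
    then show ?thesis
      using that obj[OF that(1)] obj[OF that(2)]
      by (cases p; cases q) (simp add: ArrDist_Sup IntDist_Sup)
  qed
  show ?thesis
  proof (intro quantaloid_hom.intro quantaloid_functor.intro quantaloid_functor_axioms.intro
      quantaloid_hom_axioms.intro ArrDist_quantaloid IntDist_quantaloid)
    fix p assume "p \<in> ob ?A"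
    then show "amap ?K p p (ident ?A p) = ident ?B (omap ?K p)"
      by (cases p) simp
  next
    fix p q r u v
    assume "p \<in> ob ?A" "q \<in> ob ?A" "r \<in> ob ?A" "u \<in> carrier (hom ?A p q)" "v \<in> carrier (hom ?A q r)"
    then show "amap ?K p r (comp ?A p q r v u) =
        comp ?B (omap ?K p) (omap ?K q) (omap ?K r) (amap ?K q r v) (amap ?K p q u)"
      by (cases p; cases q; cases r; cases u; cases v) simp
  qed (use obj arr Sup in blast)+
qed

end


section \<open>The open-set functor\<close>

text \<open>The second component of \<open>Ihat\<close> on arrows receives a name so that it stays
  folded in proofs. Its value at (m, n) is the hom in \<open>PSh Q X\<close> from m to
  \<open>\<zeta>\<^sup>* n\<close>, as \<open>opens_map_apply\<close> records.\<close>

definition opens_map ::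
  "('o, 'm) quantaloid \<Rightarrow> ('x, 'o, 'm) int_space \<Rightarrow> ('y, 'o, 'm) int_space \<Rightarrow> ('x \<times> 'y \<Rightarrow> 'm) \<Rightarrow>
    (('x, 'o, 'm) presheaf \<times> ('y, 'o, 'm) presheaf \<Rightarrow> 'm)" where
  "opens_map Q A B \<zeta> =
    restrict (cograph (PSh Q (fst B)) (PSh Q (fst A)) (kan_upper Q (fst A) (fst B) \<zeta>))
      (carrier (opens Q A) \<times> carrier (opens Q B))"

lemma Ihat_simps [simp]:
  "omap (Ihat Q) (X, a) = (X, opens Q (X, a), kappa Q (X, a))"
  "amap (Ihat Q) A B \<zeta> = (\<zeta>, opens_map Q A B \<zeta>)"
  by (simp_all add: Ihat_def opens_map_def)

lemma opens_carrier_iff: "m \<in> carrier (opens Q (X, a)) \<longleftrightarrow> m \<in> carrier (PSh Q X) \<and> a m = m"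
  by (simp add: opens_def full_subcat_def)

lemma opens_ty: "m \<in> carrier (opens Q (X, a)) \<Longrightarrow> ty (opens Q (X, a)) m = fst m"
  by (simp add: opens_carrier_iff) (simp add: opens_def full_subcat_def PSh_ty)

lemma opens_carr:
  "\<lbrakk>m \<in> carrier (opens Q (X, a)); n \<in> carrier (opens Q (X, a))\<rbrakk> \<Longrightarrow>
    carr (opens Q (X, a)) (m, n) = carr (PSh Q X) (m, n)"
  by (simp add: opens_carrier_iff) (simp add: opens_def full_subcat_def)

lemma opens_map_apply:
  "\<lbrakk>m \<in> carrier (opens Q (X, a)); n \<in> carrier (opens Q (Y, b))\<rbrakk> \<Longrightarrow>
    opens_map Q (X, a) (Y, b) \<zeta> (m, n) = carr (PSh Q X) (m, kan_upper Q X Y \<zeta> n)"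
  by (simp add: opens_map_def cograph_def opens_carrier_iff)

lemma kappa_apply:
  "\<lbrakk>x \<in> carrier X; m \<in> carrier (opens Q (X, a))\<rbrakk> \<Longrightarrow> kappa Q (X, a) (x, m) = snd m (x, ())"
  by (simp add: kappa_def split_beta)

context quantaloid
begin

lemma full_subcat_qcat:
  assumes X: "is_qcat Q X" and S: "S \<subseteq> carrier X"
  shows "is_qcat Q (full_subcat X S)"
  using S unfolding is_qcat_def full_subcat_def
  by (auto simp: subset_iff qcat_ty[OF X] qcat_carr[OF X] qcat_refl[OF X] qcat_trans[OF X])

lemma opens_qcat: "is_qcat Q X \<Longrightarrow> is_qcat Q (opens Q (X, a))"
  by (auto simp: opens_def intro!: full_subcat_qcat PSh_qcat)

lemma PSh_carr_trans:
  assumes "is_qcat Q X" "m \<in> carrier (PSh Q X)" "n \<in> carrier (PSh Q X)" "k \<in> carrier (PSh Q X)"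
  shows "comp Q (fst m) (fst n) (fst k) (carr (PSh Q X) (n, k)) (carr (PSh Q X) (m, n))
    \<preceq>[fst m, fst k] carr (PSh Q X) (m, k)"
  using qcat_trans[OF PSh_qcat[OF assms(1)] assms(2-4)] assms by (simp add: PSh_ty)

lemma PSh_carr_refl:
  assumes "is_qcat Q X" "m \<in> carrier (PSh Q X)"
  shows "ident Q (fst m) \<preceq>[fst m, fst m] carr (PSh Q X) (m, m)"
  using qcat_refl[OF PSh_qcat[OF assms(1)] assms(2)] assms by (simp add: PSh_ty)

text \<open>This yields the monotonicity of \<open>Ihat\<close>, because \<zeta> enters
  \<open>opens_map\<close> only through the second argument of a hom.\<close>

lemma PSh_carr_mono_right:
  assumes X: "is_qcat Q X" and [simp]: "m \<in> carrier (PSh Q X)" "n \<in> carrier (PSh Q X)" "k \<in> carrier (PSh Q X)"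
    and le: "qcat_le Q (PSh Q X) n k"
  shows "carr (PSh Q X) (m, n) \<preceq>[fst m, fst n] carr (PSh Q X) (m, k)"
proof -
  note [simp] = X PSh_ob[of _ X] PSh_carr_closed PSh_value qcat_simps
  have nk: "fst k = fst n" "\<And>x. x \<in> carrier X \<Longrightarrow> snd n (x, ()) \<preceq>[ty X x, fst n] snd k (x, ())"
    using le by (auto simp: PSh_le_iff dist_le_def)
  have cl: "snd k (x, ()) \<in> Hom (ty X x) (fst n)" if "x \<in> carrier X" for x
    using PSh_value[of k X x] that nk by simp
  have "comp Q (ty X x) (fst m) (fst n) (carr (PSh Q X) (m, n)) (snd m (x, ())) \<preceq>[ty X x, fst n] snd k (x, ())"
    if [simp]: "x \<in> carrier X" for x
    by (rule le_trans[OF PSh_carr_counit nk(2)]) (simp_all add: cl)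
  then show ?thesis
    using le_PSh_carr_iff[OF X, of m k "carr (PSh Q X) (m, n)"] nk(1) by simp
qed

lemma kan_upper_carr_le:
  assumes "is_qcat Q X" "is_qcat Q Y" "is_dist Q X Y \<zeta>" "n \<in> carrier (PSh Q Y)" "n' \<in> carrier (PSh Q Y)"
  shows "carr (PSh Q Y) (n, n') \<preceq>[fst n, fst n'] carr (PSh Q X) (kan_upper Q X Y \<zeta> n, kan_upper Q X Y \<zeta> n')"
  using kan_upper_functor[OF assms(1-3)] assms(4,5) by (simp add: is_qfunctor_def PSh_ty)

text \<open>Evaluation is compatible with homs between open presheaves by the counit of the presheaf
  hom, and with homs of \<open>X\<close> because each presheaf is a distributor.\<close>

lemma kappa_dist:
  assumes X: "is_qcat Q X"
  shows "is_dist Q X (opens Q (X, a)) (kappa Q (X, a))"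
proof (rule is_distI[OF X opens_qcat[OF X]])
  show "kappa Q (X, a) \<in> extensional (carrier X \<times> carrier (opens Q (X, a)))"
    by (simp add: kappa_def)
  fix x m assume x: "x \<in> carrier X" and m: "m \<in> carrier (opens Q (X, a))"
  have m': "m \<in> carrier (PSh Q X)"
    using m by (simp add: opens_carrier_iff)
  show "kappa Q (X, a) (x, m) \<in> Hom (ty X x) (ty (opens Q (X, a)) m)"
    using x m m' by (simp add: kappa_apply opens_ty PSh_value)
  show "comp Q (ty X x) (ty (opens Q (X, a)) m) (ty (opens Q (X, a)) n)
      (carr (opens Q (X, a)) (m, n)) (kappa Q (X, a) (x, m)) \<preceq>[ty X x, ty (opens Q (X, a)) n] kappa Q (X, a) (x, n)"
    if n: "n \<in> carrier (opens Q (X, a))" for n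
    using PSh_carr_counit[OF X m' _ x, of n] x m n by (simp add: kappa_apply opens_ty opens_carr opens_carrier_iff)
  show "comp Q (ty X x') (ty X x) (ty (opens Q (X, a)) m) (kappa Q (X, a) (x, m)) (carr X (x', x))
      \<preceq>[ty X x', ty (opens Q (X, a)) m] kappa Q (X, a) (x', m)" if x': "x' \<in> carrier X" for x'
    using dist_act_right[OF X PSh_point[OF m'] PSh_dist[OF m'] x x', of "()"] x x' m
    by (simp add: kappa_apply opens_ty)
qed

text \<open>At an open \<open>n\<close> the equation b n = n turns continuity into
  \<open>\<zeta>\<^sup>* n \<le> a (\<zeta>\<^sup>* n)\<close>; the other inequality holds for every
  interior operator.\<close>

lemma kan_upper_open:
  assumes A: "is_int_space Q (X, a)" and B: "is_int_space Q (Y, b)"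
    and \<zeta>: "is_continuous Q (X, a) (Y, b) \<zeta>" and n: "n \<in> carrier (opens Q (Y, b))"
  shows "kan_upper Q X Y \<zeta> n \<in> carrier (opens Q (X, a))"
proof -
  have n': "n \<in> carrier (PSh Q Y)" "b n = n"
    using n by (simp_all add: opens_carrier_iff)
  have k: "kan_upper Q X Y \<zeta> n \<in> carrier (PSh Q X)"
    by (rule kan_upper_closed[OF int_space_qcat[OF A] int_space_qcat[OF B] continuous_dist[OF \<zeta>] n'(1)])
  then have "a (kan_upper Q X Y \<zeta> n) = kan_upper Q X Y \<zeta> n"
    using continuous_le[OF \<zeta> n'(1)] n'(2)
    by (intro PSh_le_antisym[OF int_space_qcat[OF A]]) (auto intro: int_space_closed[OF A] int_space_le[OF A])
  with k show ?thesis
    by (simp add: opens_carrier_iff)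
qed

text \<open>The action of the source is the triangle law in \<open>PSh Q X\<close>. For the action
  of the target, functoriality of \<open>\<zeta>\<^sup>*\<close> first carries the hom from
  \<open>PSh Q Y\<close> to \<open>PSh Q X\<close>, where the same law applies.\<close>

lemma opens_map_dist:
  assumes A: "is_int_space Q (X, a)" and B: "is_int_space Q (Y, b)" and \<zeta>: "is_continuous Q (X, a) (Y, b) \<zeta>"
  shows "is_dist Q (opens Q (X, a)) (opens Q (Y, b)) (opens_map Q (X, a) (Y, b) \<zeta>)"
proof -
  note X = int_space_qcat[OF A] and Y = int_space_qcat[OF B] and d = continuous_dist[OF \<zeta>]
  note [simp] = X Y d kan_upper_closed kan_upper_fst PSh_carr_closed PSh_ob[of _ X] PSh_ob[of _ Y]
    opens_ty opens_carr opens_map_apply comp_closed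
  have opX[simp]: "m \<in> carrier (PSh Q X)" if "m \<in> carrier (opens Q (X, a))" for m
    using that by (simp add: opens_carrier_iff)
  have opY[simp]: "n \<in> carrier (PSh Q Y)" if "n \<in> carrier (opens Q (Y, b))" for n
    using that by (simp add: opens_carrier_iff)
  have cl[simp]: "carr (PSh Q X) (m, kan_upper Q X Y \<zeta> n) \<in> Hom (fst m) (fst n)"
      "carr (PSh Q X) (kan_upper Q X Y \<zeta> n, m) \<in> Hom (fst n) (fst m)"
    if "m \<in> carrier (PSh Q X)" "n \<in> carrier (PSh Q Y)" for m n
    using that PSh_carr_closed[OF X, of m "kan_upper Q X Y \<zeta> n"]
      PSh_carr_closed[OF X, of "kan_upper Q X Y \<zeta> n" m] by simp_all
  have cl'[simp]: "carr (PSh Q X) (kan_upper Q X Y \<zeta> n, kan_upper Q X Y \<zeta> n') \<in> Hom (fst n) (fst n')"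
    if "n \<in> carrier (PSh Q Y)" "n' \<in> carrier (PSh Q Y)" for n n'
    using that PSh_carr_closed[OF X, of "kan_upper Q X Y \<zeta> n" "kan_upper Q X Y \<zeta> n'"] by simp
  show ?thesis
  proof (rule is_distI[OF opens_qcat[OF X] opens_qcat[OF Y]])
    show "opens_map Q (X, a) (Y, b) \<zeta> \<in> extensional (carrier (opens Q (X, a)) \<times> carrier (opens Q (Y, b)))"
      by (simp add: opens_map_def)
    fix m n assume [simp]: "m \<in> carrier (opens Q (X, a))" "n \<in> carrier (opens Q (Y, b))"
    show "opens_map Q (X, a) (Y, b) \<zeta> (m, n) \<in> Hom (ty (opens Q (X, a)) m) (ty (opens Q (Y, b)) n)"
      by simp
    show "comp Q (ty (opens Q (X, a)) m) (ty (opens Q (Y, b)) n) (ty (opens Q (Y, b)) n')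
        (carr (opens Q (Y, b)) (n, n')) (opens_map Q (X, a) (Y, b) \<zeta> (m, n))
      \<preceq>[ty (opens Q (X, a)) m, ty (opens Q (Y, b)) n'] opens_map Q (X, a) (Y, b) \<zeta> (m, n')"
      if [simp]: "n' \<in> carrier (opens Q (Y, b))" for n'
    proof -
      have "comp Q (fst m) (fst n) (fst n') (carr (PSh Q Y) (n, n')) (carr (PSh Q X) (m, kan_upper Q X Y \<zeta> n))
        \<preceq>[fst m, fst n'] comp Q (fst m) (fst n) (fst n')
          (carr (PSh Q X) (kan_upper Q X Y \<zeta> n, kan_upper Q X Y \<zeta> n')) (carr (PSh Q X) (m, kan_upper Q X Y \<zeta> n))"
        by (rule comp_mono_left) (simp_all add: kan_upper_carr_le)
      moreover have "comp Q (fst m) (fst n) (fst n')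
          (carr (PSh Q X) (kan_upper Q X Y \<zeta> n, kan_upper Q X Y \<zeta> n')) (carr (PSh Q X) (m, kan_upper Q X Y \<zeta> n))
        \<preceq>[fst m, fst n'] carr (PSh Q X) (m, kan_upper Q X Y \<zeta> n')"
        using PSh_carr_trans[OF X, of m "kan_upper Q X Y \<zeta> n" "kan_upper Q X Y \<zeta> n'"] by simp
      ultimately show ?thesis
        by (auto intro: le_trans)
    qed
    show "comp Q (ty (opens Q (X, a)) m') (ty (opens Q (X, a)) m) (ty (opens Q (Y, b)) n)
        (opens_map Q (X, a) (Y, b) \<zeta> (m, n)) (carr (opens Q (X, a)) (m', m))
      \<preceq>[ty (opens Q (X, a)) m', ty (opens Q (Y, b)) n] opens_map Q (X, a) (Y, b) \<zeta> (m', n)"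
      if [simp]: "m' \<in> carrier (opens Q (X, a))" for m'
      using PSh_carr_trans[OF X, of m' m "kan_upper Q X Y \<zeta> n"] by simp
  qed
qed

lemma kappa_natural:
  assumes A: "is_int_space Q (X, a)" and B: "is_int_space Q (Y, b)" and \<zeta>: "is_continuous Q (X, a) (Y, b) \<zeta>"
  shows "dist_comp Q X Y (opens Q (Y, b)) (kappa Q (Y, b)) \<zeta> =
    dist_comp Q X (opens Q (X, a)) (opens Q (Y, b)) (opens_map Q (X, a) (Y, b) \<zeta>) (kappa Q (X, a))"
proof -
  note X = int_space_qcat[OF A] and Y = int_space_qcat[OF B] and d = continuous_dist[OF \<zeta>]
  note cat = X Y opens_qcat[OF X, of a] opens_qcat[OF Y, of b]
  note dist = d kappa_dist[OF X, of a] kappa_dist[OF Y, of b] opens_map_dist[OF assms]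
  note lhs = dist_comp_dist[OF cat(1,2,4) dist(1,3)] and rhs = dist_comp_dist[OF cat(1,3,4) dist(2,4)]
  show ?thesis
  proof (rule dist_eqI[OF lhs rhs])
    fix x n assume x[simp]: "x \<in> carrier X" and n[simp]: "n \<in> carrier (opens Q (Y, b))"
    let ?k = "kan_upper Q X Y \<zeta> n"
    have [simp]: "n \<in> carrier (PSh Q Y)" using n by (simp add: opens_carrier_iff)
    have k[simp]: "?k \<in> carrier (opens Q (X, a))" by (rule kan_upper_open[OF assms n])
    then have k'[simp]: "?k \<in> carrier (PSh Q X)" by (simp add: opens_carrier_iff)
    have [simp]: "fst ?k = fst n" by (simp add: kan_upper_fst)
    have v[simp]: "snd ?k (x, ()) \<in> Hom (ty X x) (fst n)"
      using PSh_value[OF k' x] by simp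
    note [simp] = qcat_ty[OF X x] PSh_ob[of n Y]
    \<comment> \<open>Composing \<zeta> with evaluation at n is the definition of
      \<open>\<zeta>\<^sup>* n\<close>, so this side needs no estimate.\<close>
    have "dist_comp Q X Y (opens Q (Y, b)) (kappa Q (Y, b)) \<zeta> (x, n) = snd ?k (x, ())"
      by (simp add: kan_upper_apply dist_comp_apply opens_ty kappa_apply cong: image_cong)
    moreover have "dist_comp Q X (opens Q (X, a)) (opens Q (Y, b)) (opens_map Q (X, a) (Y, b) \<zeta>) (kappa Q (X, a)) (x, n)
        \<preceq>[ty X x, fst n] snd ?k (x, ())"
    proof -
      have "comp Q (ty X x) (fst m) (fst n) (carr (PSh Q X) (m, ?k)) (snd m (x, ())) \<preceq>[ty X x, fst n] snd ?k (x, ())"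
        if "m \<in> carrier (opens Q (X, a))" for m
        using PSh_carr_counit[OF X _ k' x, of m] that by (simp add: opens_carrier_iff)
      then show ?thesis
        using dist_comp_apply_le_iff[OF cat(1,3,4) dist(2,4) x n, of "snd ?k (x, ())"]
        by (simp add: opens_ty opens_map_apply kappa_apply)
    qed
    \<comment> \<open>The term of the join with index \<open>?k\<close> suffices: the hom from
      \<open>?k\<close> to itself contains an identity arrow.\<close>
    moreover have "snd ?k (x, ()) \<preceq>[ty X x, fst n]
      dist_comp Q X (opens Q (X, a)) (opens Q (Y, b)) (opens_map Q (X, a) (Y, b) \<zeta>) (kappa Q (X, a)) (x, n)"
    proof -
      have c: "carr (PSh Q X) (?k, ?k) \<in> Hom (fst n) (fst n)"
        using PSh_carr_closed[OF X k' k'] by simp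
      have "snd ?k (x, ()) \<preceq>[ty X x, fst n]
          comp Q (ty X x) (fst n) (fst n) (carr (PSh Q X) (?k, ?k)) (snd ?k (x, ()))"
        using PSh_carr_refl[OF X k'] c by (intro le_comp_left) simp_all
      moreover have "comp Q (ty X x) (fst n) (fst n) (carr (PSh Q X) (?k, ?k)) (snd ?k (x, ())) \<preceq>[ty X x, fst n]
          dist_comp Q X (opens Q (X, a)) (opens Q (Y, b)) (opens_map Q (X, a) (Y, b) \<zeta>) (kappa Q (X, a)) (x, n)"
        using dist_comp_upper[OF cat(1,3,4) dist(2,4) x k n] by (simp add: opens_ty opens_map_apply kappa_apply)
      ultimately show ?thesis
        by (rule le_trans) (use is_dist_closed[OF rhs x n] c in \<open>simp_all add: opens_ty comp_closed\<close>)
    qed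
    ultimately show "dist_comp Q X Y (opens Q (Y, b)) (kappa Q (Y, b)) \<zeta> (x, n) =
      dist_comp Q X (opens Q (X, a)) (opens Q (Y, b)) (opens_map Q (X, a) (Y, b) \<zeta>) (kappa Q (X, a)) (x, n)"
      using is_dist_closed[OF rhs x n] by (auto simp: opens_ty intro: le_antisym)
  qed
qed

lemma opens_map_ident:
  assumes A: "is_int_space Q (X, a)"
  shows "opens_map Q (X, a) (X, a) (carr X) = carr (opens Q (X, a))"
proof (rule dist_eqI)
  note X = int_space_qcat[OF A]
  show "is_dist Q (opens Q (X, a)) (opens Q (X, a)) (opens_map Q (X, a) (X, a) (carr X))"
    by (rule opens_map_dist[OF A A continuous_ident[OF A]])
  show "is_dist Q (opens Q (X, a)) (opens Q (X, a)) (carr (opens Q (X, a)))"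
    by (rule carr_dist[OF opens_qcat[OF X]])
  fix m n assume "m \<in> carrier (opens Q (X, a))" "n \<in> carrier (opens Q (X, a))"
  then show "opens_map Q (X, a) (X, a) (carr X) (m, n) = carr (opens Q (X, a)) (m, n)"
    using kan_upper_ident[OF X, of n] by (simp add: opens_map_apply opens_carr opens_carrier_iff)
qed

text \<open>Each term of the composite is bounded by functoriality of \<open>\<zeta>\<^sup>*\<close>
  and the triangle law in \<open>PSh Q X\<close>. Conversely the bound is reached at the index
  \<open>?v\<close>, that is \<open>\<xi>\<^sup>* k\<close>, which belongs to the opens of
  \<open>Y\<close> because \<xi> is continuous.\<close>

lemma opens_map_comp:
  assumes A: "is_int_space Q (X, a)" and B: "is_int_space Q (Y, b)" and C: "is_int_space Q (Z, c)"
    and \<zeta>: "is_continuous Q (X, a) (Y, b) \<zeta>" and \<xi>: "is_continuous Q (Y, b) (Z, c) \<xi>"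
  shows "opens_map Q (X, a) (Z, c) (dist_comp Q X Y Z \<xi> \<zeta>) =
    dist_comp Q (opens Q (X, a)) (opens Q (Y, b)) (opens Q (Z, c))
      (opens_map Q (Y, b) (Z, c) \<xi>) (opens_map Q (X, a) (Y, b) \<zeta>)" (is "?L = ?R")
proof -
  note X = int_space_qcat[OF A] and Y = int_space_qcat[OF B] and Z = int_space_qcat[OF C]
  note cat = opens_qcat[OF X, of a] opens_qcat[OF Y, of b] opens_qcat[OF Z, of c]
  note dist = opens_map_dist[OF A B \<zeta>] opens_map_dist[OF B C \<xi>]
  note lhs = opens_map_dist[OF A C continuous_comp[OF assms]]
  note rhs = dist_comp_dist[OF cat dist]
  show ?thesis
  proof (rule dist_eqI[OF lhs rhs])
    fix m k assume m[simp]: "m \<in> carrier (opens Q (X, a))" and k[simp]: "k \<in> carrier (opens Q (Z, c))"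
    let ?v = "kan_upper Q Y Z \<xi> k"
    let ?w = "kan_upper Q X Y \<zeta> ?v"
    have m'[simp]: "m \<in> carrier (PSh Q X)" and k'[simp]: "k \<in> carrier (PSh Q Z)"
      using m k by (simp_all add: opens_carrier_iff)
    have v[simp]: "?v \<in> carrier (opens Q (Y, b))" by (rule kan_upper_open[OF B C \<xi> k])
    have w[simp]: "?w \<in> carrier (opens Q (X, a))" by (rule kan_upper_open[OF A B \<zeta> v])
    have v'[simp]: "?v \<in> carrier (PSh Q Y)" and w'[simp]: "?w \<in> carrier (PSh Q X)"
      using v w by (simp_all add: opens_carrier_iff)
    have [simp]: "fst ?v = fst k" "fst ?w = fst k" by (simp_all add: kan_upper_fst)
    have eq: "kan_upper Q X Z (dist_comp Q X Y Z \<xi> \<zeta>) k = ?w"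
      by (rule kan_upper_comp[OF X Y Z continuous_dist[OF \<zeta>] continuous_dist[OF \<xi>] k'])
    note [simp] = PSh_ob[OF m'] PSh_ob[OF k']
    have c: "carr (PSh Q X) (m, ?w) \<in> Hom (fst m) (fst k)"
      using PSh_carr_closed[OF X m' w'] by simp
    have r: "?R (m, k) \<in> Hom (fst m) (fst k)"
      using is_dist_closed[OF rhs m k] by (simp add: opens_ty)
    have "?R (m, k) \<preceq>[fst m, fst k] carr (PSh Q X) (m, ?w)"
    proof -
      have "comp Q (fst m) (fst n) (fst k) (carr (PSh Q Y) (n, ?v)) (carr (PSh Q X) (m, kan_upper Q X Y \<zeta> n))
          \<preceq>[fst m, fst k] carr (PSh Q X) (m, ?w)" if n: "n \<in> carrier (opens Q (Y, b))" for n
      proof -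
        let ?n = "kan_upper Q X Y \<zeta> n"
        have n'[simp]: "n \<in> carrier (PSh Q Y)" using n by (simp add: opens_carrier_iff)
        have n''[simp]: "?n \<in> carrier (PSh Q X)"
          by (rule kan_upper_closed[OF X Y continuous_dist[OF \<zeta>] n'])
        have [simp]: "fst ?n = fst n" by (simp add: kan_upper_fst)
        note [simp] = PSh_ob[OF n']
        have cl: "carr (PSh Q X) (m, ?n) \<in> Hom (fst m) (fst n)" "carr (PSh Q X) (?n, ?w) \<in> Hom (fst n) (fst k)"
            "carr (PSh Q Y) (n, ?v) \<in> Hom (fst n) (fst k)"
          using PSh_carr_closed[OF X m' n''] PSh_carr_closed[OF X n'' w'] PSh_carr_closed[OF Y n' v'] by simp_all
        have "carr (PSh Q Y) (n, ?v) \<preceq>[fst n, fst k] carr (PSh Q X) (?n, ?w)"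
          using kan_upper_carr_le[OF X Y continuous_dist[OF \<zeta>] n' v'] by simp
        then have "comp Q (fst m) (fst n) (fst k) (carr (PSh Q Y) (n, ?v)) (carr (PSh Q X) (m, ?n))
          \<preceq>[fst m, fst k] comp Q (fst m) (fst n) (fst k) (carr (PSh Q X) (?n, ?w)) (carr (PSh Q X) (m, ?n))"
          using cl by (intro comp_mono_left) simp_all
        moreover have "comp Q (fst m) (fst n) (fst k) (carr (PSh Q X) (?n, ?w)) (carr (PSh Q X) (m, ?n))
          \<preceq>[fst m, fst k] carr (PSh Q X) (m, ?w)"
          using PSh_carr_trans[OF X m' n'' w'] by simp
        ultimately show ?thesis
          by (rule le_trans) (use cl c in \<open>simp_all add: comp_closed\<close>)
      qed
      then show ?thesis
        using dist_comp_apply_le_iff[OF cat dist m k, of "carr (PSh Q X) (m, ?w)"] c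
        by (simp add: opens_ty opens_map_apply)
    qed
    moreover have "carr (PSh Q X) (m, ?w) \<preceq>[fst m, fst k] ?R (m, k)"
    proof -
      have cl: "carr (PSh Q Y) (?v, ?v) \<in> Hom (fst k) (fst k)"
        using PSh_carr_closed[OF Y v' v'] by simp
      have "carr (PSh Q X) (m, ?w) \<preceq>[fst m, fst k]
          comp Q (fst m) (fst k) (fst k) (carr (PSh Q Y) (?v, ?v)) (carr (PSh Q X) (m, ?w))"
        using PSh_carr_refl[OF Y v'] cl c by (intro le_comp_left) simp_all
      moreover have "comp Q (fst m) (fst k) (fst k) (carr (PSh Q Y) (?v, ?v)) (carr (PSh Q X) (m, ?w))
          \<preceq>[fst m, fst k] ?R (m, k)"
        using dist_comp_upper[OF cat dist m v k] by (simp add: opens_ty opens_map_apply)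
      ultimately show ?thesis
        by (rule le_trans) (use c cl r in \<open>simp_all add: comp_closed\<close>)
    qed
    ultimately show "?L (m, k) = ?R (m, k)"
      using c r by (auto simp: opens_map_apply eq intro: le_antisym)
  qed
qed

lemma opens_map_mono:
  assumes A: "is_int_space Q (X, a)" and B: "is_int_space Q (Y, b)"
    and \<zeta>: "is_continuous Q (X, a) (Y, b) \<zeta>" "is_continuous Q (X, a) (Y, b) \<zeta>'"
    and le: "dist_le Q X Y \<zeta> \<zeta>'"
  shows "dist_le Q (opens Q (X, a)) (opens Q (Y, b)) (opens_map Q (X, a) (Y, b) \<zeta>) (opens_map Q (X, a) (Y, b) \<zeta>')"
  unfolding dist_le_def
proof (intro ballI)
  note X = int_space_qcat[OF A] and Y = int_space_qcat[OF B] and d = \<zeta>[THEN continuous_dist]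
  fix m n assume mn: "m \<in> carrier (opens Q (X, a))" "n \<in> carrier (opens Q (Y, b))"
  then have mn': "m \<in> carrier (PSh Q X)" "n \<in> carrier (PSh Q Y)"
    by (simp_all add: opens_carrier_iff)
  show "opens_map Q (X, a) (Y, b) \<zeta> (m, n) \<preceq>[ty (opens Q (X, a)) m, ty (opens Q (Y, b)) n]
      opens_map Q (X, a) (Y, b) \<zeta>' (m, n)"
    using PSh_carr_mono_right[OF X mn'(1) kan_upper_closed[OF X Y d(1) mn'(2)]
        kan_upper_closed[OF X Y d(2) mn'(2)] kan_upper_dist_mono[OF X Y d le mn'(2)]] mn mn'
    by (simp add: opens_ty opens_map_apply kan_upper_fst)
qed

lemma Ihat_monotone:
  "monotone_functor (IntDist Q :: (('x, 'o, 'm) int_space, 'x \<times> 'x \<Rightarrow> 'm) quantaloid) (ArrDist Q) (Ihat Q)"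
  (is "monotone_functor ?A ?B ?I")
proof (intro monotone_functor.intro quantaloid_functor.intro quantaloid_functor_axioms.intro
    monotone_functor_axioms.intro ArrDist_quantaloid IntDist_quantaloid)
  fix A :: "('x, 'o, 'm) int_space" assume "A \<in> ob ?A"
  then show "omap ?I A \<in> ob ?B" "amap ?I A A (ident ?A A) = ident ?B (omap ?I A)"
    by (cases A; auto intro: int_space_qcat opens_qcat kappa_dist opens_map_ident)+
next
  fix A B :: "('x, 'o, 'm) int_space" and u
  assume "A \<in> ob ?A" "B \<in> ob ?A" "u \<in> carrier (hom ?A A B)"
  then show "amap ?I A B u \<in> carrier (hom ?B (omap ?I A) (omap ?I B))"
    by (cases A; cases B) (auto intro: continuous_dist opens_map_dist kappa_natural)
next
  fix A B C :: "('x, 'o, 'm) int_space" and u v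
  assume "A \<in> ob ?A" "B \<in> ob ?A" "C \<in> ob ?A" "u \<in> carrier (hom ?A A B)" "v \<in> carrier (hom ?A B C)"
  then show "amap ?I A C (comp ?A A B C v u) =
      comp ?B (omap ?I A) (omap ?I B) (omap ?I C) (amap ?I B C v) (amap ?I A B u)"
    by (cases A; cases B; cases C) (simp add: opens_map_comp)
next
  fix A B :: "('x, 'o, 'm) int_space" and u v
  assume "A \<in> ob ?A" "B \<in> ob ?A" "u \<in> carrier (hom ?A A B)" "v \<in> carrier (hom ?A A B)"
    "u \<sqsubseteq>\<^bsub>hom ?A A B\<^esub> v"
  then show "amap ?I A B u \<sqsubseteq>\<^bsub>hom ?B (omap ?I A) (omap ?I B)\<^esub> amap ?I A B v"
    by (cases A; cases B) (simp add: opens_map_mono)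
qed


section \<open>The retraction\<close>

lemma kan_kappa:
  assumes A: "is_int_space Q (X, a)"
  defines "W \<equiv> opens Q (X, a)"
  shows "compose (carrier (PSh Q X)) (kan_upper Q X W (kappa Q (X, a))) (kan_lower Q X W (kappa Q (X, a))) = a"
proof -
  note X = int_space_qcat[OF A]
  have W: "is_qcat Q W" unfolding W_def by (rule opens_qcat[OF X])
  have d: "is_dist Q X W (kappa Q (X, a))" unfolding W_def by (rule kappa_dist[OF X])
  let ?U = "kan_upper Q X W (kappa Q (X, a))" and ?L = "kan_lower Q X W (kappa Q (X, a))"
  have opP: "n \<in> carrier (PSh Q X)" "a n = n" if "n \<in> carrier W" for n
    using that by (simp_all add: W_def opens_carrier_iff)
  have ty: "ty W n = fst n" if "n \<in> carrier W" for n
    using that unfolding W_def by (rule opens_ty)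
  have kap: "kappa Q (X, a) (x, n) = snd n (x, ())" if "x \<in> carrier X" "n \<in> carrier W" for x n
    using that unfolding W_def by (rule kappa_apply)
  have "?U (?L m) = a m" if m: "m \<in> carrier (PSh Q X)" for m
  proof -
    note [simp] = m X W d
    have L[simp]: "?L m \<in> carrier (PSh Q W)" by (simp add: kan_lower_closed)
    have U[simp]: "?U (?L m) \<in> carrier (PSh Q X)" by (simp add: kan_upper_closed)
    have am[simp]: "a m \<in> carrier (PSh Q X)" by (rule int_space_closed[OF A m])
    have amW: "a m \<in> carrier W" by (simp add: W_def opens_carrier_iff int_space_idem[OF A])
    have f[simp]: "fst (?L m) = fst m" "fst (?U (?L m)) = fst m" "fst (a m) = fst m"
      by (simp_all add: kan_lower_fst kan_upper_fst int_space_fst[OF A])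
    note [simp] = PSh_ob[OF m]
    \<comment> \<open>The residual by evaluation is a meet over x of m(x) \<swarrow> n(x), which is
      the very formula for the hom from n to m.\<close>
    have Lval: "snd (?L m) (n, ()) = carr (PSh Q X) (n, m)" if n: "n \<in> carrier W" for n
      using n opP(1)[OF n] by (simp add: kan_lower_apply PSh_carr dist_lres_apply ty kap cong: image_cong)
    have Uval: "snd (?U (?L m)) (x, ()) = dist_comp Q X W (point Q (fst m)) (snd (?L m)) (kappa Q (X, a)) (x, ())" for x
      using kan_upper_apply[OF L, of X "kappa Q (X, a)"] by simp
    have dL: "is_dist Q W (point Q (fst m)) (snd (?L m))"
      using PSh_dist[OF L] by simp
    note cat = X W point_qcat[OF PSh_ob[OF m]]
    have "snd (?U (?L m)) (x, ()) = snd (a m) (x, ())" if x[simp]: "x \<in> carrier X" for x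
    proof -
      have v: "snd (a m) (x, ()) \<in> Hom (ty X x) (fst m)" "snd (?U (?L m)) (x, ()) \<in> Hom (ty X x) (fst m)"
        using PSh_value[OF am x] PSh_value[OF U x] by simp_all
      note [simp] = qcat_ty[OF X x]
      have "comp Q (ty X x) (fst n) (fst m) (carr (PSh Q X) (n, m)) (snd n (x, ())) \<preceq>[ty X x, fst m] snd (a m) (x, ())"
        if n: "n \<in> carrier W" for n
      proof -
        note n' = opP[OF n]
        note [simp] = PSh_ob[OF n'(1)] PSh_value[OF n'(1) x]
        have cl: "carr (PSh Q X) (n, m) \<in> Hom (fst n) (fst m)" "carr (PSh Q X) (n, a m) \<in> Hom (fst n) (fst m)"
          using PSh_carr_closed[OF X n'(1) m] PSh_carr_closed[OF X n'(1) am] by simp_all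
        \<comment> \<open>Here \<open>a\<close> is used as a functor on homs, which is more than
          monotonicity: n and m may have different types and then are not comparable in the
          preorder.\<close>
        have "carr (PSh Q X) (n, m) \<preceq>[fst n, fst m] carr (PSh Q X) (a n, a m)"
          using int_space_functor[OF A] n'(1) by (simp add: is_qfunctor_def PSh_ty)
        then have "carr (PSh Q X) (n, m) \<preceq>[fst n, fst m] carr (PSh Q X) (n, a m)"
          by (simp add: n'(2))
        then have "comp Q (ty X x) (fst n) (fst m) (carr (PSh Q X) (n, m)) (snd n (x, ())) \<preceq>[ty X x, fst m]
            comp Q (ty X x) (fst n) (fst m) (carr (PSh Q X) (n, a m)) (snd n (x, ()))"
          using cl by (intro comp_mono_left) simp_all
        moreover have "comp Q (ty X x) (fst n) (fst m) (carr (PSh Q X) (n, a m)) (snd n (x, ()))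
            \<preceq>[ty X x, fst m] snd (a m) (x, ())"
          using PSh_carr_counit[OF X n'(1) am x] by simp
        ultimately show ?thesis
          by (rule le_trans) (use cl v in \<open>simp_all add: comp_closed\<close>)
      qed
      then have "snd (?U (?L m)) (x, ()) \<preceq>[ty X x, fst m] snd (a m) (x, ())"
        using dist_comp_apply_le_iff[OF cat d dL x, of "()" "snd (a m) (x, ())"] v(1)
        by (simp add: Uval ty kap Lval)
      moreover have "snd (a m) (x, ()) \<preceq>[ty X x, fst m] snd (?U (?L m)) (x, ())"
      proof -
        have cl: "carr (PSh Q X) (a m, m) \<in> Hom (fst m) (fst m)"
          using PSh_carr_closed[OF X am m] by simp
        \<comment> \<open>The inequality a m \<le> m says that the hom from \<open>a m\<close> to
          \<open>m\<close> contains the identity, so the term of the join with index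
          \<open>a m\<close> already dominates \<open>a m\<close>.\<close>
        have "ident Q (fst m) \<preceq>[fst m, fst m] carr (PSh Q X) (a m, m)"
          using int_space_le[OF A m] by (simp add: qcat_le_def PSh_ty)
        then have "snd (a m) (x, ()) \<preceq>[ty X x, fst m]
            comp Q (ty X x) (fst m) (fst m) (carr (PSh Q X) (a m, m)) (snd (a m) (x, ()))"
          using cl v by (intro le_comp_left) simp_all
        moreover have "comp Q (ty X x) (fst m) (fst m) (carr (PSh Q X) (a m, m)) (snd (a m) (x, ()))
            \<preceq>[ty X x, fst m] snd (?U (?L m)) (x, ())"
          using dist_comp_upper[OF cat d dL x amW, of "()"] amW by (simp add: Uval ty kap Lval)
        ultimately show ?thesis
          by (rule le_trans) (use cl v in \<open>simp_all add: comp_closed\<close>)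
      qed
      ultimately show ?thesis
        using v by (auto intro: le_antisym)
    qed
    then have "snd (?U (?L m)) = snd (a m)"
      using PSh_dist[OF U] PSh_dist[OF am] by (intro dist_eqI[of Q X "point Q (fst m)"]) auto
    then show ?thesis
      by (intro prod_eqI) simp_all
  qed
  moreover have "a \<in> extensional (carrier (PSh Q X))"
    using int_space_functor[OF A] by (simp add: is_qfunctor_def PiE_def)
  ultimately show ?thesis
    by (auto simp: compose_def fun_eq_iff extensional_def)
qed

lemma Khat_Ihat_identity:
  "identity_on (IntDist Q :: (('x, 'o, 'm) int_space, 'x \<times> 'x \<Rightarrow> 'm) quantaloid)
    (functor_comp (Khat Q) (Ihat Q))"
  by (auto simp: identity_on_def functor_comp_def kan_kappa)

end

theorem proposition5p6:
  fixes Q :: "('o, 'm) quantaloid"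
  assumes "quantaloid Q"
  shows
    "quantaloid_hom (ArrDist Q :: (('x, 'y, 'o, 'm) dist_ob, ('x, 'y, 'm) dist_arr) quantaloid)
       (IntDist Q) (Khat Q)
     \<and> monotone_functor (IntDist Q :: (('x, 'o, 'm) int_space, 'x \<times> 'x \<Rightarrow> 'm) quantaloid)
       (ArrDist Q) (Ihat Q)
     \<and> identity_on (IntDist Q :: (('x, 'o, 'm) int_space, 'x \<times> 'x \<Rightarrow> 'm) quantaloid)
       (functor_comp (Khat Q) (Ihat Q))
     \<and> retract_of (IntDist Q :: (('x, 'o, 'm) int_space, 'x \<times> 'x \<Rightarrow> 'm) quantaloid)
       (ArrDist Q ::
         (('x, ('x, 'o, 'm) presheaf, 'o, 'm) dist_ob, ('x, ('x, 'o, 'm) presheaf, 'm) dist_arr)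
           quantaloid)"
proof -
  interpret quantaloid Q by fact
  show ?thesis
    unfolding retract_of_def
    \<comment> \<open>The section and the retraction in \<open>retract_of\<close> stay schematic
      until \<open>Ihat_monotone\<close> and \<open>Khat_hom\<close> fix them; the latter is then
      used with presheaves as the second element type, whereas the first conjunct leaves that type
      arbitrary.\<close>
    by (intro conjI exI) (rule Khat_hom Ihat_monotone Khat_Ihat_identity)+
qed

end
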